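(* There exist absolute constants $c\in(0,1)$, $c'>0$ (the parameters of the class $\Theta_A$) and $c_1,c_2,c_3>0$ such that the following holds. Let $n,N,p,K,\tau$ be positive integers with $n\ge K\ge\tau>1$, $\tau\le c_1N$ and $pK\le c_2\,nN$, and let $i\neq j\in\{1,\dots,n\}$. Let $d$ be a metric on $\Delta_p$ such that, for some $0<c_d\le C_d<\infty$, $c_d\|u-v\|_1\le 2d(u,v)\le C_d\|u-v\|_1$ for all $u,v\in\Delta_p$. Then, for every $A_0\in\Theta_A$, $$\inf_{\widehat W}\ \sup\ \mathbb{E}\bigl|\widehat W-W(\boldsymbol\alpha^{(i)},\boldsymbol\alpha^{(j)};d)\bigr|\ \ge\ c_3\,\frac{c_d^2}{C_d}\left(\overline\kappa_\tau(A_0)^2\sqrt{\frac{\tau}{N\log^2(\tau)}}+\sqrt{\frac{pK}{nN\log^2(p)}}\right),$$ where the infimum is over all estimators $\widehat W$ based on the observed data $Y^{(1)},\dots,Y^{(n)}$ and the supremum is over all topic models with $A\in\Theta_A$ and $\alpha^{(i)},\alpha^{(j)}\in\Theta_\alpha(\tau)$.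
   Context: $\Delta_m$ is the probability simplex in $\mathbb{R}^m$; $\|\cdot\|_0$ counts nonzero entries. Topic model: one observes independent $Y^{(\ell)}\sim\mathrm{Multinomial}_p(N,r^{(\ell)})$, $\ell=1,\dots,n$, with $r^{(\ell)}=A\alpha^{(\ell)}$, where $A=[A_1,\dots,A_K]\in\mathbb{R}^{p\times K}$ has columns $A_k\in\Delta_p$ (rows are denoted $A_{j\cdot}$), $\alpha^{(\ell)}\in\Delta_K$, and $T=[\alpha^{(1)},\dots,\alpha^{(n)}]$ has rank $K$. The mixing measure of document $\ell$ is $\boldsymbol\alpha^{(\ell)}=\sum_{k=1}^K\alpha^{(\ell)}_k\delta_{A_k}$, a probability measure on $(\Delta_p,d)$, and $W(\cdot,\cdot;d)$ is the order-1 Wasserstein distance with ground metric $d$. An index $j\in\{1,\dots,p\}$ is an anchor word of topic $k$ if $A_{jk}>0$ and $A_{jk'}=0$ for all $k'\ne k$; the anchor word assumption says every topic $k\in\{1,\dots,K\}$ has at least one anchor word. Let $m$ be the total number of anchor words. $\Theta_A$ is the set of $A$ with columns in $\Delta_p$, $\min_{j}\|A_{j\cdot}\|_\infty\ge c'/p$, satisfying the anchor word assumption with $m\le c\,p$. $\Theta_\alpha(\tau)=\{\alpha\in\Delta_K:\|\alpha\|_0\le\tau\}$. For a matrix $B$ with $K$ columns and $1\le k\le K$, $\kappa(B,k)=\min_{S\subseteq\{1,\dots,K\},|S|\le k}\ \min_{v\in\mathcal C(S)}\|Bv\|_1/\|v\|_1$ with $\mathcal C(S)=\{v\in\mathbb{R}^K\setminus\{0\}:\|v_S\|_1\ge\|v_{S^c}\|_1\}$.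 For $\alpha\in\Delta_K$ let $\overline J(\alpha)=\{j:(A\alpha)_j>0\}$ and let $A_{\overline J}$ be the submatrix of $A$ with rows in $\overline J$. Then $\overline\kappa_\tau(A)=\min_{\alpha\in\Theta_\alpha(\tau)}\kappa(A_{\overline J(\alpha)},\|\alpha\|_0)$. *)

theory Defs
  imports
    "HOL-Probability.Probability"
    "Jordan_Normal_Form.Matrix"
    "Jordan_Normal_Form.DL_Rank"
    "Jordan_Normal_Form.DL_Submatrix"
begin

unbundle no vec_syntax

text \<open>
  Words, topics and documents are indexed from 0. A word-topic matrix is \<open>A \<in> carrier_mat p K\<close>,
  a topic-document matrix is \<open>T \<in> carrier_mat K n\<close>, and the topic weights of document \<open>l\<close> are
  \<open>col T l\<close>.
\<close>

definition prob_simplex :: "nat \<Rightarrow> real vec set" where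
  "prob_simplex m = {v \<in> carrier_vec m. (\<forall>i<m. 0 \<le> v $ i) \<and> (\<Sum>i<m. v $ i) = 1}"

definition l0_norm :: "real vec \<Rightarrow> nat" where
  "l0_norm v = card {i. i < dim_vec v \<and> v $ i \<noteq> 0}"

definition l1_norm :: "real vec \<Rightarrow> real" where
  "l1_norm v = (\<Sum>i<dim_vec v. \<bar>v $ i\<bar>)"

definition linf_norm :: "real vec \<Rightarrow> real" where
  "linf_norm v = Max ((\<lambda>i. \<bar>v $ i\<bar>) ` {..<dim_vec v})"

text \<open>The distribution on indices with weights \<open>v\<close>; meaningful for \<open>v \<in> prob_simplex m\<close>.\<close>

definition pmf_of_vec :: "real vec \<Rightarrow> nat pmf" where
  "pmf_of_vec v = embed_pmf (\<lambda>i. if i < dim_vec v then v $ i else 0)"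

lemma pmf_pmf_of_vec:
  assumes "v \<in> prob_simplex m"
  shows "pmf (pmf_of_vec v) i = (if i < m then v $ i else 0)"
proof -
  have dim: "dim_vec v = m" and nonneg: "\<And>i. i < m \<Longrightarrow> 0 \<le> v $ i"
    and sum: "(\<Sum>i<m. v $ i) = 1"
    using assms by (auto simp: prob_simplex_def)
  have "(\<integral>\<^sup>+i. ennreal (if i < m then v $ i else 0) \<partial>count_space UNIV)
      = (\<integral>\<^sup>+i. ennreal (v $ i) \<partial>count_space {..<m})"
    by (subst nn_integral_count_space_indicator)
       (auto intro!: nn_integral_cong simp: indicator_def)
  also have "\<dots> = 1"
    using nonneg sum sum_ennreal[of "{..<m}" "\<lambda>i. v $ i"]
    by (simp add: nn_integral_count_space_finite)
  finally show ?thesis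
    unfolding pmf_of_vec_def dim by (subst pmf_embed_pmf) (auto simp: nonneg)
qed

text \<open>The vector of counts in \<open>N\<close> independent draws from the category distribution \<open>r\<close>.\<close>

definition multinomial_pmf :: "nat \<Rightarrow> real vec \<Rightarrow> nat vec pmf" where
  "multinomial_pmf N r =
     map_pmf (\<lambda>xs. vec (dim_vec r) (\<lambda>j. count_list xs j)) (replicate_pmf N (pmf_of_vec r))"

text \<open>The joint law of the \<open>n\<close> independent count vectors; entries with index \<open>\<ge> n\<close> are padding.\<close>

definition topic_data_pmf :: "nat \<Rightarrow> real mat \<Rightarrow> real mat \<Rightarrow> (nat \<Rightarrow> nat vec) pmf" where
  "topic_data_pmf N A T =
     Pi_pmf {..<dim_col T} (0\<^sub>v (dim_row A)) (\<lambda>l. multinomial_pmf N (A *\<^sub>v col T l))"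

definition mixing_measure :: "real mat \<Rightarrow> real vec \<Rightarrow> real vec pmf" where
  "mixing_measure A \<alpha> = map_pmf (col A) (pmf_of_vec \<alpha>)"

definition wasserstein :: "('a \<Rightarrow> 'a \<Rightarrow> real) \<Rightarrow> 'a pmf \<Rightarrow> 'a pmf \<Rightarrow> real" where
  "wasserstein d \<mu> \<nu> =
     (INF \<gamma>\<in>{\<gamma>. map_pmf fst \<gamma> = \<mu> \<and> map_pmf snd \<gamma> = \<nu>}.
        measure_pmf.expectation \<gamma> (\<lambda>(x, y). d x y))"

definition is_anchor_word :: "real mat \<Rightarrow> nat \<Rightarrow> nat \<Rightarrow> bool" where
  "is_anchor_word A j k \<longleftrightarrow>
     j < dim_row A \<and> k < dim_col A \<and> 0 < A $$ (j, k) \<and>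
     (\<forall>k'<dim_col A. k' \<noteq> k \<longrightarrow> A $$ (j, k') = 0)"

definition Theta_A :: "real \<Rightarrow> real \<Rightarrow> nat \<Rightarrow> nat \<Rightarrow> real mat set" where
  "Theta_A c c' p K =
     {A \<in> carrier_mat p K.
        (\<forall>k<K. col A k \<in> prob_simplex p) \<and>
        (\<forall>j<p. c' / real p \<le> linf_norm (row A j)) \<and>
        (\<forall>k<K. \<exists>j. is_anchor_word A j k) \<and>
        real (card {j. \<exists>k. is_anchor_word A j k}) \<le> c * real p}"

definition Theta_alpha :: "nat \<Rightarrow> nat \<Rightarrow> real vec set" where
  "Theta_alpha K \<tau> = {\<alpha> \<in> prob_simplex K. l0_norm \<alpha> \<le> \<tau>}"

text \<open>
  The topic models with \<open>n\<close> documents in which documents \<open>i\<close> and \<open>j\<close> have \<open>\<tau>\<close>-sparse weights.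
\<close>

definition topic_models ::
    "real \<Rightarrow> real \<Rightarrow> nat \<Rightarrow> nat \<Rightarrow> nat \<Rightarrow> nat \<Rightarrow> nat \<Rightarrow> nat \<Rightarrow> (real mat \<times> real mat) set" where
  "topic_models c c' n p K \<tau> i j =
     {(A, T). A \<in> Theta_A c c' p K \<and> T \<in> carrier_mat K n \<and>
        (\<forall>l<n. col T l \<in> prob_simplex K) \<and> vec_space.rank K T = K \<and>
        col T i \<in> Theta_alpha K \<tau> \<and> col T j \<in> Theta_alpha K \<tau>}"

definition sparse_cone :: "nat \<Rightarrow> nat set \<Rightarrow> real vec set" where
  "sparse_cone K S =
     {v \<in> carrier_vec K. v \<noteq> 0\<^sub>v K \<and> (\<Sum>k\<in>{..<K} - S. \<bar>v $ k\<bar>) \<le> (\<Sum>k\<in>S. \<bar>v $ k\<bar>)}"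

text \<open>
  The iterated minimum over \<open>S\<close> and \<open>v\<close> is written as one infimum over all pairs, because
  \<open>sparse_cone K {} = {}\<close> and \<open>Inf\<close> of the empty set of reals is unspecified. The set below is
  nonempty for \<open>k \<ge> 1\<close> and \<open>dim_col B \<ge> 1\<close>, and the infimum is attained by compactness.
\<close>

definition kappa :: "real mat \<Rightarrow> nat \<Rightarrow> real" where
  "kappa B k =
     Inf {l1_norm (B *\<^sub>v v) / l1_norm v | S v.
            S \<subseteq> {..<dim_col B} \<and> card S \<le> k \<and> v \<in> sparse_cone (dim_col B) S}"

definition J_bar :: "real mat \<Rightarrow> real vec \<Rightarrow> nat set" where
  "J_bar A \<alpha> = {j. j < dim_row A \<and> 0 < (A *\<^sub>v \<alpha>) $ j}"

text \<open>
  The infimum is a minimum: for entrywise nonnegative \<open>A\<close> the term depends on \<open>\<alpha>\<close> only through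
  its support.
\<close>

definition kappa_bar :: "nat \<Rightarrow> real mat \<Rightarrow> real" where
  "kappa_bar \<tau> A =
     (INF \<alpha>\<in>Theta_alpha (dim_col A) \<tau>.
        kappa (submatrix A (J_bar A \<alpha>) {..<dim_col A}) (l0_norm \<alpha>))"

text \<open>
  The data are discrete, so every function of them is measurable and is an admissible estimator.
  The risk is an extended nonnegative real, so the supremum and infimum need no side conditions.
\<close>

definition minimax_risk ::
    "(real vec \<Rightarrow> real vec \<Rightarrow> real) \<Rightarrow> nat \<Rightarrow> (real mat \<times> real mat) set \<Rightarrow> nat \<Rightarrow> nat \<Rightarrow> ennreal" where
  "minimax_risk d N M i j =
     (INF W :: (nat \<Rightarrow> nat vec) \<Rightarrow> real. SUP (A, T)\<in>M.
        \<integral>\<^sup>+Y. ennreal \<bar>W Y - wasserstein d (mixing_measure A (col T i)) (mixing_measure A (col T j))\<bar>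
          \<partial>measure_pmf (topic_data_pmf N A T))"

end

theory Submission
  imports Defs
begin

text \<open>
  The bound comes from a random perturbation \<open>X\<close> that is hidden in the word law of document \<open>i\<close> only.
  On the \<open>k\<close>-th of \<open>H\<close> pairs of words, document \<open>j\<close> has frequencies \<open>(b, b)\<close> and document \<open>i\<close> has
  \<open>(b (1 + \<epsilon> X k), b (1 - \<epsilon> X k))\<close>. The topic matrix is free to depend on \<open>X\<close>: topics 0 and 1 are the
  points in which the line through the two word laws leaves the simplex. Hence the topics differ a lot
  although the documents differ little, the pair with the largest \<open>\<bar>X k\<bar>\<close> supplies an anchor word for
  each of the two topics, and the Wasserstein distance of the two documents is their difference in
  weight times \<open>d\<close> of the end points. It therefore lies between \<open>cd / 2\<close> and \<open>Cd / 2\<close> times the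
  \<open>l1\<close>-distance of the word laws (\<open>ex_hypothesis\<close>), with no additive error from the anchor words.
  All documents other than \<open>i\<close> have laws that do not depend on \<open>X\<close>, so an estimator has to
  find the size of \<open>X\<close> from the \<open>N\<close> words of document \<open>i\<close>.

  The coordinates of \<open>X\<close> are drawn from one of two priors on \<open>[-1, 1]\<close> with equal moments up to order
  \<open>2 m + 1\<close>, one with mean absolute value at most of order \<open>\<alpha>\<^sup>2 / m\<close>, the other at least of order \<open>\<alpha> / m\<close>
  (\<open>matched_priors\<close>). With \<open>\<alpha>\<close> a small multiple of \<open>cd / Cd\<close> the gap survives the factor \<open>Cd / cd\<close>
  between the two bounds on the Wasserstein distance; the lost factor \<open>\<alpha>\<close> is the reason for
  \<open>cd\<^sup>2 / Cd\<close> in place of \<open>cd\<close>. The priors are explicit. The alternating binomial weights on the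
  integers annihilate even polynomials of low degree, and still do so after division by
  \<open>(x\<^sup>2 - 1/4) (x\<^sup>2 - \<alpha>\<^sup>2)\<close> once the points \<open>1/2\<close> and \<open>\<alpha>\<close> are added. The division concentrates all but
  \<open>O(\<alpha>\<^sup>2)\<close> of the mass on the points \<open>0\<close> and \<open>\<alpha>\<close>, with opposite signs.

  Replacing one prior by the other in a single coordinate changes the law of the sample by a
  difference whose second moment relative to the unperturbed law is an exact binomial sum over the
  squared differences of the moments; all terms below order \<open>2 m + 2\<close> vanish (\<open>matched_mixture_bound\<close>).
  For \<open>N \<epsilon>\<^sup>2 \<le> H / 8\<close> each of the replacements costs \<open>O(16 ^ - m)\<close>, so \<open>m\<close> of order \<open>ln H\<close>
  makes the two joint laws indistinguishable, and \<open>fuzzy_hypotheses\<close> turns this into a lower bound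
  of order \<open>cd\<^sup>2 / Cd * \<epsilon> / m\<close> on the risk (\<open>minimax_risk_lower_bound\<close>).

  About \<open>\<tau>\<close> pairs and \<open>\<epsilon>\<close> of order \<open>sqrt (\<tau> / N)\<close> give the first rate, because \<open>kappa_bar\<close> is at most 1;
  about \<open>p / 8\<close> pairs and \<open>\<epsilon>\<close> of order \<open>sqrt (p K / (n N))\<close> give the second one.
\<close>

section \<open>Central finite differences of even powers\<close>

text \<open>
  The \<open>n\<close>-th finite difference kills polynomials of degree below \<open>n\<close>. In the induction, Pascal's rule
  turns the sum into the sum for \<open>n\<close> of a first difference, which has lower degree.
\<close>

lemma alternating_binomial_power_sum:
  "t < n \<Longrightarrow> (\<Sum>k\<le>n. (-1) ^ k * real (n choose k) * real k ^ t) = 0"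
proof (induction n arbitrary: t)
  case 0
  then show ?case by simp
next
  case (Suc n)
  let ?a = "\<lambda>k. (-1) ^ k * real (n choose k)"
  have "(\<Sum>k\<le>Suc n. (-1) ^ k * real (Suc n choose k) * real k ^ t)
      = (\<Sum>k\<le>Suc n. ?a k * real k ^ t) + (\<Sum>k\<in>{1..Suc n}. (-1) ^ k * real (n choose (k - 1)) * real k ^ t)"
  proof -
    have "(\<Sum>k\<le>Suc n. (-1) ^ k * real (Suc n choose k) * real k ^ t)
      = (\<Sum>k\<le>Suc n. ?a k * real k ^ t + (if k = 0 then 0 else (-1) ^ k * real (n choose (k - 1)) * real k ^ t))"
      by (intro sum.cong refl) (auto simp: choose_reduce_nat algebra_simps)
    also have "\<dots> = (\<Sum>k\<le>Suc n. ?a k * real k ^ t)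
        + (\<Sum>k\<le>Suc n. (if k = 0 then 0 else (-1) ^ k * real (n choose (k - 1)) * real k ^ t))"
      by (simp only: sum.distrib)
    also have "(\<Sum>k\<le>Suc n. (if k = 0 then 0 else (-1) ^ k * real (n choose (k - 1)) * real k ^ t))
        = (\<Sum>k\<in>{1..Suc n}. (-1) ^ k * real (n choose (k - 1)) * real k ^ t)"
      by (intro sum.mono_neutral_cong_right) auto
    finally show ?thesis .
  qed
  also have "(\<Sum>k\<le>Suc n. ?a k * real k ^ t) = (\<Sum>k\<le>n. ?a k * real k ^ t)"
    by simp
  also have "(\<Sum>k\<in>{1..Suc n}. (-1) ^ k * real (n choose (k - 1)) * real k ^ t)
      = - (\<Sum>k\<le>n. ?a k * real (Suc k) ^ t)"
    unfolding sum_negf[symmetric]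
    by (rule sum.reindex_bij_witness[of _ Suc "\<lambda>k. k - 1"]) (auto simp: Suc_le_eq gr0_conv_Suc)
  also have "(\<Sum>k\<le>n. ?a k * real k ^ t) + - (\<Sum>k\<le>n. ?a k * real (Suc k) ^ t)
      = - (\<Sum>k\<le>n. \<Sum>s<t. real (t choose s) * (?a k * real k ^ s))"
  proof -
    have "?a k * real (Suc k) ^ t = ?a k * real k ^ t + (\<Sum>s<t. real (t choose s) * (?a k * real k ^ s))" for k
    proof -
      have "real (Suc k) ^ t = (\<Sum>s\<le>t. real (t choose s) * real k ^ s)"
        using binomial_ring[of "real k" 1 t] by (simp add: add.commute)
      also have "\<dots> = real k ^ t + (\<Sum>s<t. real (t choose s) * real k ^ s)"
        by (simp add: lessThan_Suc_atMost[symmetric])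
      finally show ?thesis
        by (simp add: algebra_simps sum_distrib_left)
    qed
    then show ?thesis by (simp add: sum.distrib)
  qed
  also have "\<dots> = - (\<Sum>s<t. real (t choose s) * (\<Sum>k\<le>n. ?a k * real k ^ s))"
    by (subst sum.swap) (simp add: sum_distrib_left)
  also have "\<dots> = 0" using Suc by (auto intro!: sum.neutral)
  finally show ?case .
qed

text \<open>
  The central finite difference of order \<open>2 m\<close>, with the weights of \<open>j\<close> and \<open>- j\<close> added and the weight of
  0 normalised to 1.
\<close>

definition central_weight :: "nat \<Rightarrow> nat \<Rightarrow> real" where
  "central_weight m j = (if j = 0 then 1 else 2 * (-1) ^ j * real ((2 * m) choose (m + j)) / real ((2 * m) choose m))"

lemma abs_central_weight_le: "\<bar>central_weight m j\<bar> \<le> 2"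
proof -
  have "real ((2 * m) choose (m + j)) \<le> real ((2 * m) choose m)"
    using binomial_maximum'[of m "m + j"] by simp
  moreover have "0 < real ((2 * m) choose m)" by simp
  ultimately show ?thesis
    by (auto simp: central_weight_def abs_mult power_abs divide_simps simp del: zero_less_binomial_iff of_nat_0_less_iff)
qed

lemma central_weight_moments:
  assumes "t < m"
  shows "(\<Sum>j\<le>m. central_weight m j * (real j ^ 2) ^ t) = 0"
proof -
  let ?C = "real ((2 * m) choose m)"
  let ?f = "\<lambda>k. (-1) ^ k * real ((2 * m) choose k) * ((real k - real m) ^ 2) ^ t"
  have C: "?C > 0" by simp
  have "(\<Sum>k\<le>2*m. ?f k)
      = (\<Sum>k\<le>2*m. \<Sum>s\<le>2*t. (real (2*t choose s) * (- real m) ^ (2*t - s)) * ((-1) ^ k * real ((2 * m) choose k) * real k ^ s))"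
  proof (intro sum.cong refl)
    fix k
    have "((real k - real m) ^ 2) ^ t = (real k + - real m) ^ (2 * t)"
      by (simp add: power_mult)
    also have "\<dots> = (\<Sum>s\<le>2*t. real (2*t choose s) * real k ^ s * (- real m) ^ (2*t - s))"
      by (rule binomial_ring)
    finally show "?f k = (\<Sum>s\<le>2*t. (real (2*t choose s) * (- real m) ^ (2*t - s)) * ((-1) ^ k * real ((2 * m) choose k) * real k ^ s))"
      by (simp only: sum_distrib_left) (simp add: mult_ac)
  qed
  also have "\<dots> = (\<Sum>s\<le>2*t. (real (2*t choose s) * (- real m) ^ (2*t - s)) * (\<Sum>k\<le>2*m. (-1) ^ k * real ((2 * m) choose k) * real k ^ s))"
    by (subst sum.swap) (simp add: sum_distrib_left)
  also have "\<dots> = 0"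
    using assms by (intro sum.neutral) (auto simp: alternating_binomial_power_sum)
  finally have 0: "(\<Sum>k\<le>2*m. ?f k) = 0" .
  have "{..2*m} = {..<m} \<union> ({m} \<union> {m<..2*m})" by auto
  then have "(\<Sum>k\<le>2*m. ?f k) = (\<Sum>k<m. ?f k) + (?f m + (\<Sum>k\<in>{m<..2*m}. ?f k))"
    by (simp only:) (subst sum.union_disjoint; auto)+
  also have "(\<Sum>k<m. ?f k) = (\<Sum>j\<in>{1..m}. ?f (m - j))"
    by (rule sum.reindex_bij_witness[of _ "\<lambda>j. m - j" "\<lambda>j. m - j"]) auto
  also have "\<dots> = (\<Sum>j\<in>{1..m}. ?f (m + j))"
  proof (intro sum.cong refl)
    fix j assume j: "j \<in> {1..m}"
    have 1: "(2 * m) choose (m - j) = (2 * m) choose (m + j)"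
      using j binomial_symmetric[of "m - j" "2 * m"] by (simp add: mult_2)
    have 2: "(-1::real) ^ (m - j) = (-1) ^ (m + j)"
      using j by (simp add: minus_one_power_iff)
    have 3: "(real (m - j) - real m) ^ 2 = (real (m + j) - real m) ^ 2"
      using j by (simp add: of_nat_diff)
    show "?f (m - j) = ?f (m + j)" unfolding 1 2 3 ..
  qed
  also have "(\<Sum>k\<in>{m<..2*m}. ?f k) = (\<Sum>j\<in>{1..m}. ?f (m + j))"
    by (rule sum.reindex_bij_witness[of _ "\<lambda>j. m + j" "\<lambda>j. j - m"]) auto
  finally have "?f m + 2 * (\<Sum>j\<in>{1..m}. ?f (m + j)) = 0"
    using 0 by simp
  then have "(-1) ^ m / ?C * (?f m + 2 * (\<Sum>j\<in>{1..m}. ?f (m + j))) = 0" by simp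
  moreover have "(-1) ^ m / ?C * ?f m = central_weight m 0 * (real 0 ^ 2) ^ t"
  proof -
    have "(-1) ^ m * ((-1::real) ^ m * c) = c" for c
      by (simp add: minus_one_power_iff)
    then show ?thesis using C by (simp add: central_weight_def)
  qed
  moreover have "(-1) ^ m / ?C * (2 * (\<Sum>j\<in>{1..m}. ?f (m + j)))
      = (\<Sum>j\<in>{1..m}. central_weight m j * (real j ^ 2) ^ t)"
    unfolding sum_distrib_left
    by (intro sum.cong refl) (simp add: central_weight_def power_add minus_one_power_iff)
  moreover have "{..m} = insert 0 {1..m}" by auto
  moreover have "(\<Sum>j\<le>m. central_weight m j * (real j ^ 2) ^ t) =
      central_weight m 0 * (real 0 ^ 2) ^ t + (\<Sum>j\<in>{1..m}. central_weight m j * (real j ^ 2) ^ t)"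
    unfolding \<open>{..m} = insert 0 {1..m}\<close> by (subst sum.insert) auto
  ultimately show ?thesis by (simp only: distrib_left)
qed

lemma sum_inverse_quarter_le: "(\<Sum>j\<in>{1..m}. 1 / (real j ^ 2 - 1/4)) \<le> 2"
proof -
  have "(\<Sum>j\<in>{1..m}. 1 / (real j ^ 2 - 1/4)) = 2 - 1 / (real m + 1/2)"
  proof (induction m)
    case 0 then show ?case by simp
  next
    case (Suc m)
    have "1 / (real (Suc m) ^ 2 - 1/4) = 1 / (real m + 1/2) - 1 / (real (Suc m) + 1/2)"
    proof -
      have "real (Suc m) ^ 2 - 1/4 = (real m + 1/2) * (real (Suc m) + 1/2)"
        by (simp add: power2_eq_square algebra_simps)
      moreover have "real m + 1/2 > 0" "real (Suc m) + 1/2 > 0" by simp_all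
      ultimately show ?thesis by (simp add: field_simps)
    qed
    with Suc show ?case by simp
  qed
  then show ?thesis by simp
qed

definition resolvent_sum :: "nat \<Rightarrow> real \<Rightarrow> real" where
  "resolvent_sum m c = (\<Sum>j\<le>m. central_weight m j / (real j ^ 2 - c))"

text \<open>
  Dividing the weights by \<open>j\<^sup>2 - c\<close> leaves only the moments of a point mass at \<open>c\<close>: the quotient
  \<open>(y ^ t - c ^ t) / (y - c)\<close> is a polynomial in \<open>y\<close> of degree below \<open>t\<close>, which the weights annihilate.
\<close>

lemma resolvent_moments:
  assumes "t \<le> m" and c: "\<And>j::nat. real j ^ 2 \<noteq> c"
  shows "(\<Sum>j\<le>m. central_weight m j * (real j ^ 2) ^ t / (real j ^ 2 - c)) = c ^ t * resolvent_sum m c"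
  using assms(1)
proof (induction t)
  case 0 then show ?case by (simp add: resolvent_sum_def)
next
  case (Suc t)
  have "(\<Sum>j\<le>m. central_weight m j * (real j ^ 2) ^ Suc t / (real j ^ 2 - c))
     = (\<Sum>j\<le>m. central_weight m j * (real j ^ 2) ^ t + c * (central_weight m j * (real j ^ 2) ^ t / (real j ^ 2 - c)))"
  proof (intro sum.cong refl)
    fix j
    have "real j ^ 2 - c \<noteq> 0" using c[of j] by simp
    then have e: "real j ^ 2 / (real j ^ 2 - c) = 1 + c / (real j ^ 2 - c)"
      by (simp add: field_simps)
    have "central_weight m j * (real j ^ 2) ^ Suc t / (real j ^ 2 - c)
       = central_weight m j * (real j ^ 2) ^ t * (real j ^ 2 / (real j ^ 2 - c))" by simp
    also have "\<dots> = central_weight m j * (real j ^ 2) ^ t + c * (central_weight m j * (real j ^ 2) ^ t / (real j ^ 2 - c))"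
      unfolding e by (simp add: algebra_simps)
    finally show "central_weight m j * (real j ^ 2) ^ Suc t / (real j ^ 2 - c)
      = central_weight m j * (real j ^ 2) ^ t + c * (central_weight m j * (real j ^ 2) ^ t / (real j ^ 2 - c))" .
  qed
  also have "\<dots> = c * (c ^ t * resolvent_sum m c)"
    using Suc by (simp add: sum.distrib sum_distrib_left[symmetric] central_weight_moments
        del: power_Suc times_divide_eq_right)
  finally show ?case by simp
qed

lemma ex_pmf_of_weights:
  assumes "finite I" and "\<And>i. i \<in> I \<Longrightarrow> 0 \<le> w i" and "(\<Sum>i\<in>I. w i) = (1::real)"
  shows "\<exists>P. set_pmf P \<subseteq> I \<and> (\<forall>i. pmf P i = (if i \<in> I then w i else 0))"
proof -
  let ?f = "\<lambda>i. if i \<in> I then w i else 0"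
  have "(\<integral>\<^sup>+i. ennreal (?f i) \<partial>count_space UNIV) = (\<integral>\<^sup>+i. ennreal (w i) \<partial>count_space I)"
    by (subst nn_integral_count_space_indicator)
       (auto intro!: nn_integral_cong simp: indicator_def)
  also have "\<dots> = 1"
    using assms by (simp add: nn_integral_count_space_finite)
  finally have "pmf (embed_pmf ?f) i = ?f i" for i
    by (subst pmf_embed_pmf) (use assms in auto)
  then show ?thesis by (intro exI[of _ "embed_pmf ?f"]) (auto simp: set_pmf_iff split: if_splits)
qed

section \<open>Two priors with equal moments and unequal mean absolute values\<close>

lemma expectation_random_sign:
  fixes f :: "real \<Rightarrow> real"
  assumes "finite I" "set_pmf P \<subseteq> I"
  shows "measure_pmf.expectation (map_pmf (\<lambda>(i, s). if s then u i else - u i) (pair_pmf P (bernoulli_pmf (1/2)))) f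
     = (\<Sum>i\<in>I. pmf P i * ((f (u i) + f (- u i)) / 2))"
proof -
  have "measure_pmf.expectation (map_pmf (\<lambda>(i, s). if s then u i else - u i) (pair_pmf P (bernoulli_pmf (1/2)))) f
     = (\<Sum>(i, s)\<in>I \<times> UNIV. f (if s then u i else - u i) * pmf (pair_pmf P (bernoulli_pmf (1/2))) (i, s))"
    unfolding integral_map_pmf
    by (subst integral_measure_pmf_real[of "I \<times> UNIV"]) (use assms in \<open>auto simp: case_prod_unfold\<close>)
  also have "\<dots> = (\<Sum>i\<in>I. \<Sum>s\<in>UNIV. f (if s then u i else - u i) * pmf (pair_pmf P (bernoulli_pmf (1/2))) (i, s))"
    by (rule sum.cartesian_product[symmetric])
  also have "\<dots> = (\<Sum>i\<in>I. pmf P i * ((f (u i) + f (- u i)) / 2))"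
    by (intro sum.cong refl) (simp add: UNIV_bool pmf_pair algebra_simps)
  finally show ?thesis .
qed

text \<open>
  The signed measure below lives on the squares of the nodes \<open>0, \<dots>, m\<close>, \<open>1/2\<close> and \<open>\<alpha>\<close>. The node \<open>\<alpha>\<close>
  is what carries the mean of one prior. The node \<open>1/2\<close> divides the weight of \<open>j\<close> by another \<open>j\<^sup>2\<close>,
  which keeps \<open>\<Sum> j \<bar>weight j\<bar>\<close> of order \<open>\<alpha>\<^sup>2\<close> without a factor \<open>ln m\<close>.
\<close>

locale tilted_weights =
  fixes m :: nat and \<alpha> :: real
  assumes m: "1 \<le> m" and \<alpha>: "0 < \<alpha>" "\<alpha> \<le> 1/8"
begin

definition node :: "nat \<Rightarrow> real" where
  "node i = (if i \<le> m then real i else if i = m + 1 then 1/2 else \<alpha>)"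

definition weight :: "nat \<Rightarrow> real" where
  "weight i = (if i \<le> m then central_weight m i * (\<alpha>\<^sup>2 / 4) / ((real i ^ 2 - 1/4) * (real i ^ 2 - \<alpha>\<^sup>2))
     else if i = m + 1 then - (\<alpha>\<^sup>2 / 4) * resolvent_sum m (1/4) / (1/4 - \<alpha>\<^sup>2)
     else (\<alpha>\<^sup>2 / 4) * resolvent_sum m (\<alpha>\<^sup>2) / (1/4 - \<alpha>\<^sup>2))"

lemma \<alpha>2: "0 < \<alpha>\<^sup>2" "\<alpha>\<^sup>2 \<le> 1/64"
  using \<alpha> power_mono[of \<alpha> "1/8" 2] by (auto simp: power2_eq_square)

lemma sum_nodes: "(\<Sum>i\<le>m+2. f i) = (\<Sum>i\<le>m. f i) + f (m + 1) + (f (m + 2) :: real)"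
  by (simp add: numeral_2_eq_2)

lemma sum_head: "(\<Sum>i\<le>m. f i) = f 0 + (\<Sum>i\<in>{1..m}. f i :: real)"
  by (simp add: sum.atLeast_Suc_atMost[of 0 m] atMost_atLeast0)

lemma sq_ne: "real j ^ 2 \<noteq> \<alpha>\<^sup>2" "real j ^ 2 \<noteq> 1/4"
proof -
  have "real j ^ 2 = 0 \<or> real j ^ 2 \<ge> 1"
    by (cases j) (auto simp: power2_eq_square algebra_simps)
  then show "real j ^ 2 \<noteq> \<alpha>\<^sup>2" "real j ^ 2 \<noteq> 1/4" using \<alpha>2 by auto
qed

text \<open>
  Partial fractions in \<open>x\<^sup>2\<close> reduce the tilted weights to two resolvents. By \<open>resolvent_moments\<close> each of
  them has the moments of a point mass, and the weights of the nodes \<open>1/2\<close> and \<open>\<alpha>\<close> cancel these.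
\<close>

lemma weight_moments:
  assumes "t \<le> m"
  shows "(\<Sum>i\<le>m+2. weight i * (node i ^ 2) ^ t) = 0"
proof -
  let ?g = "\<alpha>\<^sup>2" and ?b = "1/4 :: real"
  let ?k = "(?g / 4) / (?b - ?g)"
  have "(\<Sum>i\<le>m. weight i * (node i ^ 2) ^ t)
     = (\<Sum>i\<le>m. ?k * (central_weight m i * (real i ^ 2) ^ t / (real i ^ 2 - ?b))
         - ?k * (central_weight m i * (real i ^ 2) ^ t / (real i ^ 2 - ?g)))"
  proof (intro sum.cong refl)
    fix i assume i: "i \<in> {..m}"
    define u v where "u = real i ^ 2 - ?b" and "v = real i ^ 2 - ?g"
    have uv: "u \<noteq> 0" "v \<noteq> 0" "?b - ?g = v - u" "v - u \<noteq> 0"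
      using sq_ne[of i] \<alpha>2 by (auto simp: u_def v_def)
    have "a / (u * v) = (a / u - a / v) / (v - u)" for a
    proof -
      have "a / u - a / v = (a / (u * v)) * (v - u)" using uv by (simp add: field_simps)
      then show ?thesis using uv by simp
    qed
    from this[of "central_weight m i * (?g / 4) * (real i ^ 2) ^ t"]
    show "weight i * (node i ^ 2) ^ t = ?k * (central_weight m i * (real i ^ 2) ^ t / (real i ^ 2 - ?b))
         - ?k * (central_weight m i * (real i ^ 2) ^ t / (real i ^ 2 - ?g))"
      using i unfolding uv(3) by (simp add: weight_def node_def u_def[symmetric] v_def[symmetric] diff_divide_distrib mult_ac)
  qed
  also have "\<dots> = ?k * (?b ^ t * resolvent_sum m ?b) - ?k * (?g ^ t * resolvent_sum m ?g)"
    unfolding sum_subtractf sum_distrib_left[symmetric]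
    by (simp only: resolvent_moments[OF assms sq_ne(1)] resolvent_moments[OF assms sq_ne(2)])
  finally show ?thesis
    unfolding sum_nodes by (simp add: weight_def node_def power2_eq_square[of "1/2"] mult_ac)
qed

lemma weight_0: "weight 0 = 1"
  using \<alpha>2 by (simp add: weight_def central_weight_def)

lemma weight_middle:
  assumes "i \<in> {1..m}"
  shows "\<bar>weight i\<bar> \<le> \<alpha>\<^sup>2 * (1 / (real i ^ 2 - 1/4))" "\<bar>weight i\<bar> * node i \<le> \<alpha>\<^sup>2 * (1 / (real i ^ 2 - 1/4))"
proof -
  have i: "real i \<ge> 1" using assms by simp
  then have i2: "real i ^ 2 \<ge> real i" by (simp add: power2_eq_square)
  have p: "0 < real i ^ 2 - 1/4" "0 < real i ^ 2 - \<alpha>\<^sup>2" using i i2 \<alpha>2 by linarith+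
  have q: "real i / (real i ^ 2 - \<alpha>\<^sup>2) \<le> 2"
    unfolding pos_divide_le_eq[OF p(2)] using i i2 \<alpha>2 by argo
  have "\<bar>weight i\<bar> * real i = \<bar>central_weight m i\<bar> * ((\<alpha>\<^sup>2 / 4) * (1 / (real i ^ 2 - 1/4)) * (real i / (real i ^ 2 - \<alpha>\<^sup>2)))"
  proof -
    define x y where "x = real i ^ 2 - 1/4" and "y = real i ^ 2 - \<alpha>\<^sup>2"
    have "0 < x" "0 < y" using p by (simp_all only: x_def y_def)
    moreover have "weight i = central_weight m i * (\<alpha>\<^sup>2 / 4) / (x * y)"
      using assms unfolding x_def y_def by (simp add: weight_def)
    ultimately show ?thesis unfolding x_def[symmetric] y_def[symmetric] by (simp add: abs_mult)
  qed
  also have "\<dots> \<le> 2 * ((\<alpha>\<^sup>2 / 4) * (1 / (real i ^ 2 - 1/4)) * 2)"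
    using p \<alpha>2 i by (intro mult_mono abs_central_weight_le q mult_nonneg_nonneg) auto
  finally have fin: "\<bar>weight i\<bar> * real i \<le> 2 * ((\<alpha>\<^sup>2 / 4) * (1 / (real i ^ 2 - 1/4)) * 2)" .
  have *: "\<bar>weight i\<bar> * real i \<le> \<alpha>\<^sup>2 * (1 / (real i ^ 2 - 1/4))"
  proof -
    have "2 * ((a / 4) * q * 2) = a * q" for a q :: real by simp
    with fin show ?thesis by (simp only:)
  qed
  then show "\<bar>weight i\<bar> * node i \<le> \<alpha>\<^sup>2 * (1 / (real i ^ 2 - 1/4))"
    using assms by (simp add: node_def)
  have "\<bar>weight i\<bar> * 1 \<le> \<bar>weight i\<bar> * real i" using i by (intro mult_left_mono) auto
  with * show "\<bar>weight i\<bar> \<le> \<alpha>\<^sup>2 * (1 / (real i ^ 2 - 1/4))" by simp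
qed

lemma sum_weight_middle:
  "(\<Sum>i\<in>{1..m}. \<bar>weight i\<bar>) \<le> 2 * \<alpha>\<^sup>2" "(\<Sum>i\<in>{1..m}. \<bar>weight i\<bar> * node i) \<le> 2 * \<alpha>\<^sup>2"
proof -
  have *: "(\<Sum>i\<in>{1..m}. \<alpha>\<^sup>2 * (1 / (real i ^ 2 - 1/4))) \<le> 2 * \<alpha>\<^sup>2"
    unfolding sum_distrib_left[symmetric] using sum_inverse_quarter_le[of m] \<alpha>2
    by (subst mult.commute) (rule mult_right_mono, auto)
  show "(\<Sum>i\<in>{1..m}. \<bar>weight i\<bar>) \<le> 2 * \<alpha>\<^sup>2" "(\<Sum>i\<in>{1..m}. \<bar>weight i\<bar> * node i) \<le> 2 * \<alpha>\<^sup>2"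
    by (rule order_trans[OF sum_mono *], rule weight_middle, simp)+
qed

lemma abs_resolvent_tail_le:
  assumes "0 < c" "c \<le> 1/4"
  shows "\<bar>\<Sum>j\<in>{1..m}. central_weight m j / (real j ^ 2 - c)\<bar> \<le> 4"
proof -
  have "\<bar>\<Sum>j\<in>{1..m}. central_weight m j / (real j ^ 2 - c)\<bar> \<le> (\<Sum>j\<in>{1..m}. 2 * (1 / (real j ^ 2 - 1/4)))"
  proof (rule order_trans[OF sum_abs sum_mono])
    fix j assume "j \<in> {1..m}"
    then have "real j ^ 2 \<ge> 1" by simp
    then have "\<bar>central_weight m j / (real j ^ 2 - c)\<bar> = \<bar>central_weight m j\<bar> * (1 / (real j ^ 2 - c))"
      using assms by simp
    also have "\<dots> \<le> 2 * (1 / (real j ^ 2 - 1/4))"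
      using \<open>real j ^ 2 \<ge> 1\<close> assms by (intro mult_mono abs_central_weight_le divide_left_mono) auto
    finally show "\<bar>central_weight m j / (real j ^ 2 - c)\<bar> \<le> 2 * (1 / (real j ^ 2 - 1/4))" .
  qed
  also have "\<dots> \<le> 4"
    unfolding sum_distrib_left[symmetric] using sum_inverse_quarter_le[of m] by simp
  finally show ?thesis .
qed

lemma weight_half: "\<bar>weight (m + 1)\<bar> \<le> 9 * \<alpha>\<^sup>2"
proof -
  have "\<bar>resolvent_sum m (1/4)\<bar> \<le> 8"
    using abs_resolvent_tail_le[of "1/4"] by (simp add: resolvent_sum_def sum_head central_weight_def)
  moreover have "15/64 \<le> 1/4 - \<alpha>\<^sup>2" using \<alpha>2 by simp
  moreover have "\<bar>weight (m + 1)\<bar> = (\<alpha>\<^sup>2 / 4) * (\<bar>resolvent_sum m (1/4)\<bar> / (1/4 - \<alpha>\<^sup>2))"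
    using \<alpha>2 by (simp add: weight_def abs_mult)
  moreover have "\<bar>resolvent_sum m (1/4)\<bar> / (1/4 - \<alpha>\<^sup>2) \<le> 8 / (15/64)"
    using calculation by (intro frac_le) auto
  ultimately have "\<bar>weight (m + 1)\<bar> \<le> (\<alpha>\<^sup>2 / 4) * (8 / (15/64))"
    by (metis mult_left_mono \<alpha>2(1) divide_nonneg_pos less_imp_le zero_less_numeral)
  then show ?thesis using \<alpha>2 by simp
qed

text \<open>
  The term \<open>j = 0\<close> of \<open>resolvent_sum m (\<alpha>\<^sup>2)\<close> is \<open>- 1 / \<alpha>\<^sup>2\<close> and dominates the others, so that almost all
  of the negative mass sits at the node \<open>\<alpha>\<close>.
\<close>

lemma weight_last: "weight (m + 2) \<le> - (15/16)"
proof -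
  let ?T = "\<Sum>j\<in>{1..m}. central_weight m j / (real j ^ 2 - \<alpha>\<^sup>2)"
  have T: "?T \<le> 4" using abs_resolvent_tail_le[of "\<alpha>\<^sup>2"] \<alpha>2 by simp
  have "resolvent_sum m (\<alpha>\<^sup>2) = - (1 / \<alpha>\<^sup>2) + ?T"
    by (simp add: resolvent_sum_def sum_head central_weight_def)
  then have "weight (m + 2) = (- 1 + \<alpha>\<^sup>2 * ?T) / (1 - 4 * \<alpha>\<^sup>2)"
    using \<alpha>2 by (simp add: weight_def field_simps)
  moreover have "\<alpha>\<^sup>2 * ?T \<le> \<alpha>\<^sup>2 * 4" using T \<alpha>2 by (intro mult_left_mono) auto
  moreover have "0 < 1 - 4 * \<alpha>\<^sup>2" using \<alpha>2 by simp
  moreover have "(- 1 + \<alpha>\<^sup>2 * ?T) / (1 - 4 * \<alpha>\<^sup>2) \<le> - (15/16)"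
  proof -
    have "- 1 + \<alpha>\<^sup>2 * ?T \<le> - (15/16) * (1 - 4 * \<alpha>\<^sup>2)"
    proof -
      have "- 1 + x \<le> - (15/16) * (1 - 4 * g)" if "x \<le> g * 4" "g \<le> 1/64" for x g :: real
        using that by argo
      then show ?thesis using \<open>\<alpha>\<^sup>2 * ?T \<le> \<alpha>\<^sup>2 * 4\<close> \<alpha>2(2) by blast
    qed
    then show ?thesis using \<open>0 < 1 - 4 * \<alpha>\<^sup>2\<close> by (simp only: pos_divide_le_eq)
  qed
  ultimately show ?thesis by (simp only:)
qed

text \<open>
  The common mass of the positive and of the negative part of \<open>weight\<close>.
\<close>

definition total :: real where "total = (\<Sum>i\<le>m+2. max (weight i) 0)"

lemma total_eq: "total = (\<Sum>i\<le>m+2. max (- weight i) 0)"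
proof -
  have "(\<Sum>i\<le>m+2. max (weight i) 0) - (\<Sum>i\<le>m+2. max (- weight i) 0) = (\<Sum>i\<le>m+2. weight i)"
    unfolding sum_subtractf[symmetric] by (intro sum.cong) (auto simp: max_def)
  then show ?thesis using weight_moments[of 0] by (simp add: total_def)
qed

lemma total_bounds: "1 \<le> total" "total \<le> 75/64"
proof -
  have "max (weight 0) 0 \<le> total"
    unfolding total_def by (intro member_le_sum) auto
  then show "1 \<le> total" by (simp add: weight_0)
  have "total \<le> 1 + (\<Sum>i\<in>{1..m}. \<bar>weight i\<bar>) + \<bar>weight (m + 1)\<bar> + 0"
    unfolding total_def sum_nodes sum_head
    by (intro add_mono sum_mono) (use weight_last in \<open>auto simp: weight_0\<close>)
  then show "total \<le> 75/64" using sum_weight_middle weight_half \<alpha>2 by simp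
qed

lemma node_bounds: "0 \<le> node i" "node i \<le> real m"
  using m \<alpha> by (auto simp: node_def)

end

text \<open>
  \<open>P\<close> is the normalised positive part of \<open>weight\<close>: apart from mass \<open>O(\<alpha>\<^sup>2)\<close> it sits at 0, which
  contributes nothing to the mean of \<open>\<bar>u\<bar>\<close>. \<open>Q\<close> is the normalised negative part, at least half of which
  sits at \<open>\<plusminus> \<alpha> / m\<close>. A random sign makes the odd moments vanish.
\<close>

theorem matched_priors:
  fixes m :: nat and \<alpha> :: real
  assumes "1 \<le> m" "0 < \<alpha>" "\<alpha> \<le> 1/8"
  obtains P Q :: "real pmf"
  where "finite (set_pmf P)" "finite (set_pmf Q)" "set_pmf P \<subseteq> {-1..1}" "set_pmf Q \<subseteq> {-1..1}"
    and "\<And>t. t \<le> 2 * m + 1 \<Longrightarrow> measure_pmf.expectation P (\<lambda>u. u ^ t) = measure_pmf.expectation Q (\<lambda>u. u ^ t)"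
    and "measure_pmf.expectation P abs \<le> 7 * \<alpha>\<^sup>2 / real m"
    and "\<alpha> / (2 * real m) \<le> measure_pmf.expectation Q (\<lambda>u. min \<bar>u\<bar> (\<alpha> / real m))"
proof -
  interpret tilted_weights m \<alpha> by unfold_locales (use assms in auto)
  let ?I = "{..m+2}"
  have V: "total > 0" "total \<ge> 1" using total_bounds by auto
  have p: "\<exists>P. set_pmf P \<subseteq> ?I \<and> (\<forall>i. pmf P i = (if i \<in> ?I then max (weight i) 0 / total else 0))"
  proof (rule ex_pmf_of_weights)
    show "(\<Sum>i\<in>?I. max (weight i) 0 / total) = 1"
      unfolding sum_divide_distrib[symmetric] total_def[symmetric] using V by simp
  qed (use V in auto)
  have q: "\<exists>P. set_pmf P \<subseteq> ?I \<and> (\<forall>i. pmf P i = (if i \<in> ?I then max (- weight i) 0 / total else 0))"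
  proof (rule ex_pmf_of_weights)
    show "(\<Sum>i\<in>?I. max (- weight i) 0 / total) = 1"
      unfolding sum_divide_distrib[symmetric] total_eq[symmetric] using V by simp
  qed (use V in auto)
  obtain P0 where P0: "set_pmf P0 \<subseteq> ?I" "\<And>i. i \<in> ?I \<Longrightarrow> pmf P0 i = max (weight i) 0 / total"
    using p by auto
  obtain Q0 where Q0: "set_pmf Q0 \<subseteq> ?I" "\<And>i. i \<in> ?I \<Longrightarrow> pmf Q0 i = max (- weight i) 0 / total"
    using q by auto
  define u where "u = (\<lambda>i. node i / real m)"
  have u: "0 \<le> u i" "u i \<le> 1" for i
    using node_bounds[of i] m by (auto simp: u_def)
  have u': "- 1 \<le> u i" "- u i \<le> 1" for i
    using u(1)[of i] by linarith+
  define P where "P = map_pmf (\<lambda>(i, s). if s then u i else - u i) (pair_pmf P0 (bernoulli_pmf (1/2)))"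
  define Q where "Q = map_pmf (\<lambda>(i, s). if s then u i else - u i) (pair_pmf Q0 (bernoulli_pmf (1/2)))"
  have EP: "measure_pmf.expectation P f = (\<Sum>i\<in>?I. pmf P0 i * ((f (u i) + f (- u i)) / 2))" for f :: "real \<Rightarrow> real"
    unfolding P_def by (rule expectation_random_sign) (use P0 in auto)
  have EQ: "measure_pmf.expectation Q f = (\<Sum>i\<in>?I. pmf Q0 i * ((f (u i) + f (- u i)) / 2))" for f :: "real \<Rightarrow> real"
    unfolding Q_def by (rule expectation_random_sign) (use Q0 in auto)
  have "finite (set_pmf P0)" "finite (set_pmf Q0)"
    using P0 Q0 by (auto intro: finite_subset)
  then have fin: "finite (set_pmf P)" "finite (set_pmf Q)"
    by (auto simp: P_def Q_def)
  have sub: "set_pmf P \<subseteq> {-1..1}" "set_pmf Q \<subseteq> {-1..1}"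
    using u u' by (auto simp: P_def Q_def)
  have mom: "measure_pmf.expectation P (\<lambda>u. u ^ t) = measure_pmf.expectation Q (\<lambda>u. u ^ t)"
    if t: "t \<le> 2 * m + 1" for t
  proof (cases "even t")
    case True
    then obtain s where s: "t = 2 * s" by auto
    with t have "s \<le> m" by simp
    have "measure_pmf.expectation P (\<lambda>u. u ^ t) - measure_pmf.expectation Q (\<lambda>u. u ^ t)
       = (\<Sum>i\<in>?I. (pmf P0 i - pmf Q0 i) * (u i ^ 2) ^ s)"
      unfolding EP EQ sum_subtractf[symmetric] s
      by (intro sum.cong refl) (simp add: power_mult left_diff_distrib)
    also have "\<dots> = (\<Sum>i\<in>?I. 1 / (total * (real m ^ 2) ^ s) * (weight i * (node i ^ 2) ^ s))"
    proof (intro sum.cong refl)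
      fix i assume i: "i \<in> ?I"
      have "pmf P0 i - pmf Q0 i = weight i / total"
        using P0(2)[OF i] Q0(2)[OF i] by (simp add: max_def)
      then show "(pmf P0 i - pmf Q0 i) * (u i ^ 2) ^ s = 1 / (total * (real m ^ 2) ^ s) * (weight i * (node i ^ 2) ^ s)"
        by (simp add: u_def power_divide)
    qed
    also have "\<dots> = 0"
      unfolding sum_distrib_left[symmetric] weight_moments[OF \<open>s \<le> m\<close>] by simp
    finally show ?thesis by simp
  next
    case False
    then show ?thesis unfolding EP EQ by (simp add: uminus_power_if)
  qed
  have "measure_pmf.expectation P abs = (\<Sum>i\<in>?I. (max (weight i) 0 / total) * (node i / real m))"
    unfolding EP by (intro sum.cong refl) (use P0(2) node_bounds(1) in \<open>simp add: u_def\<close>)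
  also have "\<dots> \<le> (\<Sum>i\<in>?I. max (weight i) 0 * (node i / real m))"
  proof (intro sum_mono mult_right_mono)
    fix i show "max (weight i) 0 / total \<le> max (weight i) 0"
      using V by (simp add: divide_le_eq mult_le_cancel_left1)
    show "0 \<le> node i / real m" using u[of i] by (simp add: u_def)
  qed
  also have "\<dots> = (\<Sum>i\<in>?I. max (weight i) 0 * node i) / real m"
    by (simp only: sum_divide_distrib times_divide_eq_right)
  also have "\<dots> \<le> 7 * \<alpha>\<^sup>2 / real m"
  proof (intro divide_right_mono)
    have "(\<Sum>i\<in>?I. max (weight i) 0 * node i)
      \<le> 0 + (\<Sum>i\<in>{1..m}. \<bar>weight i\<bar> * node i) + \<bar>weight (m + 1)\<bar> * (1/2) + 0"
      unfolding sum_nodes sum_head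
    proof (intro add_mono sum_mono)
      show "max (weight (m + 2)) 0 * node (m + 2) \<le> 0" using weight_last by simp
      show "max (weight i) 0 * node i \<le> \<bar>weight i\<bar> * node i" for i
        by (intro mult_right_mono node_bounds) auto
    qed (auto simp: node_def)
    also have "\<dots> \<le> 7 * \<alpha>\<^sup>2" using sum_weight_middle weight_half \<alpha>2 by simp
    finally show "(\<Sum>i\<in>?I. max (weight i) 0 * node i) \<le> 7 * \<alpha>\<^sup>2" .
  qed simp
  finally have eP: "measure_pmf.expectation P abs \<le> 7 * \<alpha>\<^sup>2 / real m" .
  have "\<alpha> / (2 * real m) = 1/2 * (\<alpha> / real m)" by simp
  also have "\<dots> \<le> pmf Q0 (m + 2) * (\<alpha> / real m)"
  proof (intro mult_right_mono)
    have "1/2 * total \<le> max (- weight (m + 2)) 0"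
      using weight_last total_bounds by simp
    then have "1/2 \<le> max (- weight (m + 2)) 0 / total"
      using V(1) by (simp only: pos_le_divide_eq)
    then show "1/2 \<le> pmf Q0 (m + 2)" using Q0(2)[of "m+2"] by simp
  qed (use \<alpha> in simp)
  also have "\<dots> = pmf Q0 (m + 2) * ((min \<bar>u (m + 2)\<bar> (\<alpha> / real m) + min \<bar>- u (m + 2)\<bar> (\<alpha> / real m)) / 2)"
    using \<alpha> by (simp add: u_def node_def)
  also have "\<dots> \<le> measure_pmf.expectation Q (\<lambda>u. min \<bar>u\<bar> (\<alpha> / real m))"
    unfolding EQ by (rule member_le_sum) (use \<alpha> in auto)
  finally have eQ: "\<alpha> / (2 * real m) \<le> measure_pmf.expectation Q (\<lambda>u. min \<bar>u\<bar> (\<alpha> / real m))" .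
  show ?thesis using that[OF fin sub mom eP eQ] .
qed

section \<open>Mixtures of samples with matched moments\<close>

lemma sum_lists_prod_list:
  fixes f :: "'a \<Rightarrow> real"
  assumes "finite A"
  shows "(\<Sum>xs | set xs \<subseteq> A \<and> length xs = n. prod_list (map f xs)) = (\<Sum>a\<in>A. f a) ^ n"
proof (induction n)
  case 0
  have "{xs. set xs \<subseteq> A \<and> length xs = 0} = {[]}" by auto
  then show ?case by simp
next
  case (Suc n)
  let ?L = "\<lambda>n. {xs. set xs \<subseteq> A \<and> length xs = n}"
  have "?L (Suc n) = (\<lambda>(x, xs). x # xs) ` (A \<times> ?L n)"
    by (auto simp: length_Suc_conv image_iff)
  then have "(\<Sum>xs\<in>?L (Suc n). prod_list (map f xs)) = (\<Sum>(x, xs)\<in>A \<times> ?L n. f x * prod_list (map f xs))"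
    by (simp only:) (subst sum.reindex, auto simp: inj_on_def intro!: sum.cong)
  also have "\<dots> = (\<Sum>x\<in>A. \<Sum>xs\<in>?L n. f x * prod_list (map f xs))"
    by (rule sum.cartesian_product[symmetric])
  also have "\<dots> = (\<Sum>a\<in>A. f a) ^ Suc n"
    by (simp add: sum_distrib_left[symmetric] sum_distrib_right[symmetric] Suc)
  finally show ?case .
qed

lemma pmf_replicate_pmf:
  "pmf (replicate_pmf n P) xs = (if length xs = n then prod_list (map (pmf P) xs) else 0)"
proof (induction n arbitrary: xs)
  case 0
  then show ?case by (auto simp: pmf_return)
next
  case (Suc n)
  have eq: "replicate_pmf (Suc n) P = map_pmf (\<lambda>(x, xs). x # xs) (pair_pmf P (replicate_pmf n P))"
    by (simp add: map_pmf_def pair_pmf_def bind_assoc_pmf bind_return_pmf)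
  have inj: "inj (\<lambda>(x, xs). x # xs :: 'a list)" by (auto simp: inj_def)
  show ?case
  proof (cases xs)
    case Nil
    have "[] \<notin> set_pmf (replicate_pmf (Suc n) P)" by (simp add: set_replicate_pmf)
    then show ?thesis using Nil by (simp add: set_pmf_iff del: replicate_pmf.simps)
  next
    case (Cons y ys)
    have "pmf (replicate_pmf (Suc n) P) xs = pmf (pair_pmf P (replicate_pmf n P)) (y, ys)"
      unfolding eq using pmf_map_inj'[OF inj, of _ "(y, ys)"] Cons by simp
    then show ?thesis by (simp add: pmf_pair Suc Cons)
  qed
qed

lemma expectation_replicate_pmf:
  fixes f :: "'a list \<Rightarrow> real"
  assumes "finite A" "set_pmf P \<subseteq> A"
  shows "measure_pmf.expectation (replicate_pmf n P) f
    = (\<Sum>xs | set xs \<subseteq> A \<and> length xs = n. f xs * prod_list (map (pmf P) xs))"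
proof -
  have "finite {xs. set xs \<subseteq> A \<and> length xs = n}" using finite_lists_length_eq[OF assms(1)] .
  then have "measure_pmf.expectation (replicate_pmf n P) f
    = (\<Sum>xs | set xs \<subseteq> A \<and> length xs = n. f xs * pmf (replicate_pmf n P) xs)"
    by (rule integral_measure_pmf_real) (use assms in \<open>auto simp: set_replicate_pmf\<close>)
  then show ?thesis by (simp add: pmf_replicate_pmf)
qed

lemma prod_list_map_mult:
  "prod_list (map (\<lambda>x. f x * g x) xs) = prod_list (map f xs) * (prod_list (map g xs) :: real)"
  by (induction xs) auto

lemma power_binomial_expansion:
  fixes c :: real
  shows "(1 + c) ^ n = (\<Sum>j\<le>n. real (n choose j) * c ^ j)"
  using binomial_ring[of c 1 n] by (simp add: add.commute)

lemma binomial_le_power: "real (n choose j) \<le> real n ^ j"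
proof (cases "j \<le> n")
  case True
  have "n choose j \<le> n ^ j" using binomial_le_pow[OF True] .
  then show ?thesis by (metis of_nat_le_iff of_nat_power)
qed (simp add: binomial_eq_0)

text \<open>
  The likelihood ratio of the sample, relative to \<open>n\<close> independent draws from \<open>r\<close>, is
  \<open>\<Prod> (1 + \<kappa> u g)\<close>, and the product of two such ratios has mean \<open>(1 + \<kappa>\<^sup>2 u u' \<Sum> r g\<^sup>2) ^ n\<close>. The binomial
  theorem separates \<open>u\<close> from \<open>u'\<close>, so the second moment of the mixture with signed weights \<open>w\<close> is a sum
  over \<open>j\<close> of squared moments of \<open>w\<close>. Only \<open>j \<ge> 2 q\<close> contribute. The Cauchy-Schwarz inequality then bounds
  the integral of any test function \<open>\<psi>\<close>.
\<close>

lemma matched_mixture_bound: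
  fixes A :: "'a set" and r g :: "'a \<Rightarrow> real" and U :: "real set" and w :: "real \<Rightarrow> real"
    and \<psi> :: "'a list \<Rightarrow> real"
  assumes A: "finite A" and r: "\<And>a. a \<in> A \<Longrightarrow> 0 \<le> r a" "(\<Sum>a\<in>A. r a) = 1"
    and g: "(\<Sum>a\<in>A. r a * g a) = 0"
    and s: "real n * \<kappa>\<^sup>2 * (\<Sum>a\<in>A. r a * (g a)\<^sup>2) \<le> 1/16"
    and U: "finite U" "U \<subseteq> {-1..1}" and w: "(\<Sum>u\<in>U. \<bar>w u\<bar>) \<le> 2"
    and mom: "\<And>t. t < 2 * q \<Longrightarrow> (\<Sum>u\<in>U. w u * u ^ t) = 0"
    and \<psi>: "\<And>xs. \<bar>\<psi> xs\<bar> \<le> B"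
  shows "\<bar>\<Sum>u\<in>U. w u * (\<Sum>xs | set xs \<subseteq> A \<and> length xs = n.
            \<psi> xs * prod_list (map (\<lambda>a. r a * (1 + \<kappa> * u * g a)) xs))\<bar> \<le> 3 * B / 16 ^ q"
proof -
  let ?L = "{xs. set xs \<subseteq> A \<and> length xs = n}"
  define R where "R xs = prod_list (map r xs)" for xs
  define D where "D xs = (\<Sum>u\<in>U. w u * prod_list (map (\<lambda>a. 1 + \<kappa> * u * g a) xs))" for xs
  define v where "v = (\<Sum>a\<in>A. r a * (g a)\<^sup>2)"
  define M where "M j = (\<Sum>u\<in>U. w u * u ^ j)" for j :: nat
  have finL: "finite ?L" using finite_lists_length_eq[OF A] .
  have R0: "0 \<le> R xs" if "xs \<in> ?L" for xs
    using that r(1) unfolding R_def by (intro prod_list_nonneg) auto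
  have R1: "(\<Sum>xs\<in>?L. R xs) = 1"
    unfolding R_def using sum_lists_prod_list[OF A, where n=n and f=r] r(2) by simp
  have v0: "0 \<le> v" unfolding v_def using r by (intro sum_nonneg mult_nonneg_nonneg) auto
  have B0: "0 \<le> B" using \<psi>[of "[]"] by linarith
  have "(\<Sum>u\<in>U. w u * (\<Sum>xs\<in>?L. \<psi> xs * prod_list (map (\<lambda>a. r a * (1 + \<kappa> * u * g a)) xs)))
     = (\<Sum>xs\<in>?L. R xs * (\<psi> xs * D xs))"
    unfolding D_def R_def sum_distrib_left prod_list_map_mult by (subst sum.swap) (simp add: mult_ac)
  moreover have "\<bar>\<Sum>xs\<in>?L. R xs * (\<psi> xs * D xs)\<bar> \<le> (\<Sum>xs\<in>?L. R xs * (B * \<bar>D xs\<bar>))"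
  proof (rule order_trans[OF sum_abs sum_mono])
    fix xs assume "xs \<in> ?L"
    then show "\<bar>R xs * (\<psi> xs * D xs)\<bar> \<le> R xs * (B * \<bar>D xs\<bar>)"
      unfolding abs_mult using R0[of xs] \<psi>[of xs]
      by (simp add: mult_left_mono mult_right_mono)
  qed
  moreover have "(\<Sum>xs\<in>?L. R xs * (B * \<bar>D xs\<bar>)) = B * (\<Sum>xs\<in>?L. R xs * \<bar>D xs\<bar>)"
    by (simp add: sum_distrib_left mult_ac)
  moreover have "(\<Sum>xs\<in>?L. R xs * \<bar>D xs\<bar>) \<le> 3 / 16 ^ q"
  proof -
    have "(\<Sum>xs\<in>?L. R xs * (D xs)\<^sup>2)
       = (\<Sum>u\<in>U. \<Sum>u'\<in>U. w u * w u' * (\<Sum>xs\<in>?L. prod_list (map (\<lambda>a. r a * ((1 + \<kappa> * u * g a) * (1 + \<kappa> * u' * g a))) xs)))"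
    proof -
      have "R xs * (D xs)\<^sup>2 = (\<Sum>u\<in>U. \<Sum>u'\<in>U. w u * w u' * prod_list (map (\<lambda>a. r a * ((1 + \<kappa> * u * g a) * (1 + \<kappa> * u' * g a))) xs))" for xs
        unfolding D_def R_def power2_eq_square sum_product
        unfolding sum_distrib_left prod_list_map_mult
        by (intro sum.cong refl) (simp add: mult_ac)
      then have "(\<Sum>xs\<in>?L. R xs * (D xs)\<^sup>2) = (\<Sum>xs\<in>?L. \<Sum>u\<in>U. \<Sum>u'\<in>U. w u * w u' * prod_list (map (\<lambda>a. r a * ((1 + \<kappa> * u * g a) * (1 + \<kappa> * u' * g a))) xs))"
        by simp
      also have "\<dots> = (\<Sum>u\<in>U. \<Sum>xs\<in>?L. \<Sum>u'\<in>U. w u * w u' * prod_list (map (\<lambda>a. r a * ((1 + \<kappa> * u * g a) * (1 + \<kappa> * u' * g a))) xs))"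
        by (rule sum.swap)
      also have "\<dots> = (\<Sum>u\<in>U. \<Sum>u'\<in>U. \<Sum>xs\<in>?L. w u * w u' * prod_list (map (\<lambda>a. r a * ((1 + \<kappa> * u * g a) * (1 + \<kappa> * u' * g a))) xs))"
        by (intro sum.cong refl sum.swap)
      finally show ?thesis by (simp add: sum_distrib_left)
    qed
    also have "\<dots> = (\<Sum>u\<in>U. \<Sum>u'\<in>U. w u * w u' * (1 + \<kappa>\<^sup>2 * v * (u * u')) ^ n)"
    proof (intro sum.cong refl)
      fix u u'
      have "(\<Sum>a\<in>A. r a * ((1 + \<kappa> * u * g a) * (1 + \<kappa> * u' * g a)))
         = (\<Sum>a\<in>A. r a + (\<kappa> * (u + u')) * (r a * g a) + (\<kappa>\<^sup>2 * (u * u')) * (r a * (g a)\<^sup>2))"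
        by (intro sum.cong refl) (simp add: algebra_simps power2_eq_square)
      also have "\<dots> = 1 + \<kappa>\<^sup>2 * v * (u * u')"
        by (simp add: sum.distrib sum_distrib_left[symmetric] r(2) g v_def)
      finally show "w u * w u' * (\<Sum>xs\<in>?L. prod_list (map (\<lambda>a. r a * ((1 + \<kappa> * u * g a) * (1 + \<kappa> * u' * g a))) xs))
          = w u * w u' * (1 + \<kappa>\<^sup>2 * v * (u * u')) ^ n"
        using sum_lists_prod_list[OF A, where n=n and f="\<lambda>a. r a * ((1 + \<kappa> * u * g a) * (1 + \<kappa> * u' * g a))"] by simp
    qed
    also have "\<dots> = (\<Sum>j\<le>n. real (n choose j) * (\<kappa>\<^sup>2 * v) ^ j * (M j)\<^sup>2)"
    proof -
      have "(\<Sum>u\<in>U. \<Sum>u'\<in>U. w u * w u' * (1 + \<kappa>\<^sup>2 * v * (u * u')) ^ n)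
        = (\<Sum>u\<in>U. \<Sum>u'\<in>U. \<Sum>j\<le>n. real (n choose j) * (\<kappa>\<^sup>2 * v) ^ j * ((w u * u ^ j) * (w u' * u' ^ j)))"
        unfolding power_binomial_expansion sum_distrib_left
        by (intro sum.cong refl) (simp add: power_mult_distrib mult_ac)
      also have "\<dots> = (\<Sum>u\<in>U. \<Sum>j\<le>n. \<Sum>u'\<in>U. real (n choose j) * (\<kappa>\<^sup>2 * v) ^ j * ((w u * u ^ j) * (w u' * u' ^ j)))"
        by (intro sum.cong refl sum.swap)
      also have "\<dots> = (\<Sum>j\<le>n. \<Sum>u\<in>U. \<Sum>u'\<in>U. real (n choose j) * (\<kappa>\<^sup>2 * v) ^ j * ((w u * u ^ j) * (w u' * u' ^ j)))"
        by (rule sum.swap)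
      also have "\<dots> = (\<Sum>j\<le>n. real (n choose j) * (\<kappa>\<^sup>2 * v) ^ j * (M j)\<^sup>2)"
        unfolding M_def power2_eq_square[of "sum _ _"] sum_product
        unfolding sum_distrib_left ..
      finally show ?thesis .
    qed
    also have "\<dots> \<le> (\<Sum>j\<le>n. if j < 2 * q then 0 else 4 * (1/16) ^ j)"
    proof (intro sum_mono)
      fix j
      show "real (n choose j) * (\<kappa>\<^sup>2 * v) ^ j * (M j)\<^sup>2 \<le> (if j < 2 * q then 0 else 4 * (1/16) ^ j)"
      proof (cases "j < 2 * q")
        case True
        then show ?thesis using mom by (simp add: M_def)
      next
        case False
        have "\<bar>M j\<bar> \<le> (\<Sum>u\<in>U. \<bar>w u\<bar>)"
          unfolding M_def
        proof (rule order_trans[OF sum_abs sum_mono])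
          fix u assume "u \<in> U"
          then have "\<bar>u\<bar> \<le> 1" using U by (auto simp: abs_le_iff)
          then show "\<bar>w u * u ^ j\<bar> \<le> \<bar>w u\<bar>"
            by (simp add: abs_mult power_abs mult_left_le power_le_one)
        qed
        then have M: "(M j)\<^sup>2 \<le> 4" using w abs_le_square_iff[of "M j" 2] by simp
        have "real (n choose j) * (\<kappa>\<^sup>2 * v) ^ j \<le> real n ^ j * (\<kappa>\<^sup>2 * v) ^ j"
          using v0 by (intro mult_right_mono binomial_le_power) auto
        also have "\<dots> = (real n * \<kappa>\<^sup>2 * v) ^ j" by (simp add: power_mult_distrib)
        also have "\<dots> \<le> (1/16) ^ j"
          using s v0 unfolding v_def[symmetric] by (intro power_mono) auto
        finally have "real (n choose j) * (\<kappa>\<^sup>2 * v) ^ j * (M j)\<^sup>2 \<le> (1/16) ^ j * 4"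
          using M v0 by (intro mult_mono) auto
        then show ?thesis using False by simp
      qed
    qed
    also have "\<dots> \<le> 4 * (\<Sum>j\<in>{2*q..<2*q+Suc n}. (1/16) ^ j)"
    proof -
      have "(\<Sum>j\<le>n. if j < 2 * q then 0 else 4 * (1/16) ^ j) = (\<Sum>j\<in>{2*q..n}. 4 * (1/16::real) ^ j)"
        by (intro sum.mono_neutral_cong_right) auto
      also have "\<dots> \<le> (\<Sum>j\<in>{2*q..<2*q+Suc n}. 4 * (1/16) ^ j)"
        by (intro sum_mono2) auto
      finally show ?thesis by (simp only: sum_distrib_left)
    qed
    also have "\<dots> = 4 * ((1/16) ^ (2*q) * (\<Sum>j<Suc n. (1/16) ^ j))"
      unfolding sum_distrib_left power_add[symmetric]
      by (intro sum.reindex_bij_witness[of _ "\<lambda>j. 2*q + j" "\<lambda>j. j - 2*q"]) auto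
    also have "\<dots> \<le> 4 * ((1/16) ^ (2*q) * 2)"
    proof -
      have "(\<Sum>j<Suc n. (1/16::real) ^ j) \<le> 2"
        by (subst sum_gp_strict) (simp add: field_simps)
      then show ?thesis by (intro mult_left_mono) auto
    qed
    also have "\<dots> \<le> (3 / 16 ^ q)\<^sup>2"
      by (simp add: power_divide power_mult power2_eq_square power_mult_distrib[symmetric] mult.commute[of 2] field_simps)
    finally have chi: "(\<Sum>xs\<in>?L. R xs * (D xs)\<^sup>2) \<le> (3 / 16 ^ q)\<^sup>2" .
    have "(\<Sum>xs\<in>?L. R xs * \<bar>D xs\<bar>)\<^sup>2 = (\<Sum>xs\<in>?L. sqrt (R xs) * (sqrt (R xs) * \<bar>D xs\<bar>))\<^sup>2"
      using R0 by (intro arg_cong[where f="\<lambda>x. x\<^sup>2"] sum.cong) (auto simp: mult.assoc[symmetric])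
    also have "\<dots> \<le> (\<Sum>xs\<in>?L. (sqrt (R xs))\<^sup>2) * (\<Sum>xs\<in>?L. (sqrt (R xs) * \<bar>D xs\<bar>)\<^sup>2)"
      by (rule Cauchy_Schwarz_ineq_sum)
    also have "\<dots> = (\<Sum>xs\<in>?L. R xs) * (\<Sum>xs\<in>?L. R xs * (D xs)\<^sup>2)"
      using R0 by (intro arg_cong2[where f="(*)"] sum.cong) (auto simp: power_mult_distrib)
    also have "\<dots> \<le> (3 / 16 ^ q)\<^sup>2" using chi R1 by simp
    finally show ?thesis
      by (rule power2_le_imp_le) simp
  qed
  ultimately show ?thesis
    using B0 by (metis (no_types, lifting) mult_left_mono order_trans times_divide_eq_right mult.commute)
qed

section \<open>Product priors and fuzzy hypotheses\<close>

lemma expectation_mono_finite: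
  fixes f g :: "'a \<Rightarrow> real"
  assumes "finite (set_pmf P)" "\<And>x. x \<in> set_pmf P \<Longrightarrow> f x \<le> g x"
  shows "measure_pmf.expectation P f \<le> measure_pmf.expectation P g"
  by (rule integral_mono_AE)
     (use assms in \<open>auto intro: integrable_measure_pmf_finite simp: AE_measure_pmf_iff\<close>)

lemma abs_expectation_le:
  fixes f :: "'a \<Rightarrow> real"
  assumes "finite (set_pmf P)" "\<And>x. x \<in> set_pmf P \<Longrightarrow> \<bar>f x\<bar> \<le> b"
  shows "\<bar>measure_pmf.expectation P f\<bar> \<le> b"
proof -
  have "measure_pmf.expectation P f \<le> measure_pmf.expectation P (\<lambda>_. b)"
    "measure_pmf.expectation P (\<lambda>_. - b) \<le> measure_pmf.expectation P f"
    by (rule expectation_mono_finite[OF assms(1)], use assms(2) in \<open>fastforce simp: abs_le_iff\<close>)+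
  then show ?thesis by (simp add: abs_le_iff)
qed

lemma expectation_pair_pmf_iterated:
  fixes f :: "'a \<Rightarrow> 'b \<Rightarrow> real"
  assumes "finite (set_pmf P)" "finite (set_pmf Q)"
  shows "measure_pmf.expectation (pair_pmf P Q) (\<lambda>(x, y). f x y)
      = measure_pmf.expectation P (\<lambda>x. measure_pmf.expectation Q (f x))"
proof -
  have "measure_pmf.expectation (pair_pmf P Q) (\<lambda>(x, y). f x y)
      = (\<Sum>(x, y)\<in>set_pmf P \<times> set_pmf Q. f x y * pmf (pair_pmf P Q) (x, y))"
    by (subst integral_measure_pmf_real[of "set_pmf P \<times> set_pmf Q"])
       (use assms in \<open>auto simp: case_prod_unfold\<close>)
  also have "\<dots> = (\<Sum>x\<in>set_pmf P. (\<Sum>y\<in>set_pmf Q. f x y * pmf Q y) * pmf P x)"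
    by (subst sum.cartesian_product[symmetric]) (simp add: pmf_pair sum_distrib_left sum_distrib_right mult_ac)
  also have "\<dots> = measure_pmf.expectation P (\<lambda>x. measure_pmf.expectation Q (f x))"
    by (simp add: integral_measure_pmf_real[OF assms(1)] integral_measure_pmf_real[OF assms(2)])
  finally show ?thesis .
qed

lemma expectation_swap:
  fixes f :: "'a \<Rightarrow> 'b \<Rightarrow> real"
  assumes "finite (set_pmf P)" "finite (set_pmf Q)"
  shows "measure_pmf.expectation P (\<lambda>x. measure_pmf.expectation Q (f x))
      = measure_pmf.expectation Q (\<lambda>y. measure_pmf.expectation P (\<lambda>x. f x y))"
proof -
  have "measure_pmf.expectation P (\<lambda>x. measure_pmf.expectation Q (f x))
      = (\<Sum>x\<in>set_pmf P. \<Sum>y\<in>set_pmf Q. f x y * pmf Q y * pmf P x)"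
    by (simp add: integral_measure_pmf_real[OF assms(1)] integral_measure_pmf_real[OF assms(2)] sum_distrib_right)
  also have "\<dots> = (\<Sum>y\<in>set_pmf Q. \<Sum>x\<in>set_pmf P. f x y * pmf Q y * pmf P x)"
    by (rule sum.swap)
  also have "\<dots> = measure_pmf.expectation Q (\<lambda>y. measure_pmf.expectation P (\<lambda>x. f x y))"
    by (simp add: integral_measure_pmf_real[OF assms(1)] integral_measure_pmf_real[OF assms(2)] sum_distrib_left sum_distrib_right mult_ac)
  finally show ?thesis .
qed

lemma expectation_Pi_pmf_insert:
  fixes F :: "('a \<Rightarrow> 'b) \<Rightarrow> real"
  assumes "finite A" "x \<notin> A" "finite (set_pmf P)"
  shows "measure_pmf.expectation (Pi_pmf (insert x A) d (\<lambda>_. P)) F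
      = measure_pmf.expectation (Pi_pmf A d (\<lambda>_. P)) (\<lambda>f. measure_pmf.expectation P (\<lambda>y. F (f(x := y))))"
    (is "?L = _")
proof -
  let ?Q = "Pi_pmf A d (\<lambda>_. P)"
  have finQ: "finite (set_pmf ?Q)"
    using assms by (auto simp: set_Pi_pmf intro!: finite_PiE_dflt)
  have "?L = measure_pmf.expectation (pair_pmf P ?Q) (\<lambda>(y, f). F (f(x := y)))"
    using assms by (simp add: Pi_pmf_insert case_prod_unfold)
  also have "\<dots> = measure_pmf.expectation P (\<lambda>y. measure_pmf.expectation ?Q (\<lambda>f. F (f(x := y))))"
    by (rule expectation_pair_pmf_iterated[OF assms(3) finQ])
  finally show ?thesis by (simp only: expectation_swap[OF assms(3) finQ])
qed

text \<open>
  Coordinates are exchanged one at a time; the others are averaged over either prior. The set \<open>S\<close> limits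
  the functions for which the one-coordinate estimate is needed.
\<close>

lemma product_prior_difference:
  fixes F :: "('a \<Rightarrow> 'b) \<Rightarrow> real"
  assumes "finite A" and fin: "finite (set_pmf P)" "finite (set_pmf Q)"
    and S: "set_pmf P \<subseteq> S" "set_pmf Q \<subseteq> S" "d \<in> S"
    and step: "\<And>x f. x \<in> A \<Longrightarrow> range f \<subseteq> S \<Longrightarrow>
      \<bar>measure_pmf.expectation Q (\<lambda>y. F (f(x := y))) - measure_pmf.expectation P (\<lambda>y. F (f(x := y)))\<bar> \<le> \<eta>"
  shows "\<bar>measure_pmf.expectation (Pi_pmf A d (\<lambda>_. Q)) F - measure_pmf.expectation (Pi_pmf A d (\<lambda>_. P)) F\<bar>
    \<le> real (card A) * \<eta>"
  using assms(1) step
proof (induction A arbitrary: F rule: finite_induct)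
  case empty
  then show ?case by simp
next
  case (insert x A)
  let ?E = "measure_pmf.expectation"
  let ?Q = "Pi_pmf A d (\<lambda>_. Q)" and ?P = "Pi_pmf A d (\<lambda>_. P)"
  let ?G = "\<lambda>f. ?E Q (\<lambda>y. F (f(x := y)))"
  let ?H = "\<lambda>f. ?E P (\<lambda>y. F (f(x := y)))"
  have finP: "finite (set_pmf ?P)"
    using insert fin by (auto simp: set_Pi_pmf intro!: finite_PiE_dflt)
  have 1: "\<bar>?E ?Q ?G - ?E ?P ?G\<bar> \<le> real (card A) * \<eta>"
  proof (rule insert.IH)
    fix z :: 'a and f :: "'a \<Rightarrow> 'b" assume z: "z \<in> A" and f: "range f \<subseteq> S"
    then have "z \<noteq> x" using insert by auto
    have "?E Q (\<lambda>y. ?G (f(z := y))) - ?E P (\<lambda>y. ?G (f(z := y)))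
        = ?E Q (\<lambda>y'. ?E Q (\<lambda>y. F (f(x := y', z := y)))) - ?E Q (\<lambda>y'. ?E P (\<lambda>y. F (f(x := y', z := y))))"
      unfolding fun_upd_twist[OF \<open>z \<noteq> x\<close>]
      by (intro arg_cong2[where f="(-)"] expectation_swap fin)
    also have "\<dots> = ?E Q (\<lambda>y'. ?E Q (\<lambda>y. F (f(x := y', z := y))) - ?E P (\<lambda>y. F (f(x := y', z := y))))"
      by (rule Bochner_Integration.integral_diff[symmetric]) (auto intro: integrable_measure_pmf_finite fin)
    finally have swap: "?E Q (\<lambda>y. ?G (f(z := y))) - ?E P (\<lambda>y. ?G (f(z := y)))
        = ?E Q (\<lambda>y'. ?E Q (\<lambda>y. F (f(x := y', z := y))) - ?E P (\<lambda>y. F (f(x := y', z := y))))" .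
    show "\<bar>?E Q (\<lambda>y. ?G (f(z := y))) - ?E P (\<lambda>y. ?G (f(z := y)))\<bar> \<le> \<eta>"
      unfolding swap by (rule abs_expectation_le[OF fin(2)], rule insert.prems) (use z f S in auto)
  qed
  have 2: "\<bar>?E ?P ?G - ?E ?P ?H\<bar> \<le> \<eta>"
  proof -
    have "?E ?P ?G - ?E ?P ?H = ?E ?P (\<lambda>f. ?G f - ?H f)"
      by (rule Bochner_Integration.integral_diff[symmetric]) (auto intro: integrable_measure_pmf_finite finP)
    moreover have "range f \<subseteq> S" if "f \<in> set_pmf ?P" for f
    proof -
      have "f y \<in> S" for y
        using that S insert.hyps(1) by (cases "y \<in> A") (auto simp: set_Pi_pmf PiE_dflt_def)
      then show ?thesis by auto
    qed
    ultimately show ?thesis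
      by (simp only:) (rule abs_expectation_le[OF finP], rule insert.prems, auto)
  qed
  have "?E (Pi_pmf (insert x A) d (\<lambda>_. Q)) F = ?E ?Q ?G" "?E (Pi_pmf (insert x A) d (\<lambda>_. P)) F = ?E ?P ?H"
    using insert fin by (simp_all add: expectation_Pi_pmf_insert)
  with 1 2 insert show ?case by (simp add: algebra_simps abs_le_iff)
qed

text \<open>
  The estimate is compared with the target after clipping both to \<open>[0, B]\<close>. Clipping is a contraction,
  so it does not increase the risk, and it makes the estimate a bounded test function, whose mean is
  nearly the same under the two priors. With \<open>B\<close> of the order of a typical target under \<open>Q\<close>, the
  rare large values of the target do not affect the comparison.
\<close>

lemma fuzzy_hypotheses:
  fixes W :: "'y \<Rightarrow> real" and \<theta> :: "'x \<Rightarrow> real"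
  assumes fin: "finite (set_pmf P)" "finite (set_pmf Q)" "\<And>x. x \<in> set_pmf P \<union> set_pmf Q \<Longrightarrow> finite (set_pmf (D x))"
    and risk: "\<And>x. x \<in> set_pmf P \<union> set_pmf Q \<Longrightarrow> measure_pmf.expectation (D x) (\<lambda>y. \<bar>W y - \<theta> x\<bar>) \<le> r"
    and pos: "\<And>x. x \<in> set_pmf P \<Longrightarrow> 0 \<le> \<theta> x" and B: "0 \<le> B"
    and close: "\<And>\<Phi>. (\<And>y. \<bar>\<Phi> y\<bar> \<le> B) \<Longrightarrow>
      \<bar>measure_pmf.expectation Q (\<lambda>x. measure_pmf.expectation (D x) \<Phi>)
        - measure_pmf.expectation P (\<lambda>x. measure_pmf.expectation (D x) \<Phi>)\<bar> \<le> \<eta>"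
  shows "measure_pmf.expectation Q (\<lambda>x. min (\<theta> x) B) - measure_pmf.expectation P \<theta> \<le> 2 * r + \<eta>"
proof -
  let ?E = "measure_pmf.expectation"
  define clip where "clip t = max 0 (min t B)" for t :: real
  have int: "integrable (D x) f" if "x \<in> set_pmf P \<union> set_pmf Q" for x and f :: "'y \<Rightarrow> real"
    by (rule integrable_measure_pmf_finite[OF fin(3)[OF that]])
  have near: "\<bar>?E (D x) (\<lambda>y. clip (W y)) - clip (\<theta> x)\<bar> \<le> r" if x: "x \<in> set_pmf P \<union> set_pmf Q" for x
  proof -
    have "?E (D x) (\<lambda>y. clip (W y)) - clip (\<theta> x) = ?E (D x) (\<lambda>y. clip (W y) - clip (\<theta> x))"
      by (simp add: Bochner_Integration.integral_diff[OF int[OF x] int[OF x]])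
    also have "\<bar>\<dots>\<bar> \<le> ?E (D x) (\<lambda>y. \<bar>clip (W y) - clip (\<theta> x)\<bar>)"
      by (rule integral_abs_bound)
    also have "\<dots> \<le> ?E (D x) (\<lambda>y. \<bar>W y - \<theta> x\<bar>)"
      by (rule expectation_mono_finite[OF fin(3)[OF x]]) (auto simp: clip_def)
    finally show ?thesis using risk[OF x] by linarith
  qed
  have "?E Q (\<lambda>x. min (\<theta> x) B) \<le> ?E Q (\<lambda>x. ?E (D x) (\<lambda>y. clip (W y)) + r)"
  proof (rule expectation_mono_finite[OF fin(2)])
    fix x assume "x \<in> set_pmf Q"
    then have "clip (\<theta> x) \<le> ?E (D x) (\<lambda>y. clip (W y)) + r" using near[of x] by (simp add: abs_le_iff)
    then show "min (\<theta> x) B \<le> ?E (D x) (\<lambda>y. clip (W y)) + r" unfolding clip_def by linarith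
  qed
  also have "\<dots> = ?E Q (\<lambda>x. ?E (D x) (\<lambda>y. clip (W y))) + r"
    by (subst Bochner_Integration.integral_add) (auto intro: integrable_measure_pmf_finite fin)
  finally have 1: "?E Q (\<lambda>x. min (\<theta> x) B) \<le> ?E Q (\<lambda>x. ?E (D x) (\<lambda>y. clip (W y))) + r" .
  have "?E P (\<lambda>x. ?E (D x) (\<lambda>y. clip (W y))) \<le> ?E P (\<lambda>x. \<theta> x + r)"
  proof (rule expectation_mono_finite[OF fin(1)])
    fix x assume x: "x \<in> set_pmf P"
    then have "?E (D x) (\<lambda>y. clip (W y)) \<le> clip (\<theta> x) + r" using near[of x] by (simp add: abs_le_iff)
    then show "?E (D x) (\<lambda>y. clip (W y)) \<le> \<theta> x + r" using pos[OF x] by (simp add: clip_def)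
  qed
  also have "\<dots> = ?E P \<theta> + r"
    by (subst Bochner_Integration.integral_add) (auto intro: integrable_measure_pmf_finite fin)
  finally have 2: "?E P (\<lambda>x. ?E (D x) (\<lambda>y. clip (W y))) \<le> ?E P \<theta> + r" .
  have "\<bar>clip (W y)\<bar> \<le> B" for y using B by (simp add: clip_def)
  from close[of "\<lambda>y. clip (W y)", OF this] 1 2 show ?thesis by linarith
qed

section \<open>Wasserstein distances between mixing measures\<close>

lemma set_pmf_of_vec:
  assumes "v \<in> prob_simplex m"
  shows "set_pmf (pmf_of_vec v) \<subseteq> {..<m}"
  using pmf_pmf_of_vec[OF assms] by (auto simp: set_pmf_iff split: if_splits)

lemma expectation_pmf_of_vec:
  fixes f :: "nat \<Rightarrow> real"
  assumes "v \<in> prob_simplex m"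
  shows "measure_pmf.expectation (pmf_of_vec v) f = (\<Sum>i<m. f i * v $ i)"
  by (subst integral_measure_pmf_real[of "{..<m}"])
     (use set_pmf_of_vec[OF assms] in \<open>auto simp: pmf_pmf_of_vec[OF assms]\<close>)

lemma l1_norm_minus: "v \<in> carrier_vec p \<Longrightarrow> l1_norm (u - v) = (\<Sum>i<p. \<bar>u $ i - v $ i\<bar>)"
  by (auto simp: l1_norm_def)

lemma mult_mat_vec_sum:
  "A \<in> carrier_mat p K \<Longrightarrow> \<alpha> \<in> carrier_vec K \<Longrightarrow> v < p \<Longrightarrow> (A *\<^sub>v \<alpha>) $ v = (\<Sum>k<K. A $$ (v, k) * \<alpha> $ k)"
  by (auto simp: scalar_prod_def lessThan_atLeast0 intro!: sum.cong)

context
  fixes A :: "real mat" and p K :: nat and d :: "real vec \<Rightarrow> real vec \<Rightarrow> real" and cd :: real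
  assumes A: "A \<in> carrier_mat p K" and colA: "\<And>k. k < K \<Longrightarrow> col A k \<in> prob_simplex p"
    and cd: "0 < cd"
    and d: "\<And>u v. u \<in> prob_simplex p \<Longrightarrow> v \<in> prob_simplex p \<Longrightarrow> cd * l1_norm (u - v) \<le> 2 * d u v"
begin

lemma set_mixing_measure:
  assumes "\<alpha> \<in> prob_simplex K"
  shows "set_pmf (mixing_measure A \<alpha>) \<subseteq> col A ` {..<K}"
  unfolding mixing_measure_def using set_pmf_of_vec[OF assms] by auto

lemma expectation_mixing_measure:
  assumes \<alpha>: "\<alpha> \<in> prob_simplex K" and v: "v < p"
  shows "measure_pmf.expectation (mixing_measure A \<alpha>) (\<lambda>x. x $ v) = (A *\<^sub>v \<alpha>) $ v"
proof -
  have "\<alpha> \<in> carrier_vec K" using \<alpha> by (simp add: prob_simplex_def)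
  then show ?thesis
    unfolding mixing_measure_def integral_map_pmf expectation_pmf_of_vec[OF \<alpha>]
    using A v by (simp add: mult_mat_vec_sum[OF A] del: index_mult_mat_vec)
qed

lemma coupling_support:
  assumes "\<alpha> \<in> prob_simplex K" "\<beta> \<in> prob_simplex K"
    and "map_pmf fst \<gamma> = mixing_measure A \<alpha>" "map_pmf snd \<gamma> = mixing_measure A \<beta>"
  shows "finite (set_pmf \<gamma>)" "\<And>x y. (x, y) \<in> set_pmf \<gamma> \<Longrightarrow> x \<in> prob_simplex p \<and> y \<in> prob_simplex p"
proof -
  have "set_pmf \<gamma> \<subseteq> fst ` set_pmf \<gamma> \<times> snd ` set_pmf \<gamma>" by force
  also have "\<dots> \<subseteq> col A ` {..<K} \<times> col A ` {..<K}"
    using set_mixing_measure[OF assms(1)] set_mixing_measure[OF assms(2)]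
    unfolding assms(3,4)[symmetric] set_map_pmf by (rule Sigma_mono)
  finally have *: "set_pmf \<gamma> \<subseteq> col A ` {..<K} \<times> col A ` {..<K}" .
  then show "finite (set_pmf \<gamma>)" by (rule finite_subset) auto
  show "\<And>x y. (x, y) \<in> set_pmf \<gamma> \<Longrightarrow> x \<in> prob_simplex p \<and> y \<in> prob_simplex p"
    using * colA by auto
qed

text \<open>
  Under any coupling the mean of the first component is \<open>A \<alpha>\<close> and that of the second one is \<open>A \<beta>\<close>, and
  \<open>d\<close> dominates \<open>cd / 2\<close> times the \<open>l1\<close>-distance, to which Jensen's inequality applies.
\<close>

lemma coupling_cost_ge:
  assumes \<alpha>: "\<alpha> \<in> prob_simplex K" and \<beta>: "\<beta> \<in> prob_simplex K"
    and m: "map_pmf fst \<gamma> = mixing_measure A \<alpha>" "map_pmf snd \<gamma> = mixing_measure A \<beta>"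
  shows "cd / 2 * l1_norm (A *\<^sub>v \<alpha> - A *\<^sub>v \<beta>) \<le> measure_pmf.expectation \<gamma> (\<lambda>(x, y). d x y)"
proof -
  let ?E = "measure_pmf.expectation \<gamma>"
  note fin = coupling_support(1)[OF assms] and supp = coupling_support(2)[OF assms]
  have int: "integrable \<gamma> f" for f :: "real vec \<times> real vec \<Rightarrow> real"
    by (rule integrable_measure_pmf_finite[OF fin])
  have "l1_norm (A *\<^sub>v \<alpha> - A *\<^sub>v \<beta>) = (\<Sum>v<p. \<bar>(A *\<^sub>v \<alpha>) $ v - (A *\<^sub>v \<beta>) $ v\<bar>)"
    using A by (intro l1_norm_minus mult_mat_vec_carrier) (use \<beta> in \<open>auto simp: prob_simplex_def\<close>)
  also have "\<dots> = (\<Sum>v<p. \<bar>?E (\<lambda>z. fst z $ v - snd z $ v)\<bar>)"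
  proof (intro sum.cong refl)
    fix v assume "v \<in> {..<p}"
    then have v: "v < p" by simp
    have "(A *\<^sub>v \<alpha>) $ v = ?E (\<lambda>z. fst z $ v)"
      unfolding expectation_mixing_measure[OF \<alpha> v, symmetric] m(1)[symmetric] by simp
    moreover have "(A *\<^sub>v \<beta>) $ v = ?E (\<lambda>z. snd z $ v)"
      unfolding expectation_mixing_measure[OF \<beta> v, symmetric] m(2)[symmetric] by simp
    ultimately show "\<bar>(A *\<^sub>v \<alpha>) $ v - (A *\<^sub>v \<beta>) $ v\<bar> = \<bar>?E (\<lambda>z. fst z $ v - snd z $ v)\<bar>"
      by (simp add: Bochner_Integration.integral_diff[OF int int])
  qed
  also have "\<dots> \<le> (\<Sum>v<p. ?E (\<lambda>z. \<bar>fst z $ v - snd z $ v\<bar>))"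
    by (intro sum_mono integral_abs_bound)
  also have "\<dots> = ?E (\<lambda>z. \<Sum>v<p. \<bar>fst z $ v - snd z $ v\<bar>)"
    by (rule Bochner_Integration.integral_sum[symmetric]) (rule int)
  finally have "cd / 2 * l1_norm (A *\<^sub>v \<alpha> - A *\<^sub>v \<beta>) \<le> cd / 2 * ?E (\<lambda>z. \<Sum>v<p. \<bar>fst z $ v - snd z $ v\<bar>)"
    using cd by (intro mult_left_mono) auto
  also have "\<dots> = ?E (\<lambda>z. cd / 2 * (\<Sum>v<p. \<bar>fst z $ v - snd z $ v\<bar>))"
    by simp
  also have "\<dots> \<le> ?E (\<lambda>(x, y). d x y)"
  proof (rule expectation_mono_finite[OF fin])
    fix z assume z: "z \<in> set_pmf \<gamma>"
    obtain x y where xy: "z = (x, y)" by (cases z)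
    with supp z have s: "x \<in> prob_simplex p" "y \<in> prob_simplex p" by auto
    then have "y \<in> carrier_vec p" by (simp add: prob_simplex_def)
    from d[OF s] show "cd / 2 * (\<Sum>v<p. \<bar>fst z $ v - snd z $ v\<bar>) \<le> (case z of (x, y) \<Rightarrow> d x y)"
      unfolding xy by (simp add: l1_norm_minus[OF \<open>y \<in> carrier_vec p\<close>])
  qed
  finally show ?thesis .
qed

lemma wasserstein_ge:
  assumes \<alpha>: "\<alpha> \<in> prob_simplex K" and \<beta>: "\<beta> \<in> prob_simplex K"
  shows "cd / 2 * l1_norm (A *\<^sub>v \<alpha> - A *\<^sub>v \<beta>) \<le> wasserstein d (mixing_measure A \<alpha>) (mixing_measure A \<beta>)"
  unfolding wasserstein_def
proof (rule cINF_greatest)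
  have "pair_pmf (mixing_measure A \<alpha>) (mixing_measure A \<beta>)
      \<in> {\<gamma>. map_pmf fst \<gamma> = mixing_measure A \<alpha> \<and> map_pmf snd \<gamma> = mixing_measure A \<beta>}"
    by (simp add: map_fst_pair_pmf map_snd_pair_pmf)
  then show "{\<gamma>. map_pmf fst \<gamma> = mixing_measure A \<alpha> \<and> map_pmf snd \<gamma> = mixing_measure A \<beta>} \<noteq> {}"
    by blast
qed (use coupling_cost_ge[OF \<alpha> \<beta>] in auto)

lemma wasserstein_le_coupling:
  assumes \<alpha>: "\<alpha> \<in> prob_simplex K" and \<beta>: "\<beta> \<in> prob_simplex K"
    and m: "map_pmf fst \<gamma> = mixing_measure A \<alpha>" "map_pmf snd \<gamma> = mixing_measure A \<beta>"
  shows "wasserstein d (mixing_measure A \<alpha>) (mixing_measure A \<beta>) \<le> measure_pmf.expectation \<gamma> (\<lambda>(x, y). d x y)"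
  unfolding wasserstein_def
proof (rule cINF_lower)
  show "bdd_below ((\<lambda>\<gamma>. measure_pmf.expectation \<gamma> (\<lambda>(x, y). d x y)) `
    {\<gamma>. map_pmf fst \<gamma> = mixing_measure A \<alpha> \<and> map_pmf snd \<gamma> = mixing_measure A \<beta>})"
    using coupling_cost_ge[OF \<alpha> \<beta>] by (intro bdd_belowI2[where m = "cd / 2 * l1_norm (A *\<^sub>v \<alpha> - A *\<^sub>v \<beta>)"]) auto
qed (use m in simp)

text \<open>
  Moving the surplus weight \<open>\<delta> / 2\<close> from topic 0 to topic 1 is a coupling.
\<close>

lemma wasserstein_two_topics_le:
  assumes \<alpha>: "\<alpha> \<in> prob_simplex K" and \<beta>: "\<beta> \<in> prob_simplex K" and K: "2 \<le> K"
    and \<delta>: "0 \<le> \<delta>" "\<delta> \<le> 1"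
    and \<alpha>k: "\<And>k. k < K \<Longrightarrow> \<alpha> $ k = (if k = 0 then (1 + \<delta>) / 2 else if k = 1 then (1 - \<delta>) / 2 else 0)"
    and \<beta>k: "\<And>k. k < K \<Longrightarrow> \<beta> $ k = (if k < 2 then 1 / 2 else 0)"
    and d0: "\<And>x. x \<in> prob_simplex p \<Longrightarrow> d x x \<le> 0"
  shows "wasserstein d (mixing_measure A \<alpha>) (mixing_measure A \<beta>) \<le> \<delta> / 2 * d (col A 0) (col A 1)"
proof -
  \<comment> \<open>cell 0 keeps mass on topic 0, cell 1 keeps mass on topic 1, cell 2 moves \<open>\<delta> / 2\<close> between them\<close>
  define cell where "cell c = (if c = (0::nat) then 1 / 2 else if c = 1 then (1 - \<delta>) / 2 else \<delta> / 2)" for c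
  have "\<exists>C. set_pmf C \<subseteq> {..<3} \<and> (\<forall>c. pmf C c = (if c \<in> {..<3::nat} then cell c else 0))"
    by (rule ex_pmf_of_weights) (use \<delta> in \<open>auto simp: cell_def numeral_3_eq_3 field_simps\<close>)
  then obtain C where C: "set_pmf C \<subseteq> {..<3}" "\<And>c. c < 3 \<Longrightarrow> pmf C c = cell c" by auto
  have EC: "measure_pmf.expectation C f = f 0 / 2 + f 1 * ((1 - \<delta>) / 2) + f 2 * (\<delta> / 2)" for f :: "nat \<Rightarrow> real"
    by (subst integral_measure_pmf_real[of "{..<3}"]) (use C in \<open>auto simp: numeral_3_eq_3 cell_def numeral_2_eq_2\<close>)
  have pmf_map: "pmf (map_pmf h C) x = (if h 0 = x then 1 / 2 else 0) + (if h 1 = x then (1 - \<delta>) / 2 else 0)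
      + (if h 2 = x then \<delta> / 2 else 0)" for h :: "nat \<Rightarrow> nat" and x
  proof -
    have "pmf (map_pmf h C) x = measure_pmf.expectation C (indicator (h -` {x}))"
      by (simp add: pmf_map)
    also have "\<dots> = (indicator (h -` {x}) 0 / 2 + indicator (h -` {x}) 1 * ((1 - \<delta>) / 2) + indicator (h -` {x}) 2 * (\<delta> / 2) :: real)"
      by (rule EC)
    finally show ?thesis by (simp add: indicator_def)
  qed
  let ?h1 = "\<lambda>c::nat. if c = 1 then 1 else 0 :: nat" and ?h2 = "\<lambda>c::nat. if c = 0 then 0 else 1 :: nat"
  have h1: "map_pmf ?h1 C = pmf_of_vec \<alpha>" and h2: "map_pmf ?h2 C = pmf_of_vec \<beta>"
    by (rule pmf_eqI, use K in \<open>auto simp: pmf_map pmf_pmf_of_vec[OF \<alpha>] pmf_pmf_of_vec[OF \<beta>] \<alpha>k \<beta>k field_simps\<close>)+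
  let ?\<gamma> = "map_pmf (\<lambda>c. (col A (?h1 c), col A (?h2 c))) C"
  have "map_pmf fst ?\<gamma> = map_pmf (col A) (map_pmf ?h1 C)" "map_pmf snd ?\<gamma> = map_pmf (col A) (map_pmf ?h2 C)"
    by (simp_all add: pmf.map_comp o_def)
  then have "wasserstein d (mixing_measure A \<alpha>) (mixing_measure A \<beta>) \<le> measure_pmf.expectation ?\<gamma> (\<lambda>(x, y). d x y)"
    by (intro wasserstein_le_coupling[OF \<alpha> \<beta>]) (simp_all only: h1 h2 mixing_measure_def)
  also have "\<dots> = d (col A 0) (col A 0) / 2 + d (col A 1) (col A 1) * ((1 - \<delta>) / 2) + d (col A 0) (col A 1) * (\<delta> / 2)"
    unfolding integral_map_pmf by (simp add: EC)
  also have "\<dots> \<le> 0 + 0 + d (col A 0) (col A 1) * (\<delta> / 2)"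
    using d0[OF colA[of 0]] d0[OF colA[of 1]] K \<delta>
    by (intro add_mono mult_nonpos_nonneg order_refl) auto
  finally show ?thesis by (simp add: mult.commute)
qed

end

section \<open>Topic models on a chord of the simplex\<close>

lemma sum_pairs: "(\<Sum>v<2*(H::nat). \<phi> v) = (\<Sum>k<H. \<phi> (2*k) + \<phi> (2*k + 1) :: real)"
  by (induction H) (simp_all add: algebra_simps)

definition two_topic_weights :: "nat \<Rightarrow> real \<Rightarrow> real vec" where
  "two_topic_weights K \<delta> = vec K (\<lambda>k. if k = 0 then (1 + \<delta>) / 2 else if k = 1 then (1 - \<delta>) / 2 else 0)"

lemma two_topic_weights_in_simplex:
  assumes "2 \<le> K" "0 \<le> \<delta>" "\<delta> \<le> 1"
  shows "two_topic_weights K \<delta> \<in> prob_simplex K"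
proof -
  have "(\<Sum>k<K. two_topic_weights K \<delta> $ k) = (\<Sum>k\<in>{0, 1}. two_topic_weights K \<delta> $ k)"
    using assms by (intro sum.mono_neutral_right) (auto simp: two_topic_weights_def)
  also have "\<dots> = 1" using assms by (simp add: two_topic_weights_def field_simps)
  finally show ?thesis using assms by (auto simp: prob_simplex_def two_topic_weights_def)
qed

lemma two_topic_weights_sparse:
  assumes "2 \<le> K" "0 \<le> \<delta>" "\<delta> \<le> 1" "2 \<le> \<tau>"
  shows "two_topic_weights K \<delta> \<in> Theta_alpha K \<tau>"
proof -
  have "card {k. k < dim_vec (two_topic_weights K \<delta>) \<and> two_topic_weights K \<delta> $ k \<noteq> 0} \<le> card {0, 1 :: nat}"
    by (intro card_mono) (auto simp: two_topic_weights_def split: if_splits)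
  then show ?thesis
    using assms two_topic_weights_in_simplex[of K \<delta>] by (simp add: Theta_alpha_def l0_norm_def)
qed

lemma unit_vec_in_simplex: "k < K \<Longrightarrow> unit_vec K k \<in> prob_simplex K"
  by (auto simp: prob_simplex_def unit_vec_def)

text \<open>
  Two weight vectors on topics 0 and 1 with different proportions span both unit vectors; the
  remaining ones are columns of \<open>T\<close>.
\<close>

lemma rank_eq_dim_row:
  fixes T :: "real mat"
  assumes T: "T \<in> carrier_mat K n" and K: "2 \<le> K" and \<delta>: "\<delta> \<noteq> 0"
    and ij: "two_topic_weights K \<delta> \<in> set (cols T)" "two_topic_weights K 0 \<in> set (cols T)"
    and un: "\<And>k. 2 \<le> k \<Longrightarrow> k < K \<Longrightarrow> unit_vec K k \<in> set (cols T)"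
  shows "vec_space.rank K T = K"
proof -
  interpret vec_space "TYPE(real)" K .
  let ?S = "set (cols T)"
  have S: "?S \<subseteq> carrier_vec K" using T cols_dim by blast
  have lin: "a \<cdot>\<^sub>v two_topic_weights K \<delta> + b \<cdot>\<^sub>v two_topic_weights K 0 \<in> span ?S" for a b
    by (intro span_add1[OF S] smult_in_span[OF S] span_mem[OF S] ij)
  have "unit_vec K k \<in> span ?S" if k: "k < K" for k
  proof -
    consider "k = 0" | "k = 1" | "2 \<le> k" by linarith
    then show ?thesis
    proof cases
      case 1
      have "(1 / \<delta>) \<cdot>\<^sub>v two_topic_weights K \<delta> + (1 - 1 / \<delta>) \<cdot>\<^sub>v two_topic_weights K 0 = unit_vec K k"
        using K \<delta> 1 by (intro eq_vecI) (auto simp: two_topic_weights_def unit_vec_def field_simps)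
      then show ?thesis using lin[of "1 / \<delta>" "1 - 1 / \<delta>"] by simp
    next
      case 2
      have "(- 1 / \<delta>) \<cdot>\<^sub>v two_topic_weights K \<delta> + (1 + 1 / \<delta>) \<cdot>\<^sub>v two_topic_weights K 0 = unit_vec K k"
        using K \<delta> 2 by (intro eq_vecI) (auto simp: two_topic_weights_def unit_vec_def field_simps)
      then show ?thesis using lin[of "- 1 / \<delta>" "1 + 1 / \<delta>"] by simp
    next
      case 3
      then show ?thesis using un k span_mem[OF S] by blast
    qed
  qed
  then have "set (unit_vecs K) \<subseteq> span ?S" by (auto simp: unit_vecs_def)
  then have "span (set (unit_vecs K)) \<subseteq> span ?S" by (rule span_subsetI[OF S])
  then have "span ?S = carrier_vec K"
    using span_is_subset2[OF S] span_unit_vecs_is_carrier by auto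
  then have "span_vs ?S = V" by simp
  then show ?thesis unfolding rank_def by (simp add: dim_is_n)
qed

text \<open>
  Words \<open>0, \<dots>, 2 H - 1\<close> form the \<open>H\<close> pairs \<open>(2 k, 2 k + 1)\<close> and share half of the mass. Words
  \<open>2 H, \<dots>, 2 H + K - 3\<close> are the anchor words of the topics \<open>2, \<dots>, K - 1\<close> and have mass zero in
  \<open>base\<close>. The filler words after them share the other half and are equally frequent in topics 0 and 1.
\<close>

locale chord_model =
  fixes H p K :: nat
  assumes H: "1 \<le> H" and K: "2 \<le> K" and Kp: "4 * K \<le> p" and p: "2 * H + (K - 2) < p"
begin

definition filler_start :: nat where
  "filler_start = 2 * H + (K - 2)"

lemma filler_start: "2 * H \<le> filler_start" "filler_start < p" "filler_start - 2 * H = K - 2"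
  using p by (simp_all add: filler_start_def)

definition base :: "nat \<Rightarrow> real" where
  "base v = (if v < 2 * H then 1 / (4 * real H)
     else if v < filler_start then 0
     else 1 / (2 * real (p - filler_start)))"

definition bump :: "(nat \<Rightarrow> real) \<Rightarrow> nat \<Rightarrow> real" where
  "bump X v = (if v < 2 * H then (if even v then X (v div 2) else - X (v div 2)) else 0)"

definition word_law :: "(nat \<Rightarrow> real) \<Rightarrow> real vec" where
  "word_law X = vec p (\<lambda>v. base v * (1 + bump X v))"

lemma word_law_index: "v < p \<Longrightarrow> word_law X $ v = base v * (1 + bump X v)"
  by (simp add: word_law_def)

lemma base_nonneg: "0 \<le> base v"
  by (simp add: base_def)

lemma sum_base_times:
  assumes "\<And>v. 2 * H \<le> v \<Longrightarrow> \<phi> v = 0"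
  shows "(\<Sum>v<p. base v * \<phi> v) = (\<Sum>k<H. \<phi> (2*k) + \<phi> (2*k + 1)) / (4 * real H)"
proof -
  have "(\<Sum>v<p. base v * \<phi> v) = (\<Sum>v<2*H. base v * \<phi> v)"
    using p assms by (intro sum.mono_neutral_right) auto
  also have "\<dots> = (\<Sum>v<2*H. \<phi> v) / (4 * real H)"
    by (simp add: base_def sum_divide_distrib)
  finally show ?thesis by (simp only: sum_pairs)
qed

lemma sum_base: "(\<Sum>v<p. base v) = 1"
proof -
  have "{..<p} = {..<2*H} \<union> ({2*H..<filler_start} \<union> {filler_start..<p})" using filler_start by auto
  then have "(\<Sum>v<p. base v) = (\<Sum>v\<in>{..<2*H} \<union> ({2*H..<filler_start} \<union> {filler_start..<p}). base v)"
    by (rule arg_cong)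
  also have "\<dots> = (\<Sum>v<2*H. base v) + (\<Sum>v\<in>{2*H..<filler_start} \<union> {filler_start..<p}. base v)"
    using filler_start by (intro sum.union_disjoint) auto
  also have "(\<Sum>v\<in>{2*H..<filler_start} \<union> {filler_start..<p}. base v)
      = (\<Sum>v\<in>{2*H..<filler_start}. base v) + (\<Sum>v\<in>{filler_start..<p}. base v)"
    by (intro sum.union_disjoint) auto
  also have "(\<Sum>v<2*H. base v) = 1/2" using H by (simp add: base_def)
  also have "(\<Sum>v\<in>{2*H..<filler_start}. base v) = 0" by (intro sum.neutral) (auto simp: base_def)
  also have "(\<Sum>v\<in>{filler_start..<p}. base v) = (\<Sum>v\<in>{filler_start..<p}. 1 / (2 * real (p - filler_start)))"
    using filler_start by (intro sum.cong) (auto simp: base_def)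
  also have "\<dots> = 1/2" using filler_start(2) by (simp del: of_nat_diff)
  finally show ?thesis by simp
qed

lemma bump_pair: "k < H \<Longrightarrow> bump X (2 * k) = X k" "k < H \<Longrightarrow> bump X (2 * k + 1) = - X k"
  by (auto simp: bump_def)

lemma bump_outside: "2 * H \<le> v \<Longrightarrow> bump X v = 0"
  by (simp add: bump_def)

lemma sum_base_bump: "(\<Sum>v<p. base v * bump X v) = 0"
  by (subst sum_base_times) (auto simp: bump_outside bump_pair[simplified])

lemma sum_base_abs_bump: "(\<Sum>v<p. base v * \<bar>bump X v\<bar>) = (\<Sum>k<H. \<bar>X k\<bar>) / (2 * real H)"
  by (subst sum_base_times) (auto simp: bump_outside bump_pair[simplified] sum.distrib sum_distrib_left[symmetric])

lemma sum_base_bump_sq: "(\<Sum>v<p. base v * (bump X v)\<^sup>2) = (\<Sum>k<H. (X k)\<^sup>2) / (2 * real H)"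
  by (subst sum_base_times) (auto simp: bump_outside bump_pair[simplified] sum.distrib sum_distrib_left[symmetric])

lemma abs_bump_le:
  assumes "\<And>k. k < H \<Longrightarrow> \<bar>X k\<bar> \<le> c" "0 \<le> c"
  shows "\<bar>bump X v\<bar> \<le> c"
proof (cases "v < 2 * H")
  case True
  then have "v div 2 < H" by linarith
  then show ?thesis using assms(1)[of "v div 2"] True by (auto simp: bump_def)
qed (use assms in \<open>simp add: bump_def\<close>)

lemma bump_scale: "bump (\<lambda>k. c * X k) v = c * bump X v"
  by (simp add: bump_def)

lemma word_law_in_simplex:
  assumes "\<And>k. k < H \<Longrightarrow> \<bar>X k\<bar> \<le> 1"
  shows "word_law X \<in> prob_simplex p"
proof -
  have "0 \<le> 1 + bump X v" for v using abs_bump_le[of X 1 v] assms by auto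
  moreover have "(\<Sum>v<p. base v * (1 + bump X v)) = 1"
    by (simp add: distrib_left sum.distrib sum_base sum_base_bump)
  ultimately show ?thesis
    using base_nonneg by (simp add: prob_simplex_def word_law_def)
qed

text \<open>
  Columns 0 and 1 are symmetric about \<open>base\<close>, on the line in direction \<open>\<xi>\<close>. Each other topic is
  concentrated on its own anchor word.
\<close>

definition topic_mat :: "(nat \<Rightarrow> real) \<Rightarrow> real mat" where
  "topic_mat \<xi> = mat p K (\<lambda>(v, k). if k = 0 then base v * (1 + bump \<xi> v)
     else if k = 1 then base v * (1 - bump \<xi> v)
     else if v = 2 * H + (k - 2) then 1 else 0)"

lemma topic_mat_carrier [simp]: "topic_mat \<xi> \<in> carrier_mat p K"
  by (simp add: topic_mat_def)

lemma topic_mat_two_topics: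
  "topic_mat \<xi> *\<^sub>v two_topic_weights K \<delta> = word_law (\<lambda>k. \<delta> * \<xi> k)"
proof (rule eq_vecI)
  fix v assume "v < dim_vec (word_law (\<lambda>k. \<delta> * \<xi> k))"
  then have v: "v < p" by (simp add: word_law_def)
  have "(topic_mat \<xi> *\<^sub>v two_topic_weights K \<delta>) $ v = (\<Sum>k<K. topic_mat \<xi> $$ (v, k) * two_topic_weights K \<delta> $ k)"
    using v by (intro mult_mat_vec_sum[OF topic_mat_carrier]) (simp_all add: two_topic_weights_def)
  also have "\<dots> = (\<Sum>k\<in>{0, 1}. topic_mat \<xi> $$ (v, k) * two_topic_weights K \<delta> $ k)"
    using K by (intro sum.mono_neutral_right) (auto simp: two_topic_weights_def)
  also have "\<dots> = base v * (1 + \<delta> * bump \<xi> v)"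
    using K v by (simp add: two_topic_weights_def topic_mat_def field_simps)
  finally show "(topic_mat \<xi> *\<^sub>v two_topic_weights K \<delta>) $ v = word_law (\<lambda>k. \<delta> * \<xi> k) $ v"
    using v by (simp add: word_law_def bump_scale)
qed (simp add: word_law_def topic_mat_def)

lemma topic_mat_unit:
  assumes "2 \<le> k" "k < K"
  shows "topic_mat \<xi> *\<^sub>v unit_vec K k = unit_vec p (2 * H + (k - 2))"
proof (rule eq_vecI)
  fix v assume "v < dim_vec (unit_vec p (2 * H + (k - 2)) :: real vec)"
  then have v: "v < p" by simp
  then show "(topic_mat \<xi> *\<^sub>v unit_vec K k) $ v = unit_vec p (2 * H + (k - 2)) $ v"
    using assms by (simp add: topic_mat_def unit_vec_def[of p])
qed (simp add: topic_mat_def)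

lemma col_topic_mat:
  "k < K \<Longrightarrow> col (topic_mat \<xi>) k = (if k = 0 then word_law \<xi> else if k = 1 then word_law (\<lambda>k. - \<xi> k)
     else unit_vec p (2 * H + (k - 2)))"
  by (intro eq_vecI) (auto simp: word_law_def topic_mat_def bump_def unit_vec_def)

lemma col_topic_mat_in_simplex:
  assumes "k < K" and "\<And>k. k < H \<Longrightarrow> \<bar>\<xi> k\<bar> \<le> 1"
  shows "col (topic_mat \<xi>) k \<in> prob_simplex p"
  using assms filler_start word_law_in_simplex[of \<xi>] word_law_in_simplex[of "\<lambda>k. - \<xi> k"]
  by (auto simp: col_topic_mat filler_start_def intro!: unit_vec_in_simplex)

text \<open>
  A word of a pair with \<open>\<bar>\<xi> k\<bar> < 1\<close> occurs in both topics 0 and 1. In the one pair with \<open>\<bar>\<xi> k0\<bar> = 1\<close> each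
  word is missing in one of them, hence is an anchor word of the other one. So there are \<open>K\<close> anchor
  words altogether.
\<close>

lemma topic_mat_in_class:
  assumes \<xi>: "\<And>k. k < H \<Longrightarrow> \<bar>\<xi> k\<bar> \<le> 1" and k0: "k0 < H" "\<bar>\<xi> k0\<bar> = 1"
    and strict: "\<And>k. k < H \<Longrightarrow> k \<noteq> k0 \<Longrightarrow> \<bar>\<xi> k\<bar> < 1"
  shows "topic_mat \<xi> \<in> Theta_A (1/4) (1/4) p K"
proof -
  let ?A = "topic_mat \<xi>"
  have entry: "v < p \<Longrightarrow> k < K \<Longrightarrow> ?A $$ (v, k) = (if k = 0 then base v * (1 + bump \<xi> v)
     else if k = 1 then base v * (1 - bump \<xi> v) else if v = 2 * H + (k - 2) then 1 else 0)" for v k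
    by (simp add: topic_mat_def)
  have p0: "0 < p" using p by simp
  have filler_less: "2 * H + (k - 2) < filler_start" if "2 \<le> k" "k < K" for k
    using that by (simp add: filler_start_def)
  have w_less: "2 * H + (k - 2) < p" if "2 \<le> k" "k < K" for k
    using filler_less[OF that] filler_start(2) by simp
  have col: "col ?A k \<in> prob_simplex p" if "k < K" for k
    using that \<xi> by (intro col_topic_mat_in_simplex)
  have row: "1/4 / real p \<le> linf_norm (row ?A v)" if v: "v < p" for v
  proof -
    have ge: "?A $$ (v, k) \<le> linf_norm (row ?A v)" if k: "k < K" for k
    proof -
      have "\<bar>row ?A v $ k\<bar> \<le> linf_norm (row ?A v)"
        unfolding linf_norm_def using k by (intro Max_ge) (auto simp: topic_mat_def)
      then show ?thesis using k v by (simp add: topic_mat_def)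
    qed
    consider "v < 2 * H" "0 \<le> bump \<xi> v" | "v < 2 * H" "bump \<xi> v \<le> 0"
      | "2 * H \<le> v" "v < filler_start" | "filler_start \<le> v" by linarith
    then show ?thesis
    proof cases
      case 1
      have "1/4 / real p \<le> 1 / (4 * real H)" using H filler_start by (simp add: field_simps)
      also have "\<dots> = base v * 1" using 1 by (simp add: base_def)
      also have "\<dots> \<le> base v * (1 + bump \<xi> v)"
        using 1 by (intro mult_left_mono base_nonneg) simp
      also have "\<dots> = ?A $$ (v, 0)" using K v by (simp add: entry)
      finally show ?thesis using ge[of 0] K by simp
    next
      case 2
      have "1/4 / real p \<le> 1 / (4 * real H)" using H filler_start by (simp add: field_simps)
      also have "\<dots> = base v * 1" using 2 by (simp add: base_def)
      also have "\<dots> \<le> base v * (1 - bump \<xi> v)"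
        using 2 by (intro mult_left_mono base_nonneg) simp
      also have "\<dots> = ?A $$ (v, 1)" using K v by (simp add: entry)
      finally show ?thesis using ge[of 1] K by simp
    next
      case 3
      have le1: "1/4 / real p \<le> 1" using p0 by (simp add: field_simps)
      have "v - 2 * H + 2 < K" using 3 filler_start(3) K by linarith
      then have "1 = ?A $$ (v, v - 2 * H + 2)" using 3 v by (subst entry) auto
      also have "\<dots> \<le> linf_norm (row ?A v)" using \<open>v - 2 * H + 2 < K\<close> by (rule ge)
      finally show ?thesis using le1 by simp
    next
      case 4
      have "2 * real (p - filler_start) \<le> 4 * real p" "0 < real (p - filler_start)"
        using filler_start(2) by simp_all
      then have "1 / (4 * real p) \<le> 1 / (2 * real (p - filler_start))"
        by (intro divide_left_mono) auto
      then have "1/4 / real p \<le> 1 / (2 * real (p - filler_start))" by simp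
      also have "\<dots> = base v * (1 + bump \<xi> v)" using 4 filler_start(1) by (simp add: base_def bump_def)
      also have "\<dots> = ?A $$ (v, 0)" using K v by (simp add: entry)
      finally show ?thesis using ge[of 0] K by simp
    qed
  qed
  \<comment> \<open>the word of the extremal pair on which the tilt is \<open>s = 1\<close> or \<open>s = - 1\<close>\<close>
  define w where "w s = (if \<xi> k0 = s then 2 * k0 else 2 * k0 + 1)" for s :: real
  have w: "bump \<xi> (w s) = s" "w s < 2 * H" if "s = 1 \<or> s = -1" for s
    using that k0 by (auto simp: w_def bump_def abs_if split: if_splits)
  have base_pos: "0 < base v" if "v < 2 * H" for v using that H by (simp add: base_def)
  have anchor: "\<exists>v. is_anchor_word ?A v k" if k: "k < K" for k
  proof -
    consider "k = 0" | "k = 1" | "2 \<le> k" by linarith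
    then show ?thesis
    proof cases
      case 1
      have "is_anchor_word ?A (w 1) k"
        unfolding is_anchor_word_def
        using w[of 1] K filler_start 1 base_pos[of "w 1"] by (auto simp: entry topic_mat_def)
      then show ?thesis ..
    next
      case 2
      have "is_anchor_word ?A (w (-1)) k"
        unfolding is_anchor_word_def
        using w[of "-1"] K filler_start 2 base_pos[of "w (-1)"] by (auto simp: entry topic_mat_def)
      then show ?thesis ..
    next
      case 3
      have "is_anchor_word ?A (2 * H + (k - 2)) k"
        unfolding is_anchor_word_def
        using 3 k w_less[OF 3 k] filler_less[OF 3 k] by (auto simp: topic_mat_def base_def)
      then show ?thesis ..
    qed
  qed
  have sub: "{v. \<exists>k. is_anchor_word ?A v k} \<subseteq> {2 * k0, 2 * k0 + 1} \<union> {2 * H..<filler_start}"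
  proof
    fix v assume "v \<in> {v. \<exists>k. is_anchor_word ?A v k}"
    then obtain k where "is_anchor_word ?A v k" by auto
    then have v: "v < p" and zero: "\<And>k'. k' < K \<Longrightarrow> k' \<noteq> k \<Longrightarrow> ?A $$ (v, k') = 0"
      unfolding is_anchor_word_def carrier_matD[OF topic_mat_carrier] by blast+
    have "?A $$ (v, 0) = 0 \<or> ?A $$ (v, 1) = 0" using zero[of 0] zero[of 1] K by (cases "k = 0") auto
    then have *: "base v = 0 \<or> \<bar>bump \<xi> v\<bar> = 1" using entry v K by auto
    show "v \<in> {2 * k0, 2 * k0 + 1} \<union> {2 * H..<filler_start}"
    proof (cases "v < 2 * H")
      case True
      then have "v div 2 < H" by linarith
      have "base v \<noteq> 0" using base_pos[OF True] by simp
      with * True have "\<bar>\<xi> (v div 2)\<bar> = 1" by (auto simp: bump_def split: if_splits)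
      then have "v div 2 = k0" using strict[OF \<open>v div 2 < H\<close>] by force
      then show ?thesis by auto
    next
      case False
      then have "base v = 0" using * by (simp add: bump_def)
      then show ?thesis using False v by (auto simp: base_def split: if_splits)
    qed
  qed
  have "card {v. \<exists>k. is_anchor_word ?A v k} \<le> card ({2 * k0, 2 * k0 + 1} \<union> {2 * H..<filler_start})"
    by (rule card_mono[OF _ sub]) simp
  also have "\<dots> \<le> card {2 * k0, 2 * k0 + 1} + card {2 * H..<filler_start}" by (rule card_Un_le)
  also have "\<dots> = K" using K filler_start(3) by simp
  finally have "4 * card {v. \<exists>k. is_anchor_word ?A v k} \<le> p" using Kp by simp
  then have "real (card {v. \<exists>k. is_anchor_word ?A v k}) \<le> 1/4 * real p" by linarith
  then show ?thesis
    unfolding Theta_A_def using col row anchor by simp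
qed

end

section \<open>The law of the documents\<close>

lemma finite_set_replicate_pmf:
  assumes "finite (set_pmf P)"
  shows "finite (set_pmf (replicate_pmf N P))"
  unfolding set_replicate_pmf using finite_lists_length_eq[OF assms, of N]
  by (simp add: lists_eq_set Int_def conj_commute)

lemma finite_set_multinomial_pmf:
  assumes "r \<in> prob_simplex m"
  shows "finite (set_pmf (multinomial_pmf N r))"
proof -
  have "finite (set_pmf (pmf_of_vec r))"
    by (rule finite_subset[OF set_pmf_of_vec[OF assms]]) simp
  then show ?thesis unfolding multinomial_pmf_def by (simp add: finite_set_replicate_pmf)
qed

text \<open>
  \<open>topic l = Some k\<close> makes topic \<open>k\<close> the only topic of document \<open>l\<close>; all other documents except \<open>i\<close> get the
  weights of document \<open>j\<close>. Every topic from 2 on occurs, which gives the topic-document matrix rank \<open>K\<close>.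
\<close>

lemma ex_document_assignment:
  fixes i j n K :: nat
  assumes "K \<le> n" "i < n" "j < n" "i \<noteq> j" "2 \<le> K"
  shows "\<exists>topic. topic j = None \<and> (\<forall>l k. l \<noteq> i \<longrightarrow> topic l = Some k \<longrightarrow> 2 \<le> k \<and> k < K)
    \<and> (\<forall>k. 2 \<le> k \<longrightarrow> k < K \<longrightarrow> (\<exists>l<n. l \<noteq> i \<and> topic l = Some k))"
proof -
  let ?L = "{..<n} - {i, j}"
  have "card ?L = n - 2" using assms by (simp add: card_Diff_subset)
  then have "card {2..<K} \<le> card ?L" using assms by simp
  then obtain f where f: "f ` {2..<K} \<subseteq> ?L" "inj_on f {2..<K}"
    using card_le_inj[of "{2..<K}" ?L] by auto
  define topic where "topic l = (if l \<in> f ` {2..<K} then Some (inv_into {2..<K} f l) else None)" for l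
  have "topic j = None" using f by (auto simp: topic_def)
  moreover have "2 \<le> k \<and> k < K" if "topic l = Some k" for l k
    using that inv_into_into[of l f "{2..<K}"] by (auto simp: topic_def split: if_splits)
  moreover have "\<exists>l<n. l \<noteq> i \<and> topic l = Some k" if "2 \<le> k" "k < K" for k
  proof (intro exI[of _ "f k"] conjI)
    show "topic (f k) = Some k" using that f by (auto simp: topic_def)
    have "f k \<in> ?L" using that by (intro subsetD[OF f(1)] imageI) simp
    then show "f k < n" "f k \<noteq> i" by auto
  qed
  ultimately show ?thesis by blast
qed

locale chord_documents = chord_model H p K for H p K :: nat +
  fixes n i j :: nat and topic :: "nat \<Rightarrow> nat option"
  assumes ij: "i < n" "j < n" "i \<noteq> j"
    and topic_j: "topic j = None"
    and topic_range: "\<And>l k. l \<noteq> i \<Longrightarrow> topic l = Some k \<Longrightarrow> 2 \<le> k \<and> k < K"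
    and topic_onto: "\<And>k. 2 \<le> k \<Longrightarrow> k < K \<Longrightarrow> \<exists>l<n. l \<noteq> i \<and> topic l = Some k"
begin

definition doc_weights :: "nat \<Rightarrow> real vec" where
  "doc_weights l = (case topic l of None \<Rightarrow> two_topic_weights K 0 | Some k \<Rightarrow> unit_vec K k)"

definition weight_mat :: "real \<Rightarrow> real mat" where
  "weight_mat \<delta> = mat K n (\<lambda>(k, l). (if l = i then two_topic_weights K \<delta> else doc_weights l) $ k)"

lemma doc_weights_carrier: "doc_weights l \<in> carrier_vec K"
  by (simp add: doc_weights_def two_topic_weights_def split: option.split)

lemma weight_mat_carrier [simp]: "weight_mat \<delta> \<in> carrier_mat K n"
  by (simp add: weight_mat_def)

lemma col_weight_mat:
  "l < n \<Longrightarrow> col (weight_mat \<delta>) l = (if l = i then two_topic_weights K \<delta> else doc_weights l)"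
  using doc_weights_carrier[of l]
  by (intro eq_vecI) (auto simp: weight_mat_def two_topic_weights_def)

lemma col_i: "col (weight_mat \<delta>) i = two_topic_weights K \<delta>"
  and col_j: "col (weight_mat \<delta>) j = two_topic_weights K 0"
  using ij by (simp_all add: col_weight_mat doc_weights_def topic_j)

lemma doc_weights_in_simplex: "l \<noteq> i \<Longrightarrow> doc_weights l \<in> prob_simplex K"
  using topic_range[of l] K
  by (auto simp: doc_weights_def two_topic_weights_in_simplex unit_vec_in_simplex split: option.split)

lemma model_in_class:
  assumes \<xi>: "\<And>k. k < H \<Longrightarrow> \<bar>\<xi> k\<bar> \<le> 1" and k0: "k0 < H" "\<bar>\<xi> k0\<bar> = 1"
    and strict: "\<And>k. k < H \<Longrightarrow> k \<noteq> k0 \<Longrightarrow> \<bar>\<xi> k\<bar> < 1"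
    and \<delta>: "0 < \<delta>" "\<delta> \<le> 1" and \<tau>: "2 \<le> \<tau>"
  shows "(topic_mat \<xi>, weight_mat \<delta>) \<in> topic_models (1/4) (1/4) n p K \<tau> i j"
proof -
  have "col (weight_mat \<delta>) l \<in> prob_simplex K" if "l < n" for l
    using that \<delta> K by (simp add: col_weight_mat two_topic_weights_in_simplex doc_weights_in_simplex)
  moreover have "vec_space.rank K (weight_mat \<delta>) = K"
  proof (rule rank_eq_dim_row[of _ K n \<delta>])
    have in_cols: "col (weight_mat \<delta>) l \<in> set (cols (weight_mat \<delta>))" if "l < n" for l
      using that by (auto simp: cols_def weight_mat_def)
    show "two_topic_weights K \<delta> \<in> set (cols (weight_mat \<delta>))" "two_topic_weights K 0 \<in> set (cols (weight_mat \<delta>))"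
      using in_cols[OF ij(1)] in_cols[OF ij(2)] by (simp_all add: col_i col_j)
    fix k assume "2 \<le> k" "k < K"
    then obtain l where l: "l < n" "l \<noteq> i" "topic l = Some k" using topic_onto by blast
    with in_cols[OF l(1)] show "unit_vec K k \<in> set (cols (weight_mat \<delta>))"
      by (simp add: col_weight_mat doc_weights_def)
  qed (use \<delta> K in auto)
  moreover have "topic_mat \<xi> \<in> Theta_A (1/4) (1/4) p K"
    using topic_mat_in_class[of \<xi> k0] \<xi> k0 strict by blast
  ultimately show ?thesis
    using \<delta> \<tau> K by (simp add: topic_models_def col_i col_j two_topic_weights_sparse)
qed

text \<open>
  The joint law of all documents but \<open>i\<close>. It is the same for all \<open>\<xi>\<close> (lemma \<open>topic_mat_doc_weights\<close>), so
  \<open>\<xi> = 0\<close> is used.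
\<close>

definition other_docs :: "nat \<Rightarrow> (nat \<Rightarrow> nat vec) pmf" where
  "other_docs N = Pi_pmf ({..<n} - {i}) (0\<^sub>v p) (\<lambda>l. multinomial_pmf N (topic_mat (\<lambda>_. 0) *\<^sub>v doc_weights l))"

lemma topic_mat_doc_weights:
  assumes "l \<noteq> i"
  shows "topic_mat \<xi> *\<^sub>v doc_weights l = topic_mat (\<lambda>_. 0) *\<^sub>v doc_weights l"
  using topic_range[OF assms]
  by (auto simp: doc_weights_def topic_mat_two_topics topic_mat_unit split: option.split)

lemma doc_law_in_simplex:
  assumes "l \<noteq> i"
  shows "topic_mat \<xi> *\<^sub>v doc_weights l \<in> prob_simplex p"
proof -
  have "unit_vec p (2 * H + (k - 2)) \<in> prob_simplex p" if "2 \<le> k" "k < K" for k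
    using that filler_start by (intro unit_vec_in_simplex) (simp add: filler_start_def)
  then show ?thesis
    using topic_range[OF assms] word_law_in_simplex[of "\<lambda>_. 0"]
    by (auto simp: doc_weights_def topic_mat_two_topics topic_mat_unit split: option.split)
qed

lemma finite_set_other_docs: "finite (set_pmf (other_docs N))"
  unfolding other_docs_def set_Pi_pmf[OF finite_Diff[OF finite_lessThan]]
  by (intro finite_PiE_dflt) (auto intro!: finite_set_multinomial_pmf doc_law_in_simplex)

lemma topic_data_law:
  "topic_data_pmf N (topic_mat \<xi>) (weight_mat \<delta>)
     = map_pmf (\<lambda>(xs, Y). Y(i := vec p (count_list xs)))
         (pair_pmf (replicate_pmf N (pmf_of_vec (word_law (\<lambda>k. \<delta> * \<xi> k)))) (other_docs N))"
proof -
  let ?law = "\<lambda>l. multinomial_pmf N (topic_mat \<xi> *\<^sub>v col (weight_mat \<delta>) l)"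
  have "{..<n} = insert i ({..<n} - {i})" using ij by auto
  moreover have dims: "dim_col (weight_mat \<delta>) = n" "dim_row (topic_mat \<xi>) = p"
    by (simp_all add: weight_mat_def topic_mat_def)
  ultimately have "topic_data_pmf N (topic_mat \<xi>) (weight_mat \<delta>)
      = Pi_pmf (insert i ({..<n} - {i})) (0\<^sub>v p) ?law"
    unfolding topic_data_pmf_def by simp
  also have "\<dots> = map_pmf (\<lambda>(y, Y). Y(i := y)) (pair_pmf (?law i) (Pi_pmf ({..<n} - {i}) (0\<^sub>v p) ?law))"
    by (rule Pi_pmf_insert) auto
  also have "Pi_pmf ({..<n} - {i}) (0\<^sub>v p) ?law = other_docs N"
    unfolding other_docs_def
    by (rule Pi_pmf_cong) (auto simp: col_weight_mat topic_mat_doc_weights[of _ \<xi>])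
  also have "?law i = map_pmf (\<lambda>xs. vec p (count_list xs)) (replicate_pmf N (pmf_of_vec (word_law (\<lambda>k. \<delta> * \<xi> k))))"
    unfolding col_i topic_mat_two_topics multinomial_pmf_def by (simp add: word_law_def)
  also have "pair_pmf \<dots> (other_docs N) = map_pmf (apfst (\<lambda>xs. vec p (count_list xs)))
      (pair_pmf (replicate_pmf N (pmf_of_vec (word_law (\<lambda>k. \<delta> * \<xi> k)))) (other_docs N))"
    by (rule pair_map_pmf1)
  finally show ?thesis
    unfolding pmf.map_comp
    by (rule trans) (intro arg_cong2[where f=map_pmf] ext refl, simp add: case_prod_unfold)
qed

lemma finite_set_document_sample:
  assumes "\<And>k. k < H \<Longrightarrow> \<bar>X k\<bar> \<le> 1"
  shows "finite (set_pmf (replicate_pmf N (pmf_of_vec (word_law X))))"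
proof -
  have "finite (set_pmf (pmf_of_vec (word_law X)))"
    by (rule finite_subset[OF set_pmf_of_vec[OF word_law_in_simplex]]) (use assms in auto)
  then show ?thesis by (rule finite_set_replicate_pmf)
qed

lemma finite_set_topic_data:
  assumes "\<And>k. k < H \<Longrightarrow> \<bar>\<delta> * \<xi> k\<bar> \<le> 1"
  shows "finite (set_pmf (topic_data_pmf N (topic_mat \<xi>) (weight_mat \<delta>)))"
  unfolding topic_data_law using assms by (simp add: finite_set_other_docs finite_set_document_sample)

lemma expectation_topic_data:
  fixes \<Phi> :: "(nat \<Rightarrow> nat vec) \<Rightarrow> real"
  assumes "\<And>k. k < H \<Longrightarrow> \<bar>\<delta> * \<xi> k\<bar> \<le> 1"
  shows "measure_pmf.expectation (topic_data_pmf N (topic_mat \<xi>) (weight_mat \<delta>)) \<Phi>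
    = (\<Sum>xs | set xs \<subseteq> {..<p} \<and> length xs = N.
        measure_pmf.expectation (other_docs N) (\<lambda>Y. \<Phi> (Y(i := vec p (count_list xs))))
          * prod_list (map (\<lambda>v. base v * (1 + bump (\<lambda>k. \<delta> * \<xi> k) v)) xs))"
proof -
  let ?r = "word_law (\<lambda>k. \<delta> * \<xi> k)"
  have r: "?r \<in> prob_simplex p" using assms by (intro word_law_in_simplex)
  have fin: "finite (set_pmf (replicate_pmf N (pmf_of_vec ?r)))"
    using assms by (rule finite_set_document_sample)
  have "measure_pmf.expectation (topic_data_pmf N (topic_mat \<xi>) (weight_mat \<delta>)) \<Phi>
    = measure_pmf.expectation (pair_pmf (replicate_pmf N (pmf_of_vec ?r)) (other_docs N))
        (\<lambda>(xs, Y). \<Phi> (Y(i := vec p (count_list xs))))"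
    unfolding topic_data_law by (simp add: case_prod_unfold)
  also have "\<dots> = measure_pmf.expectation (replicate_pmf N (pmf_of_vec ?r))
      (\<lambda>xs. measure_pmf.expectation (other_docs N) (\<lambda>Y. \<Phi> (Y(i := vec p (count_list xs)))))"
    by (rule expectation_pair_pmf_iterated[OF fin finite_set_other_docs])
  also have "\<dots> = (\<Sum>xs | set xs \<subseteq> {..<p} \<and> length xs = N.
        measure_pmf.expectation (other_docs N) (\<lambda>Y. \<Phi> (Y(i := vec p (count_list xs))))
          * prod_list (map (pmf (pmf_of_vec ?r)) xs))"
    by (rule expectation_replicate_pmf[OF _ set_pmf_of_vec[OF r]]) simp
  also have "\<dots> = (\<Sum>xs | set xs \<subseteq> {..<p} \<and> length xs = N.
        measure_pmf.expectation (other_docs N) (\<lambda>Y. \<Phi> (Y(i := vec p (count_list xs))))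
          * prod_list (map (\<lambda>v. base v * (1 + bump (\<lambda>k. \<delta> * \<xi> k) v)) xs))"
    by (intro sum.cong refl arg_cong2[where f="(*)"] arg_cong[where f=prod_list] map_cong)
       (auto simp: pmf_pmf_of_vec[OF r] word_law_index)
  finally show ?thesis .
qed

text \<open>
  Both \<open>W\<close> and the \<open>l1\<close>-distance of the word laws are homogeneous in the weight \<open>\<delta>\<close> along the chord. This
  is why the two bounds hold with no loss however small \<open>\<delta>\<close> is.
\<close>

lemma wasserstein_bounds:
  assumes \<xi>: "\<And>k. k < H \<Longrightarrow> \<bar>\<xi> k\<bar> \<le> 1" and \<delta>: "0 < \<delta>" "\<delta> \<le> 1"
    and cd: "0 < cd"
    and d: "\<And>u v. u \<in> prob_simplex p \<Longrightarrow> v \<in> prob_simplex p \<Longrightarrow>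
      cd * l1_norm (u - v) \<le> 2 * d u v \<and> 2 * d u v \<le> Cd * l1_norm (u - v)"
  defines "W \<equiv> wasserstein d (mixing_measure (topic_mat \<xi>) (two_topic_weights K \<delta>))
      (mixing_measure (topic_mat \<xi>) (two_topic_weights K 0))"
  shows "cd / 2 * ((\<Sum>k<H. \<bar>\<delta> * \<xi> k\<bar>) / (2 * real H)) \<le> W"
    and "W \<le> Cd / 2 * ((\<Sum>k<H. \<bar>\<delta> * \<xi> k\<bar>) / (2 * real H))"
proof -
  let ?A = "topic_mat \<xi>"
  have c0: "col ?A 0 = word_law \<xi>" and c1: "col ?A 1 = word_law (\<lambda>k. - \<xi> k)"
    using K by (simp_all add: col_topic_mat)
  have "col ?A k \<in> prob_simplex p" if "k < K" for k
    using that \<xi> by (intro col_topic_mat_in_simplex)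
  note A = topic_mat_carrier[of \<xi>] this
  have sx: "two_topic_weights K \<delta> \<in> prob_simplex K" "two_topic_weights K 0 \<in> prob_simplex K"
    using K \<delta> by (simp_all add: two_topic_weights_in_simplex)
  have diff: "l1_norm (word_law X - word_law Y) = (\<Sum>v<p. base v * \<bar>bump (\<lambda>k. X k - Y k) v\<bar>)" for X Y
  proof -
    have "word_law Y \<in> carrier_vec p" by (simp add: word_law_def)
    then have "l1_norm (word_law X - word_law Y) = (\<Sum>v<p. \<bar>base v * (1 + bump X v) - base v * (1 + bump Y v)\<bar>)"
      by (simp add: l1_norm_minus word_law_def)
    also have "\<dots> = (\<Sum>v<p. base v * \<bar>bump (\<lambda>k. X k - Y k) v\<bar>)"
    proof (intro sum.cong refl)
      fix v
      have "base v * (1 + bump X v) - base v * (1 + bump Y v) = base v * bump (\<lambda>k. X k - Y k) v"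
        by (simp add: bump_def algebra_simps)
      then show "\<bar>base v * (1 + bump X v) - base v * (1 + bump Y v)\<bar> = base v * \<bar>bump (\<lambda>k. X k - Y k) v\<bar>"
        using base_nonneg[of v] by (simp add: abs_mult)
    qed
    finally show ?thesis .
  qed
  have "cd / 2 * l1_norm (?A *\<^sub>v two_topic_weights K \<delta> - ?A *\<^sub>v two_topic_weights K 0) \<le> W"
    unfolding W_def by (rule wasserstein_ge[OF A cd conjunct1[OF d] sx])
  then show "cd / 2 * ((\<Sum>k<H. \<bar>\<delta> * \<xi> k\<bar>) / (2 * real H)) \<le> W"
    unfolding topic_mat_two_topics diff sum_base_abs_bump by simp
  have "W \<le> \<delta> / 2 * d (col ?A 0) (col ?A 1)"
    unfolding W_def
  proof (rule wasserstein_two_topics_le[OF A cd _ sx K])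
    show "d x x \<le> 0" if "x \<in> prob_simplex p" for x
    proof -
      have "dim_vec x = p" using that by (auto simp: prob_simplex_def)
      then have "l1_norm (x - x) = 0" by (simp add: l1_norm_def)
      then show ?thesis using d[OF that that] by simp
    qed
    show "cd * l1_norm (u - v) \<le> 2 * d u v" if "u \<in> prob_simplex p" "v \<in> prob_simplex p" for u v
      using d[OF that] ..
  qed (use \<delta> in \<open>auto simp: two_topic_weights_def\<close>)
  also have "\<dots> \<le> \<delta> / 2 * (Cd / 2 * l1_norm (col ?A 0 - col ?A 1))"
    using d[of "col ?A 0" "col ?A 1"] A(2)[of 0] A(2)[of 1] K \<delta> by (intro mult_left_mono) auto
  also have "\<dots> = Cd / 2 * ((\<Sum>k<H. \<bar>\<delta> * \<xi> k\<bar>) / (2 * real H))"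
    unfolding c0 c1 diff sum_base_abs_bump
    using \<delta> by (simp add: abs_mult sum_distrib_left[symmetric])
  finally show "W \<le> Cd / 2 * ((\<Sum>k<H. \<bar>\<delta> * \<xi> k\<bar>) / (2 * real H))" .
qed

text \<open>
  Any nonzero perturbation \<open>X\<close> with a unique extremal pair is realised by a model: \<open>\<xi>\<close> is \<open>X\<close> scaled to
  maximum 1, and the factor goes into the weights \<open>\<delta>\<close> of document \<open>i\<close>.
\<close>

lemma ex_hypothesis:
  assumes X: "\<And>k. k < H \<Longrightarrow> \<bar>X k\<bar> \<le> 1" and k0: "k0 < H" "X k0 \<noteq> 0"
    and strict: "\<And>k. k < H \<Longrightarrow> k \<noteq> k0 \<Longrightarrow> \<bar>X k\<bar> < \<bar>X k0\<bar>"
    and \<epsilon>: "0 < \<epsilon>" "\<epsilon> \<le> 1" and \<tau>: "2 \<le> \<tau>" and cd: "0 < cd"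
    and d: "\<And>u v. u \<in> prob_simplex p \<Longrightarrow> v \<in> prob_simplex p \<Longrightarrow>
      cd * l1_norm (u - v) \<le> 2 * d u v \<and> 2 * d u v \<le> Cd * l1_norm (u - v)"
  obtains A T where "(A, T) \<in> topic_models (1/4) (1/4) n p K \<tau> i j"
    and "finite (set_pmf (topic_data_pmf N A T))"
    and "\<And>\<Phi> :: (nat \<Rightarrow> nat vec) \<Rightarrow> real. measure_pmf.expectation (topic_data_pmf N A T) \<Phi>
      = (\<Sum>xs | set xs \<subseteq> {..<p} \<and> length xs = N.
          measure_pmf.expectation (other_docs N) (\<lambda>Y. \<Phi> (Y(i := vec p (count_list xs))))
            * prod_list (map (\<lambda>v. base v * (1 + bump (\<lambda>k. \<epsilon> * X k) v)) xs))"
    and "cd / 2 * (\<epsilon> * (\<Sum>k<H. \<bar>X k\<bar>) / (2 * real H))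
      \<le> wasserstein d (mixing_measure A (col T i)) (mixing_measure A (col T j))"
    and "wasserstein d (mixing_measure A (col T i)) (mixing_measure A (col T j))
      \<le> Cd / 2 * (\<epsilon> * (\<Sum>k<H. \<bar>X k\<bar>) / (2 * real H))"
proof -
  define M where "M = \<bar>X k0\<bar>"
  define \<xi> where "\<xi> k = X k / M" for k
  define \<delta> where "\<delta> = \<epsilon> * M"
  have M: "0 < M" "M \<le> 1" using k0 X by (auto simp: M_def)
  have \<delta>: "0 < \<delta>" "\<delta> \<le> 1" using \<epsilon> M by (auto simp: \<delta>_def mult_le_one)
  have \<delta>\<xi>: "\<delta> * \<xi> k = \<epsilon> * X k" for k using M by (simp add: \<delta>_def \<xi>_def)
  have \<xi>0: "\<bar>\<xi> k0\<bar> = 1" using M by (simp add: \<xi>_def M_def)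
  have \<xi>1: "\<bar>\<xi> k\<bar> < 1" if "k < H" "k \<noteq> k0" for k
    using strict[OF that] M by (simp add: \<xi>_def M_def[symmetric] abs_divide)
  have \<xi>: "\<bar>\<xi> k\<bar> \<le> 1" if "k < H" for k
    using \<xi>0 \<xi>1[OF that] by (cases "k = k0") auto
  have le: "\<bar>\<delta> * \<xi> k\<bar> \<le> 1" if "k < H" for k
    unfolding \<delta>\<xi> abs_mult using X[OF that] \<epsilon> by (intro mult_le_one) auto
  have sum: "(\<Sum>k<H. \<bar>\<delta> * \<xi> k\<bar>) = \<epsilon> * (\<Sum>k<H. \<bar>X k\<bar>)"
    unfolding \<delta>\<xi> abs_mult sum_distrib_left using \<epsilon> by simp
  show ?thesis
  proof (rule that[of "topic_mat \<xi>" "weight_mat \<delta>"])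
    show "(topic_mat \<xi>, weight_mat \<delta>) \<in> topic_models (1/4) (1/4) n p K \<tau> i j"
      using model_in_class[of \<xi> k0 \<delta> \<tau>] \<xi> k0 \<xi>0 \<xi>1 \<delta> \<tau> by blast
    show "finite (set_pmf (topic_data_pmf N (topic_mat \<xi>) (weight_mat \<delta>)))"
      using finite_set_topic_data le by blast
    show "measure_pmf.expectation (topic_data_pmf N (topic_mat \<xi>) (weight_mat \<delta>)) \<Phi>
      = (\<Sum>xs | set xs \<subseteq> {..<p} \<and> length xs = N.
          measure_pmf.expectation (other_docs N) (\<lambda>Y. \<Phi> (Y(i := vec p (count_list xs))))
            * prod_list (map (\<lambda>v. base v * (1 + bump (\<lambda>k. \<epsilon> * X k) v)) xs))" for \<Phi> :: "(nat \<Rightarrow> nat vec) \<Rightarrow> real"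
      using expectation_topic_data[of \<delta> \<xi> N \<Phi>] le unfolding \<delta>\<xi> by blast
    show "cd / 2 * (\<epsilon> * (\<Sum>k<H. \<bar>X k\<bar>) / (2 * real H))
      \<le> wasserstein d (mixing_measure (topic_mat \<xi>) (col (weight_mat \<delta>) i)) (mixing_measure (topic_mat \<xi>) (col (weight_mat \<delta>) j))"
      unfolding col_i col_j sum[symmetric] by (rule wasserstein_bounds(1)[OF \<xi> \<delta> cd d])
    show "wasserstein d (mixing_measure (topic_mat \<xi>) (col (weight_mat \<delta>) i)) (mixing_measure (topic_mat \<xi>) (col (weight_mat \<delta>) j))
      \<le> Cd / 2 * (\<epsilon> * (\<Sum>k<H. \<bar>X k\<bar>) / (2 * real H))"
      unfolding col_i col_j sum[symmetric] by (rule wasserstein_bounds(2)[OF \<xi> \<delta> cd d])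
  qed
qed

end

context chord_model
begin

text \<open>
  This is \<open>matched_mixture_bound\<close> relative to the word law in which coordinate \<open>x\<close> is unperturbed: there
  the pair \<open>x\<close>, on which the direction \<open>?g\<close> of the perturbation lives, has its words equally frequent, so
  that \<open>?g\<close> has mean 0 and second moment \<open>1 / (2 * H)\<close>.
\<close>

lemma coordinate_change_bound:
  fixes P Q :: "real pmf" and \<psi> :: "nat list \<Rightarrow> real"
  assumes fin: "finite (set_pmf P)" "finite (set_pmf Q)" and sub: "set_pmf P \<subseteq> {-1..1}" "set_pmf Q \<subseteq> {-1..1}"
    and mom: "\<And>t. t < 2 * q \<Longrightarrow> measure_pmf.expectation P (\<lambda>u. u ^ t) = measure_pmf.expectation Q (\<lambda>u. u ^ t)"
    and x: "x < H" and X: "\<And>k. k < H \<Longrightarrow> \<bar>X k\<bar> \<le> 1"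
    and \<kappa>: "real N * \<kappa>\<^sup>2 \<le> real H / 8"
    and \<psi>: "\<And>xs. \<bar>\<psi> xs\<bar> \<le> B"
  defines "F \<equiv> \<lambda>u. \<Sum>xs | set xs \<subseteq> {..<p} \<and> length xs = N.
      \<psi> xs * prod_list (map (\<lambda>v. base v * (1 + bump (X(x := \<kappa> * u)) v)) xs)"
  shows "\<bar>measure_pmf.expectation Q F - measure_pmf.expectation P F\<bar> \<le> 3 * B / 16 ^ q"
proof -
  let ?U = "set_pmf P \<union> set_pmf Q"
  let ?g = "bump (\<lambda>k. if k = x then 1 else 0)"
  let ?r = "\<lambda>v. base v * (1 + bump (X(x := 0)) v)"
  have EP: "measure_pmf.expectation P f = (\<Sum>u\<in>?U. f u * pmf P u)" for f
    by (rule integral_measure_pmf_real) (use fin in auto)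
  have EQ: "measure_pmf.expectation Q f = (\<Sum>u\<in>?U. f u * pmf Q u)" for f
    by (rule integral_measure_pmf_real) (use fin in auto)
  have orth: "bump (X(x := 0)) v * ?g v = 0" for v by (simp add: bump_def)
  have f1: "bump (X(x := \<kappa> * u)) v = bump (X(x := 0)) v + \<kappa> * u * ?g v" for u v
    by (simp add: bump_def)
  have f2: "?r v * (1 + \<kappa> * u * ?g v)
      = base v * (1 + (bump (X(x := 0)) v + \<kappa> * u * ?g v) + \<kappa> * u * (bump (X(x := 0)) v * ?g v))" for u v
    by (simp add: algebra_simps)
  have split: "base v * (1 + bump (X(x := \<kappa> * u)) v) = ?r v * (1 + \<kappa> * u * ?g v)" for u v
    unfolding f1 f2 orth by simp
  have rg: "?r v * ?g v = base v * ?g v" for v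
    using orth[of v] by (simp add: algebra_simps)
  have "measure_pmf.expectation Q F - measure_pmf.expectation P F = (\<Sum>u\<in>?U. (pmf Q u - pmf P u) * F u)"
    unfolding EP EQ sum_subtractf[symmetric] by (simp add: algebra_simps)
  also have "\<dots> = (\<Sum>u\<in>?U. (pmf Q u - pmf P u) * (\<Sum>xs | set xs \<subseteq> {..<p} \<and> length xs = N.
            \<psi> xs * prod_list (map (\<lambda>v. ?r v * (1 + \<kappa> * u * ?g v)) xs)))"
    unfolding F_def split ..
  also have "\<bar>\<dots>\<bar> \<le> 3 * B / 16 ^ q"
  proof (rule matched_mixture_bound)
    have b: "\<bar>(X(x := 0)) k\<bar> \<le> 1" if "k < H" for k using X that by simp
    have bb: "\<bar>bump (X(x := 0)) v\<bar> \<le> 1" for v by (rule abs_bump_le[OF b]) auto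
    have "0 \<le> 1 + bump (X(x := 0)) v" for v using bb[of v] by linarith
    then show "0 \<le> ?r v" for v
      using base_nonneg[of v] by (intro mult_nonneg_nonneg)
    show "(\<Sum>v<p. ?r v) = 1"
      by (simp add: distrib_left sum.distrib sum_base sum_base_bump)
    show "(\<Sum>v<p. ?r v * ?g v) = 0"
      unfolding rg by (rule sum_base_bump)
    have "(\<Sum>v<p. ?r v * (?g v)\<^sup>2) = (\<Sum>v<p. base v * (?g v)\<^sup>2)"
      unfolding power2_eq_square mult.assoc[symmetric] rg ..
    also have "\<dots> = 1 / (2 * real H)"
      unfolding sum_base_bump_sq using x by (simp add: if_distrib[of "\<lambda>a. a\<^sup>2"] cong: if_cong)
    finally have v: "(\<Sum>v<p. ?r v * (?g v)\<^sup>2) = 1 / (2 * real H)" .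
    show "real N * \<kappa>\<^sup>2 * (\<Sum>v<p. ?r v * (?g v)\<^sup>2) \<le> 1 / 16"
      unfolding v using \<kappa> H by (simp add: field_simps)
    show "finite ?U" "?U \<subseteq> {-1..1}" using fin sub by auto
    have "(\<Sum>u\<in>?U. \<bar>pmf Q u - pmf P u\<bar>) \<le> (\<Sum>u\<in>?U. pmf Q u + pmf P u)"
      by (intro sum_mono) (auto simp: abs_le_iff)
    also have "\<dots> = 2" using EP[of "\<lambda>_. 1"] EQ[of "\<lambda>_. 1"] by (simp add: sum.distrib)
    finally show "(\<Sum>u\<in>?U. \<bar>pmf Q u - pmf P u\<bar>) \<le> 2" .
    show "(\<Sum>u\<in>?U. (pmf Q u - pmf P u) * u ^ t) = 0" if "t < 2 * q" for t
      using mom[OF that] unfolding EP EQ by (simp add: left_diff_distrib right_diff_distrib sum_subtractf mult.commute)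
  qed (use \<psi> in auto)
  finally show ?thesis .
qed

end

section \<open>The lower bound for a given number of perturbed pairs\<close>

lemma expectation_cong_pmf:
  fixes f g :: "'a \<Rightarrow> real"
  assumes "\<And>x. x \<in> set_pmf P \<Longrightarrow> f x = g x"
  shows "measure_pmf.expectation P f = measure_pmf.expectation P g"
  by (rule integral_cong_AE) (use assms in \<open>auto simp: AE_measure_pmf_iff\<close>)

text \<open>
  If all scale factors lie in \<open>(\<rho>, 1]\<close>, scaling does not change the order of two different values from \<open>G\<close>.
\<close>

lemma ex_ratio_gap:
  fixes G :: "real set"
  assumes "finite G"
  shows "\<exists>\<rho>. 1/2 \<le> \<rho> \<and> \<rho> < 1 \<and> (\<forall>x\<in>G. \<forall>y\<in>G. 0 \<le> x \<longrightarrow> x < y \<longrightarrow> x < \<rho> * y)"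
proof -
  have "\<forall>\<^sub>F \<rho> in at_left 1. x < \<rho> * y" if "0 \<le> x" "x < y" for x y :: real
  proof -
    have "((\<lambda>\<rho>. \<rho> * y) \<longlongrightarrow> 1 * y) (at_left 1)" by (intro tendsto_intros)
    then show ?thesis using that by (intro order_tendstoD(1)) auto
  qed
  then have "\<forall>\<^sub>F \<rho> in at_left (1::real). \<forall>x\<in>G. \<forall>y\<in>G. 0 \<le> x \<longrightarrow> x < y \<longrightarrow> x < \<rho> * y"
    using assms by (intro eventually_ball_finite ballI) (auto simp: eventually_conj_iff)
  moreover have "\<forall>\<^sub>F \<rho> in at_left (1::real). \<rho> < 1 \<and> 1/2 \<le> \<rho>"
    using eventually_at_left_real[of "1/2" "1::real"] by (rule eventually_mono) auto
  ultimately have "\<forall>\<^sub>F \<rho> in at_left (1::real). (\<rho> < 1 \<and> 1/2 \<le> \<rho>) \<and> (\<forall>x\<in>G. \<forall>y\<in>G. 0 \<le> x \<longrightarrow> x < y \<longrightarrow> x < \<rho> * y)"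
    by eventually_elim auto
  then show ?thesis using eventually_happens'[OF trivial_limit_at_left_real] by blast
qed

text \<open>
  Different values are kept apart by the ratio gap, equal ones by the different scale factors.
\<close>

lemma ex_unique_extremal:
  fixes s Y :: "nat \<Rightarrow> real"
  assumes s: "\<And>k. k < H \<Longrightarrow> \<rho> < s k \<and> s k \<le> 1" "inj_on s {..<H}" and \<rho>: "0 < \<rho>"
    and gap: "\<And>x y. x \<in> G \<Longrightarrow> y \<in> G \<Longrightarrow> 0 \<le> x \<Longrightarrow> x < y \<Longrightarrow> x < \<rho> * y"
    and Y: "\<And>k. k < H \<Longrightarrow> \<bar>Y k\<bar> \<in> G" and nz: "h < H" "Y h \<noteq> 0"
  shows "\<exists>k0<H. s k0 * Y k0 \<noteq> 0 \<and> (\<forall>k<H. k \<noteq> k0 \<longrightarrow> \<bar>s k * Y k\<bar> < \<bar>s k0 * Y k0\<bar>)"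
proof -
  let ?S = "(\<lambda>k. \<bar>s k * Y k\<bar>) ` {..<H}"
  have pos: "0 < s k" if "k < H" for k using s(1)[OF that] \<rho> by linarith
  have "Max ?S \<in> ?S" using nz by (intro Max_in) auto
  then obtain k0 where k0: "k0 < H" "Max ?S = \<bar>s k0 * Y k0\<bar>" by auto
  have le: "\<bar>s k * Y k\<bar> \<le> \<bar>s k0 * Y k0\<bar>" if "k < H" for k
    unfolding k0(2)[symmetric] using that by (intro Max_ge) auto
  have ne: "\<bar>s k * Y k\<bar> \<noteq> \<bar>s l * Y l\<bar>"
    if kl: "k < H" "l < H" "k \<noteq> l" and lt: "\<bar>Y k\<bar> \<le> \<bar>Y l\<bar>" and l0: "Y l \<noteq> 0" for k l
  proof (cases "\<bar>Y k\<bar> = \<bar>Y l\<bar>")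
    case True
    have "s k \<noteq> s l" using s(2) kl by (auto simp: inj_on_def)
    then show ?thesis using True l0 pos[OF kl(1)] pos[OF kl(2)] by (simp add: abs_mult)
  next
    case False
    have "\<bar>s k * Y k\<bar> \<le> 1 * \<bar>Y k\<bar>"
      unfolding abs_mult using s(1)[OF kl(1)] pos[OF kl(1)] by (intro mult_right_mono) auto
    also have "\<dots> < \<rho> * \<bar>Y l\<bar>" using gap[of "\<bar>Y k\<bar>" "\<bar>Y l\<bar>"] Y kl lt False by auto
    also have "\<dots> \<le> \<bar>s l * Y l\<bar>"
      unfolding abs_mult using s(1)[OF kl(2)] by (intro mult_right_mono) auto
    finally show ?thesis by simp
  qed
  have nz0: "s k0 * Y k0 \<noteq> 0" using le[OF nz(1)] nz pos[OF nz(1)] by auto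
  have "\<bar>s k * Y k\<bar> < \<bar>s k0 * Y k0\<bar>" if k: "k < H" "k \<noteq> k0" for k
  proof -
    have "\<bar>s k * Y k\<bar> \<noteq> \<bar>s k0 * Y k0\<bar>"
    proof (cases "\<bar>Y k\<bar> \<le> \<bar>Y k0\<bar>")
      case True
      then show ?thesis using ne[of k k0] k k0(1) nz0 by auto
    next
      case False
      then have "\<bar>Y k0\<bar> \<le> \<bar>Y k\<bar>" "Y k \<noteq> 0" by auto
      from ne[OF k0(1) k(1) k(2)[symmetric] this] show ?thesis by simp
    qed
    then show ?thesis using le[OF k(1)] by simp
  qed
  then show ?thesis using k0(1) nz0 by blast
qed

lemma exp_le_power3: "exp (real m) \<le> 3 ^ m"
proof -
  have "exp (real m) = exp 1 ^ m" using exp_of_nat_mult[of m "1::real"] by simp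
  also have "\<dots> \<le> 3 ^ m" using exp_le by (intro power_mono) auto
  finally show ?thesis .
qed

text \<open>
  There are \<open>h\<close> random pairs and one more pair with a fixed tiny perturbation \<open>a\<close>, which is small enough
  to leave the mean under \<open>P\<close> of the same order. It makes \<open>X\<close> nonzero, so that documents \<open>i\<close> and \<open>j\<close> have
  different weights and the chord is defined. The scale factors \<open>s\<close> make the extremal pair unique.
\<close>

theorem minimax_risk_lower_bound:
  fixes n N p K \<tau> i j h m :: nat and d :: "real vec \<Rightarrow> real vec \<Rightarrow> real" and cd Cd \<epsilon> :: real
  assumes K: "2 \<le> K" "K \<le> n" "4 * K \<le> p" "2 * Suc h + (K - 2) < p"
    and h: "1 \<le> h" "1 \<le> m" "real h \<le> exp (real m)"
    and ij: "i < n" "j < n" "i \<noteq> j" and \<tau>: "2 \<le> \<tau>"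
    and cd: "0 < cd" "cd \<le> Cd"
    and d: "\<And>u v. u \<in> prob_simplex p \<Longrightarrow> v \<in> prob_simplex p \<Longrightarrow>
      cd * l1_norm (u - v) \<le> 2 * d u v \<and> 2 * d u v \<le> Cd * l1_norm (u - v)"
    and \<epsilon>: "0 < \<epsilon>" "\<epsilon> \<le> 1" "real N * \<epsilon>\<^sup>2 \<le> real (Suc h) / 8"
  shows "ennreal (cd\<^sup>2 / Cd * (\<epsilon> / real m) / 28672)
    \<le> minimax_risk d N (topic_models (1/4) (1/4) n p K \<tau> i j) i j"
proof -
  obtain topic where topic: "topic j = None"
    "\<And>l k. l \<noteq> i \<Longrightarrow> topic l = Some k \<Longrightarrow> 2 \<le> k \<and> k < K"
    "\<And>k. 2 \<le> k \<Longrightarrow> k < K \<Longrightarrow> \<exists>l<n. l \<noteq> i \<and> topic l = Some k"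
    using ex_document_assignment[OF K(2) ij K(1)] by blast
  define H where "H = Suc h"
  interpret chord_documents H p K n i j topic
    by unfold_locales (use K ij topic in \<open>auto simp: H_def\<close>)
  let ?E = "measure_pmf.expectation"
  \<comment> \<open>so small that the mean of the distance under \<open>P\<close> is at most \<open>B / 8\<close>, for the clipping level \<open>B\<close> below\<close>
  define \<alpha> where "\<alpha> = cd / (224 * Cd)"
  have \<alpha>: "0 < \<alpha>" "\<alpha> \<le> 1/224" using cd by (auto simp: \<alpha>_def field_simps)
  then have "\<alpha> \<le> 1/8" by simp
  with \<alpha>(1) h(2) obtain P Q :: "real pmf" where fin: "finite (set_pmf P)" "finite (set_pmf Q)"
    and sub: "set_pmf P \<subseteq> {-1..1}" "set_pmf Q \<subseteq> {-1..1}"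
    and mom: "\<And>t. t \<le> 2 * m + 1 \<Longrightarrow> ?E P (\<lambda>u. u ^ t) = ?E Q (\<lambda>u. u ^ t)"
    and EP: "?E P abs \<le> 7 * \<alpha>\<^sup>2 / real m"
    and EQ: "\<alpha> / (2 * real m) \<le> ?E Q (\<lambda>u. min \<bar>u\<bar> (\<alpha> / real m))"
    using matched_priors[of m \<alpha>] by metis
  define a where "a = 7 * \<alpha>\<^sup>2 / real m"
  have "7 * \<alpha>\<^sup>2 \<le> 1"
    using \<alpha> power_mono[of \<alpha> "1/224" 2] by (simp add: power2_eq_square)
  then have a: "0 < a" "a \<le> 1" using \<alpha> h(2) by (auto simp: a_def divide_le_eq)
  define U where "U = set_pmf P \<union> set_pmf Q"
  have U: "finite U" "U \<subseteq> {-1..1}" using fin sub by (auto simp: U_def)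
  obtain \<rho> where \<rho>: "1/2 \<le> \<rho>" "\<rho> < 1"
    and gap: "\<And>x y. x \<in> abs ` insert a U \<Longrightarrow> y \<in> abs ` insert a U \<Longrightarrow> 0 \<le> x \<Longrightarrow> x < y \<Longrightarrow> x < \<rho> * y"
    using ex_ratio_gap[OF finite_imageI[OF finite.insertI[OF U(1)]]] by metis
  \<comment> \<open>distinct scale factors between \<open>\<rho>\<close> and 1\<close>
  define s where "s k = 1 - (1 - \<rho>) * (real k / real H)" for k
  have s: "\<rho> < s k" "s k \<le> 1" if "k < H" for k
  proof -
    have "real k / real H < 1" using that by simp
    then have "(1 - \<rho>) * (real k / real H) < (1 - \<rho>) * 1" using \<rho> by (intro mult_strict_left_mono) auto
    then show "\<rho> < s k" by (simp add: s_def)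
    show "s k \<le> 1" using \<rho> by (simp add: s_def)
  qed
  have inj: "inj_on s {..<H}" using \<rho> H_def by (auto simp: inj_on_def s_def)
  define valid where "valid Y \<longleftrightarrow> (\<forall>k<h. Y k \<in> U) \<and> Y h = a" for Y :: "nat \<Rightarrow> real"
  define X where "X Y k = s k * Y k" for Y :: "nat \<Rightarrow> real" and k
  define L where "L Y = \<epsilon> * (\<Sum>k<H. \<bar>X Y k\<bar>) / (2 * real H)" for Y
  define \<theta> where "\<theta> A T = wasserstein d (mixing_measure A (col T i)) (mixing_measure A (col T j))" for A T
  \<comment> \<open>the estimator averaged over all documents but \<open>i\<close>, as a function of the words of document \<open>i\<close>\<close>
  define post where "post \<Phi> xs = ?E (other_docs N) (\<lambda>Y. \<Phi> (Y(i := vec p (count_list xs))))"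
    for \<Phi> :: "(nat \<Rightarrow> nat vec) \<Rightarrow> real" and xs
  define F where "F \<Phi> Y = (\<Sum>xs | set xs \<subseteq> {..<p} \<and> length xs = N.
      post \<Phi> xs * prod_list (map (\<lambda>v. base v * (1 + bump (\<lambda>k. \<epsilon> * X Y k) v)) xs))" for \<Phi> Y
  have sX: "\<bar>X Y k\<bar> \<le> \<bar>Y k\<bar>" "\<bar>Y k\<bar> / 2 \<le> \<bar>X Y k\<bar>" if "k < H" for Y k
  proof -
    have "\<bar>X Y k\<bar> = s k * \<bar>Y k\<bar>" using s[OF that] \<rho> by (simp add: X_def abs_mult)
    moreover have "s k * \<bar>Y k\<bar> \<le> 1 * \<bar>Y k\<bar>" using s[OF that] by (intro mult_right_mono) auto
    moreover have "1/2 * \<bar>Y k\<bar> \<le> s k * \<bar>Y k\<bar>" using s[OF that] \<rho> by (intro mult_right_mono) auto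
    ultimately show "\<bar>X Y k\<bar> \<le> \<bar>Y k\<bar>" "\<bar>Y k\<bar> / 2 \<le> \<bar>X Y k\<bar>" by simp_all
  qed
  have "\<exists>A T. valid Y \<longrightarrow> (A, T) \<in> topic_models (1/4) (1/4) n p K \<tau> i j
      \<and> finite (set_pmf (topic_data_pmf N A T))
      \<and> (\<forall>\<Phi>. ?E (topic_data_pmf N A T) \<Phi> = F \<Phi> Y)
      \<and> cd / 2 * L Y \<le> \<theta> A T \<and> \<theta> A T \<le> Cd / 2 * L Y" for Y
  proof (cases "valid Y")
    case True
    have Y: "Y k \<in> insert a U" if "k < H" for k
      using that True by (cases "k = h") (auto simp: valid_def H_def)
    have "\<exists>k0<H. s k0 * Y k0 \<noteq> 0 \<and> (\<forall>k<H. k \<noteq> k0 \<longrightarrow> \<bar>s k * Y k\<bar> < \<bar>s k0 * Y k0\<bar>)"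
    proof (rule ex_unique_extremal[OF _ inj _ gap])
      show "\<rho> < s k \<and> s k \<le> 1" if "k < H" for k using s[OF that] ..
      show "\<bar>Y k\<bar> \<in> abs ` insert a U" if "k < H" for k using Y[OF that] by (rule imageI)
      show "h < H" "Y h \<noteq> 0" "0 < \<rho>" using True a \<rho> by (simp_all add: valid_def H_def)
    qed
    then obtain k0 where k0: "k0 < H" "s k0 * Y k0 \<noteq> 0"
      "\<And>k. k < H \<Longrightarrow> k \<noteq> k0 \<Longrightarrow> \<bar>s k * Y k\<bar> < \<bar>s k0 * Y k0\<bar>"
      by blast
    have le1: "\<bar>X Y k\<bar> \<le> 1" if "k < H" for k
    proof -
      have "\<bar>Y k\<bar> \<le> 1" using Y[OF that] U(2) a by (auto simp: abs_le_iff)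
      then show ?thesis using sX(1)[OF that, of Y] by linarith
    qed
    show ?thesis
      by (rule ex_hypothesis[of "X Y" k0 \<epsilon> \<tau> cd d Cd N, OF le1])
         (use k0 \<epsilon> \<tau> cd d in \<open>auto simp: X_def[symmetric] F_def post_def L_def \<theta>_def\<close>)
  qed simp
  then obtain A T where AT: "\<And>Y. valid Y \<Longrightarrow> (A Y, T Y) \<in> topic_models (1/4) (1/4) n p K \<tau> i j"
    "\<And>Y. valid Y \<Longrightarrow> finite (set_pmf (topic_data_pmf N (A Y) (T Y)))"
    "\<And>Y \<Phi>. valid Y \<Longrightarrow> ?E (topic_data_pmf N (A Y) (T Y)) \<Phi> = F \<Phi> Y"
    "\<And>Y. valid Y \<Longrightarrow> cd / 2 * L Y \<le> \<theta> (A Y) (T Y)"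
    "\<And>Y. valid Y \<Longrightarrow> \<theta> (A Y) (T Y) \<le> Cd / 2 * L Y"
    by metis
  \<comment> \<open>the default value \<open>a\<close> of the product measure is the perturbation of the last pair\<close>
  define PP where "PP = Pi_pmf {..<h} a (\<lambda>_. P)"
  define QQ where "QQ = Pi_pmf {..<h} a (\<lambda>_. Q)"
  have finPQ: "finite (set_pmf PP)" "finite (set_pmf QQ)"
    unfolding PP_def QQ_def using fin by (auto simp: set_Pi_pmf intro!: finite_PiE_dflt)
  have valid: "valid Y" if "Y \<in> set_pmf PP \<union> set_pmf QQ" for Y
    using that by (auto simp: PP_def QQ_def set_Pi_pmf PiE_dflt_def valid_def U_def)
  have L0: "0 \<le> L Y" for Y unfolding L_def using \<epsilon> by (intro divide_nonneg_nonneg mult_nonneg_nonneg sum_nonneg) auto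
  define c where "c = \<epsilon> / (2 * real H)"
  have c: "0 < c" using \<epsilon> by (simp add: c_def H_def)
  \<comment> \<open>the distance \<open>\<theta>\<close> is at least \<open>B\<close> as soon as \<open>\<bar>Y k\<bar> \<ge> \<alpha> / m\<close> for all \<open>k < h\<close>\<close>
  define B where "B = cd / 2 * (c * (real h * (\<alpha> / real m) / 2))"
  have B: "0 < B" using cd c h \<alpha> by (simp add: B_def)
  have comp: "?E (Pi_pmf {..<h} a (\<lambda>_. R)) (\<lambda>Y. f (Y k)) = ?E R f" if "k < h" for R and f :: "real \<Rightarrow> real" and k
  proof -
    have "?E (Pi_pmf {..<h} a (\<lambda>_. R)) (\<lambda>Y. f (Y k)) = ?E (map_pmf (\<lambda>Y. Y k) (Pi_pmf {..<h} a (\<lambda>_. R))) f"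
      by simp
    then show ?thesis using that by (simp add: Pi_pmf_component)
  qed
  have mean0: "?E PP (\<lambda>Y. \<theta> (A Y) (T Y)) \<le> B / 8"
  proof -
    have "?E PP (\<lambda>Y. \<theta> (A Y) (T Y)) \<le> ?E PP (\<lambda>Y. Cd / 2 * (c * ((\<Sum>k<h. \<bar>Y k\<bar>) + a)))"
    proof (rule expectation_mono_finite[OF finPQ(1)])
      fix Y assume Y: "Y \<in> set_pmf PP"
      then have v: "valid Y" using valid by blast
      have "(\<Sum>k<H. \<bar>X Y k\<bar>) \<le> (\<Sum>k<H. \<bar>Y k\<bar>)" by (intro sum_mono sX) simp
      also have "\<dots> = (\<Sum>k<h. \<bar>Y k\<bar>) + a" using v a by (simp add: H_def valid_def)
      finally have "c * (\<Sum>k<H. \<bar>X Y k\<bar>) \<le> c * ((\<Sum>k<h. \<bar>Y k\<bar>) + a)" using c by (intro mult_left_mono) auto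
      then have "L Y \<le> c * ((\<Sum>k<h. \<bar>Y k\<bar>) + a)" by (simp add: L_def c_def)
      then have "Cd / 2 * L Y \<le> Cd / 2 * (c * ((\<Sum>k<h. \<bar>Y k\<bar>) + a))" using cd by (intro mult_left_mono) auto
      with AT(5)[OF v] show "\<theta> (A Y) (T Y) \<le> Cd / 2 * (c * ((\<Sum>k<h. \<bar>Y k\<bar>) + a))" by linarith
    qed
    also have "\<dots> = Cd / 2 * (c * ((\<Sum>k<h. ?E PP (\<lambda>Y. \<bar>Y k\<bar>)) + a))"
    proof -
      have int: "integrable PP g" for g :: "(nat \<Rightarrow> real) \<Rightarrow> real" by (rule integrable_measure_pmf_finite[OF finPQ(1)])
      show ?thesis
        by (simp add: Bochner_Integration.integral_add[OF int int] Bochner_Integration.integral_sum[OF int])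
    qed
    also have "\<dots> = Cd / 2 * (c * (real h * ?E P abs + a))"
      using comp[of _ P abs] by (simp add: PP_def)
    also have "\<dots> \<le> Cd / 2 * (c * (real h * a + real h * a))"
    proof -
      have "real h * ?E P abs \<le> real h * a" using EP by (intro mult_left_mono) (auto simp: a_def)
      moreover have "1 * a \<le> real h * a" using h a by (intro mult_right_mono) auto
      ultimately have "real h * ?E P abs + a \<le> real h * a + real h * a" by linarith
      then show ?thesis using cd c by (intro mult_left_mono) auto
    qed
    also have "\<dots> = B / 8"
      using cd h by (simp add: B_def a_def \<alpha>_def power2_eq_square field_simps)
    finally show ?thesis .
  qed
  have mean1: "B / 2 \<le> ?E QQ (\<lambda>Y. min (\<theta> (A Y) (T Y)) B)"
  proof -
    let ?g = "\<lambda>Y. cd / 2 * (c * (\<Sum>k<h. min \<bar>Y k\<bar> (\<alpha> / real m) / 2))"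
    have "B / 2 = cd / 2 * (c * (\<Sum>k<h. \<alpha> / (2 * real m) / 2))"
      by (simp add: B_def)
    also have "\<dots> \<le> cd / 2 * (c * (\<Sum>k<h. ?E QQ (\<lambda>Y. min \<bar>Y k\<bar> (\<alpha> / real m)) / 2))"
    proof (intro mult_left_mono sum_mono divide_right_mono)
      fix k assume "k \<in> {..<h}"
      then show "\<alpha> / (2 * real m) \<le> ?E QQ (\<lambda>Y. min \<bar>Y k\<bar> (\<alpha> / real m))"
        using comp[of k Q "\<lambda>u. min \<bar>u\<bar> (\<alpha> / real m)"] EQ by (simp add: QQ_def)
    qed (use cd c in auto)
    also have "\<dots> = ?E QQ ?g"
    proof -
      have int: "integrable QQ g" for g :: "(nat \<Rightarrow> real) \<Rightarrow> real" by (rule integrable_measure_pmf_finite[OF finPQ(2)])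
      show ?thesis by (simp add: Bochner_Integration.integral_sum[OF int])
    qed
    also have "\<dots> \<le> ?E QQ (\<lambda>Y. min (\<theta> (A Y) (T Y)) B)"
    proof (rule expectation_mono_finite[OF finPQ(2)])
      fix Y assume "Y \<in> set_pmf QQ"
      then have v: "valid Y" using valid by blast
      have "(\<Sum>k<h. min \<bar>Y k\<bar> (\<alpha> / real m) / 2) \<le> (\<Sum>k<h. \<bar>X Y k\<bar>)"
      proof (rule sum_mono)
        fix k assume "k \<in> {..<h}"
        then have "\<bar>Y k\<bar> / 2 \<le> \<bar>X Y k\<bar>" by (intro sX) (simp add: H_def)
        moreover have "min \<bar>Y k\<bar> (\<alpha> / real m) / 2 \<le> \<bar>Y k\<bar> / 2" by (intro divide_right_mono) auto
        ultimately show "min \<bar>Y k\<bar> (\<alpha> / real m) / 2 \<le> \<bar>X Y k\<bar>" by (rule order_trans[rotated])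
      qed
      also have "\<dots> \<le> (\<Sum>k<H. \<bar>X Y k\<bar>)" by (simp add: H_def)
      finally have "c * (\<Sum>k<h. min \<bar>Y k\<bar> (\<alpha> / real m) / 2) \<le> c * (\<Sum>k<H. \<bar>X Y k\<bar>)"
        using c by (intro mult_left_mono) auto
      also have "\<dots> = L Y" by (simp add: L_def c_def)
      finally have "?g Y \<le> cd / 2 * L Y" using cd by (intro mult_left_mono) auto
      with AT(4)[OF v] have "?g Y \<le> \<theta> (A Y) (T Y)" by linarith
      moreover have "(\<Sum>k<h. min \<bar>Y k\<bar> (\<alpha> / real m) / 2) \<le> (\<Sum>k<h. \<alpha> / real m / 2)"
        by (intro sum_mono divide_right_mono) auto
      then have "?g Y \<le> cd / 2 * (c * (\<Sum>k<h. \<alpha> / real m / 2))"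
        using cd c by (intro mult_left_mono) auto
      then have "?g Y \<le> B" by (simp add: B_def)
      ultimately show "?g Y \<le> min (\<theta> (A Y) (T Y)) B" by simp
    qed
    finally show ?thesis .
  qed
  have close: "\<bar>?E QQ (\<lambda>Y. ?E (topic_data_pmf N (A Y) (T Y)) \<Phi>) - ?E PP (\<lambda>Y. ?E (topic_data_pmf N (A Y) (T Y)) \<Phi>)\<bar> \<le> B / 16"
    if \<Phi>: "\<And>y. \<bar>\<Phi> y\<bar> \<le> B" for \<Phi>
  proof -
    have "?E QQ (\<lambda>Y. ?E (topic_data_pmf N (A Y) (T Y)) \<Phi>) = ?E QQ (F \<Phi>)"
      "?E PP (\<lambda>Y. ?E (topic_data_pmf N (A Y) (T Y)) \<Phi>) = ?E PP (F \<Phi>)"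
      using valid AT(3) by (auto intro!: expectation_cong_pmf)
    moreover have "\<bar>?E QQ (F \<Phi>) - ?E PP (F \<Phi>)\<bar> \<le> real (card {..<h}) * (3 * B / 16 ^ (m + 1))"
      unfolding PP_def QQ_def
    proof (rule product_prior_difference[OF _ fin sub])
      fix x :: nat and f :: "nat \<Rightarrow> real"
      assume x: "x \<in> {..<h}" and f: "range f \<subseteq> {-1..1}"
      have xH: "x < H" using x by (simp add: H_def)
      have upd: "(\<lambda>k. \<epsilon> * X (f(x := u)) k) = (\<lambda>k. \<epsilon> * X f k)(x := (\<epsilon> * s x) * u)" for u
        by (auto simp: X_def)
      have Feq: "F \<Phi> (f(x := u)) = (\<Sum>xs | set xs \<subseteq> {..<p} \<and> length xs = N.
          post \<Phi> xs * prod_list (map (\<lambda>v. base v * (1 + bump ((\<lambda>k. \<epsilon> * X f k)(x := (\<epsilon> * s x) * u)) v)) xs))" for u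
        unfolding F_def upd ..
      show "\<bar>?E Q (\<lambda>u. F \<Phi> (f(x := u))) - ?E P (\<lambda>u. F \<Phi> (f(x := u)))\<bar> \<le> 3 * B / 16 ^ (m + 1)"
        unfolding Feq
      proof (rule coordinate_change_bound[OF fin sub])
        show "?E P (\<lambda>u. u ^ t) = ?E Q (\<lambda>u. u ^ t)" if "t < 2 * (m + 1)" for t using mom that by simp
        show "x < H" by (rule xH)
        show "\<bar>\<epsilon> * X f k\<bar> \<le> 1" if "k < H" for k
        proof -
          have "\<bar>f k\<bar> \<le> 1" using f by (auto simp: abs_le_iff image_subset_iff minus_le_iff)
          then have "\<bar>X f k\<bar> \<le> 1" using sX(1)[OF that, of f] by linarith
          then show ?thesis unfolding abs_mult using \<epsilon> by (intro mult_le_one) auto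
        qed
        have "(\<epsilon> * s x)\<^sup>2 \<le> \<epsilon>\<^sup>2"
          using \<epsilon> s[OF xH] \<rho> by (intro power_mono mult_left_le) auto
        then have "real N * (\<epsilon> * s x)\<^sup>2 \<le> real N * \<epsilon>\<^sup>2" by (intro mult_left_mono) auto
        also have "\<dots> \<le> real H / 8" using \<epsilon>(3) by (simp add: H_def)
        finally show "real N * (\<epsilon> * s x)\<^sup>2 \<le> real H / 8" .
        show "\<bar>post \<Phi> xs\<bar> \<le> B" for xs
          unfolding post_def by (rule abs_expectation_le[OF finite_set_other_docs \<Phi>])
      qed
    qed (use a in auto)
    moreover have "real (card {..<h}) * (3 * B / 16 ^ (m + 1)) \<le> B / 16"
    proof -
      have "real h * 3 \<le> 3 ^ m * 3" using h(3) exp_le_power3[of m] by linarith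
      also have "\<dots> \<le> 16 ^ m"
      proof -
        obtain m' where m': "m = Suc m'" using h(2) by (cases m) auto
        have "(3::real) ^ m' * 9 \<le> 16 ^ m' * 16" by (intro mult_mono power_mono) auto
        then show ?thesis by (simp add: m')
      qed
      finally have "real h * 3 * B \<le> 16 ^ m * B" using B by (intro mult_right_mono) auto
      then show ?thesis by (simp add: field_simps)
    qed
    ultimately show ?thesis by linarith
  qed
  have t: "cd\<^sup>2 / Cd * (\<epsilon> / real m) / 28672 \<le> B / 8"
  proof -
    have "real H \<le> 2 * real h" using h by (simp add: H_def)
    then have "1 / 4 \<le> real h / (2 * real H)" using h by (simp add: field_simps H_def)
    have "cd\<^sup>2 / Cd * (\<epsilon> / real m) / 28672 = (cd * \<epsilon> * \<alpha> / (32 * real m)) * (1 / 4)"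
      by (simp add: \<alpha>_def power2_eq_square mult_ac)
    also have "\<dots> \<le> (cd * \<epsilon> * \<alpha> / (32 * real m)) * (real h / (2 * real H))"
      using \<open>1 / 4 \<le> real h / (2 * real H)\<close> cd \<epsilon> \<alpha> by (intro mult_left_mono) auto
    also have "\<dots> = B / 8" by (simp add: B_def c_def mult_ac)
    finally show ?thesis .
  qed
  have "ennreal (B / 8) \<le> minimax_risk d N (topic_models (1/4) (1/4) n p K \<tau> i j) i j"
    unfolding minimax_risk_def
  proof (rule INF_greatest, rule ccontr)
    fix W :: "(nat \<Rightarrow> nat vec) \<Rightarrow> real"
    assume "\<not> ennreal (B / 8) \<le> (SUP (A, T)\<in>topic_models (1/4) (1/4) n p K \<tau> i j.
        \<integral>\<^sup>+Y. ennreal \<bar>W Y - wasserstein d (mixing_measure A (col T i)) (mixing_measure A (col T j))\<bar>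
          \<partial>measure_pmf (topic_data_pmf N A T))"
    then have small: "(\<integral>\<^sup>+Y. ennreal \<bar>W Y - \<theta> A T\<bar> \<partial>measure_pmf (topic_data_pmf N A T)) \<le> ennreal (B / 8)"
      if "(A, T) \<in> topic_models (1/4) (1/4) n p K \<tau> i j" for A T
      using SUP_upper[OF that, of "\<lambda>(A, T). \<integral>\<^sup>+Y. ennreal \<bar>W Y - \<theta> A T\<bar> \<partial>measure_pmf (topic_data_pmf N A T)"]
      unfolding \<theta>_def by (simp add: not_le)
    have "?E QQ (\<lambda>Y. min (\<theta> (A Y) (T Y)) B) - ?E PP (\<lambda>Y. \<theta> (A Y) (T Y)) \<le> 2 * (B / 8) + B / 16"
    proof (rule fuzzy_hypotheses[OF finPQ, where D="\<lambda>Y. topic_data_pmf N (A Y) (T Y)" and W=W])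
      fix Y assume "Y \<in> set_pmf PP \<union> set_pmf QQ"
      then have v: "valid Y" by (rule valid)
      show finD: "finite (set_pmf (topic_data_pmf N (A Y) (T Y)))" by (rule AT(2)[OF v])
      have "ennreal (?E (topic_data_pmf N (A Y) (T Y)) (\<lambda>y. \<bar>W y - \<theta> (A Y) (T Y)\<bar>))
          = (\<integral>\<^sup>+y. ennreal \<bar>W y - \<theta> (A Y) (T Y)\<bar> \<partial>measure_pmf (topic_data_pmf N (A Y) (T Y)))"
        by (rule nn_integral_eq_integral[symmetric]) (auto intro: integrable_measure_pmf_finite finD)
      also have "\<dots> \<le> ennreal (B / 8)" by (rule small[OF AT(1)[OF v]])
      finally show "?E (topic_data_pmf N (A Y) (T Y)) (\<lambda>y. \<bar>W y - \<theta> (A Y) (T Y)\<bar>) \<le> B / 8"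
        using B by (simp add: ennreal_le_iff)
    next
      fix Y assume "Y \<in> set_pmf PP"
      then have "cd / 2 * L Y \<le> \<theta> (A Y) (T Y)" using valid AT(4) by blast
      moreover have "0 \<le> cd / 2 * L Y" using L0[of Y] cd by simp
      ultimately show "0 \<le> \<theta> (A Y) (T Y)" by linarith
    qed (use B close in auto)
    with mean0 mean1 B show False by linarith
  qed
  moreover have "ennreal (cd\<^sup>2 / Cd * (\<epsilon> / real m) / 28672) \<le> ennreal (B / 8)"
    by (rule ennreal_leI[OF t])
  ultimately show ?thesis by (rule order_trans[rotated])
qed

section \<open>The two rates\<close>

lemma l1_norm_submatrix_unit_vec_le:
  assumes A: "A \<in> carrier_mat p K" and col: "\<And>k. k < K \<Longrightarrow> col A k \<in> prob_simplex p"
    and I: "I \<subseteq> {..<p}" and K: "0 < K"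
  shows "l1_norm (submatrix A I {..<K} *\<^sub>v unit_vec K 0) \<le> 1"
proof -
  let ?B = "submatrix A I {..<K}"
  let ?c = "pick {..<K} 0"
  have finI: "finite I" using I by (rule finite_subset) simp
  have rows: "{v. v < dim_row A \<and> v \<in> I} = I" using A I by auto
  have cols: "{k. k < dim_col A \<and> k \<in> {..<K}} = {..<K}" using A by auto
  have dims: "dim_row ?B = card I" "dim_col ?B = K"
    unfolding dim_submatrix rows cols by simp_all
  have "?c \<in> {..<K}" using K by (intro pick_in_set_le) simp
  then have c: "?c < K" by simp
  have nonneg: "0 \<le> A $$ (v, ?c)" if "v < p" for v
    using col[OF c] that A c by (auto simp: prob_simplex_def)
  have entry: "(?B *\<^sub>v unit_vec K 0) $ v = A $$ (pick I v, ?c)" if "v < card I" for v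
  proof -
    have "(?B *\<^sub>v unit_vec K 0) $ v = ?B $$ (v, 0)"
      using that dims K by simp
    also have "\<dots> = A $$ (pick I v, ?c)"
      by (rule submatrix_index) (use that K rows cols in auto)
    finally show ?thesis .
  qed
  have "l1_norm (?B *\<^sub>v unit_vec K 0) = (\<Sum>v<card I. \<bar>A $$ (pick I v, ?c)\<bar>)"
    unfolding l1_norm_def using dims entry by (intro sum.cong) auto
  also have "\<dots> = (\<Sum>v\<in>pick I ` {..<card I}. \<bar>A $$ (v, ?c)\<bar>)"
  proof (rule sum.reindex[symmetric, unfolded o_def])
    show "inj_on (pick I) {..<card I}"
    proof (rule inj_onI)
      fix x y assume "x \<in> {..<card I}" "y \<in> {..<card I}" "pick I x = pick I y"
      then show "x = y"
        using pick_mono_le[of y I x] pick_mono_le[of x I y] by (metis lessThan_iff less_irrefl linorder_neqE_nat)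
    qed
  qed
  also have "\<dots> \<le> (\<Sum>v<p. \<bar>A $$ (v, ?c)\<bar>)"
    using pick_in_set_le[of _ I] I by (intro sum_mono2) auto
  also have "\<dots> = (\<Sum>v<p. col A ?c $ v)"
    using nonneg A c by (intro sum.cong) auto
  also have "\<dots> = 1" using col[OF c] by (simp add: prob_simplex_def)
  finally show ?thesis .
qed

text \<open>
  The unit vector of a topic lies in the cone of that topic. Every quotient is nonnegative, so the
  bound from below holds for the infimum as well.
\<close>

lemma kappa_in_unit_interval:
  assumes K: "0 < dim_col B" and k: "1 \<le> k"
    and le: "l1_norm (B *\<^sub>v unit_vec (dim_col B) 0) \<le> 1"
  shows "0 \<le> kappa B k" "kappa B k \<le> 1"
proof -
  let ?K = "dim_col B"
  let ?V = "{l1_norm (B *\<^sub>v v) / l1_norm v | S v. S \<subseteq> {..<?K} \<and> card S \<le> k \<and> v \<in> sparse_cone ?K S}"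
  let ?e = "unit_vec ?K 0 :: real vec"
  have l1: "l1_norm ?e = 1"
  proof -
    have "l1_norm ?e = (\<Sum>i<?K. if i = 0 then 1 else 0)"
      unfolding l1_norm_def by (intro sum.cong) (auto simp: unit_vec_def)
    then show ?thesis using K by simp
  qed
  have "?e \<in> sparse_cone ?K {0}"
  proof -
    have "?e \<noteq> 0\<^sub>v ?K" using K by (metis index_unit_vec(2) index_zero_vec(1) zero_neq_one)
    then show ?thesis using K by (simp add: sparse_cone_def)
  qed
  then have mem: "l1_norm (B *\<^sub>v ?e) / l1_norm ?e \<in> ?V"
    using K k by (intro CollectI exI[of _ "{0}"] exI[of _ ?e]) auto
  have nonneg: "0 \<le> x" if "x \<in> ?V" for x
    using that by (auto simp: l1_norm_def intro!: divide_nonneg_nonneg sum_nonneg)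
  show "0 \<le> kappa B k"
    unfolding kappa_def by (rule cInf_greatest) (use mem nonneg in auto)
  have "kappa B k \<le> l1_norm (B *\<^sub>v ?e) / l1_norm ?e"
    unfolding kappa_def by (rule cInf_lower[OF mem]) (use nonneg in \<open>auto intro!: bdd_belowI[of _ 0]\<close>)
  then show "kappa B k \<le> 1" using le by (simp add: l1)
qed

lemma kappa_bar_in_unit_interval:
  assumes A: "A \<in> Theta_A c c' p K" and K: "0 < K" and \<tau>: "1 \<le> \<tau>"
  shows "0 \<le> kappa_bar \<tau> A" "kappa_bar \<tau> A \<le> 1"
proof -
  have A': "A \<in> carrier_mat p K" "\<And>k. k < K \<Longrightarrow> col A k \<in> prob_simplex p"
    using A by (auto simp: Theta_A_def)
  let ?f = "\<lambda>\<alpha>. kappa (submatrix A (J_bar A \<alpha>) {..<dim_col A}) (l0_norm \<alpha>)"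
  have f: "0 \<le> ?f \<alpha> \<and> ?f \<alpha> \<le> 1" if \<alpha>: "\<alpha> \<in> Theta_alpha K \<tau>" for \<alpha>
  proof -
    have dim: "dim_col (submatrix A (J_bar A \<alpha>) {..<dim_col A}) = K"
      using A' by (simp add: dim_submatrix)
    have "J_bar A \<alpha> \<subseteq> {..<p}" using A' by (auto simp: J_bar_def)
    then have le: "l1_norm (submatrix A (J_bar A \<alpha>) {..<K} *\<^sub>v unit_vec K 0) \<le> 1"
      using l1_norm_submatrix_unit_vec_le[of A p K "J_bar A \<alpha>"] A' K by blast
    have "1 \<le> l0_norm \<alpha>"
    proof (rule ccontr)
      assume "\<not> 1 \<le> l0_norm \<alpha>"
      then have "card {i. i < dim_vec \<alpha> \<and> \<alpha> $ i \<noteq> 0} = 0" unfolding l0_norm_def by linarith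
      moreover have "finite {i. i < dim_vec \<alpha> \<and> \<alpha> $ i \<noteq> 0}" by simp
      ultimately have "{i. i < dim_vec \<alpha> \<and> \<alpha> $ i \<noteq> 0} = {}" by (simp only: card_0_eq)
      then have "(\<Sum>i<K. \<alpha> $ i) = 0"
        using \<alpha> by (intro sum.neutral) (auto simp: Theta_alpha_def prob_simplex_def)
      then show False using \<alpha> by (simp add: Theta_alpha_def prob_simplex_def)
    qed
    then show ?thesis
      using kappa_in_unit_interval[of "submatrix A (J_bar A \<alpha>) {..<dim_col A}" "l0_norm \<alpha>"] dim K le A' by simp
  qed
  have e: "unit_vec K 0 \<in> Theta_alpha K \<tau>"
  proof -
    have "card {i. i < dim_vec (unit_vec K 0 :: real vec) \<and> (unit_vec K 0 :: real vec) $ i \<noteq> 0} \<le> card {0 :: nat}"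
      by (intro card_mono) (auto simp: unit_vec_def split: if_splits)
    then show ?thesis
      using unit_vec_in_simplex[OF K] \<tau> by (simp add: Theta_alpha_def l0_norm_def)
  qed
  have dK: "dim_col A = K" using A' by simp
  show "0 \<le> kappa_bar \<tau> A"
    unfolding kappa_bar_def by (rule cINF_greatest) (use e f dK in auto)
  have "kappa_bar \<tau> A \<le> ?f (unit_vec K 0)"
    unfolding kappa_bar_def
    by (rule cINF_lower) (use e f dK in \<open>auto intro!: bdd_belowI2[of _ 0]\<close>)
  then show "kappa_bar \<tau> A \<le> 1" using f[OF e] by linarith
qed

text \<open>
  A word is an anchor word of at most one topic.
\<close>

lemma topics_le_anchor_words:
  assumes A: "A \<in> Theta_A c c' p K"
  shows "real K \<le> c * real p"
proof -
  have ex: "\<And>k. k < K \<Longrightarrow> \<exists>v. is_anchor_word A v k" and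
    card: "real (card {v. \<exists>k. is_anchor_word A v k}) \<le> c * real p"
    using A by (auto simp: Theta_A_def)
  from ex obtain f where f: "\<And>k. k < K \<Longrightarrow> is_anchor_word A (f k) k" by metis
  have "inj_on f {..<K}"
  proof (rule inj_onI)
    fix k l assume kl: "k \<in> {..<K}" "l \<in> {..<K}" "f k = f l"
    have "is_anchor_word A (f k) k" by (rule f) (use kl in simp)
    moreover have "is_anchor_word A (f k) l" unfolding kl(3) by (rule f) (use kl in simp)
    ultimately show "k = l" unfolding is_anchor_word_def by (metis less_irrefl)
  qed
  then have "K = card (f ` {..<K})" by (simp add: card_image)
  also have "\<dots> \<le> card {v. \<exists>k. is_anchor_word A v k}"
    by (rule card_mono) (use f in \<open>auto simp: is_anchor_word_def intro: finite_subset[of _ "{..<dim_row A}"]\<close>)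
  finally show ?thesis using card by linarith
qed

text \<open>
  The choice of \<open>m\<close> for up to \<open>x\<close> pairs. The last bound turns the factor \<open>1 / m\<close> of the lower bound into
  the logarithm of the rate.
\<close>

lemma nat_ceiling_ln_bounds:
  assumes "2 \<le> (x::nat)"
  shows "1 \<le> nat \<lceil>ln (real x)\<rceil>" "real x \<le> exp (real (nat \<lceil>ln (real x)\<rceil>))" "real (nat \<lceil>ln (real x)\<rceil>) \<le> 3 * ln (real x)"
proof -
  have "ln 2 \<le> ln (real x)" using assms by simp
  then have ln: "2/3 \<le> ln (real x)" using ln2_ge_two_thirds by linarith
  have ge: "ln (real x) \<le> real (nat \<lceil>ln (real x)\<rceil>)" by linarith
  then show "1 \<le> nat \<lceil>ln (real x)\<rceil>" using ln by linarith
  have "real x = exp (ln (real x))" using assms by simp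
  also have "\<dots> \<le> exp (real (nat \<lceil>ln (real x)\<rceil>))" using ge by simp
  finally show "real x \<le> exp (real (nat \<lceil>ln (real x)\<rceil>))" .
  show "real (nat \<lceil>ln (real x)\<rceil>) \<le> 3 * ln (real x)" using ln by linarith
qed

lemma rate_le:
  fixes l b m x y :: real
  assumes "0 < b" "0 < m" "m \<le> 3 * l" "0 \<le> x" "0 \<le> y"
  shows "sqrt (x / (y * l\<^sup>2)) / (3 * b) \<le> sqrt (x / y) / b / m"
proof -
  have l: "0 < l" using assms by linarith
  have "sqrt (x / (y * l\<^sup>2)) = sqrt (x / y) / l"
    using l by (simp add: real_sqrt_divide real_sqrt_mult)
  then have "sqrt (x / (y * l\<^sup>2)) / (3 * b) = sqrt (x / y) / b / (3 * l)" by simp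
  also have "\<dots> \<le> sqrt (x / y) / b / m"
    using assms l by (intro divide_left_mono) auto
  finally show ?thesis .
qed

theorem theorem3:
  shows "\<exists>c c' c1 c2 c3 :: real.
    0 < c \<and> c < 1 \<and> 0 < c' \<and> 0 < c1 \<and> 0 < c2 \<and> 0 < c3 \<and>
    (\<forall>(n::nat) (N::nat) (p::nat) (K::nat) (\<tau>::nat) (i::nat) (j::nat)
       (d :: real vec \<Rightarrow> real vec \<Rightarrow> real) (cd::real) (Cd::real) (A0 :: real mat).
      0 < N \<longrightarrow> 0 < p \<longrightarrow> K \<le> n \<longrightarrow> \<tau> \<le> K \<longrightarrow> 1 < \<tau> \<longrightarrow>
      real \<tau> \<le> c1 * real N \<longrightarrow> real p * real K \<le> c2 * real n * real N \<longrightarrow>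
      i < n \<longrightarrow> j < n \<longrightarrow> i \<noteq> j \<longrightarrow>
      Metric_space (prob_simplex p) d \<longrightarrow>
      0 < cd \<longrightarrow> cd \<le> Cd \<longrightarrow>
      (\<forall>u\<in>prob_simplex p. \<forall>v\<in>prob_simplex p.
         cd * l1_norm (u - v) \<le> 2 * d u v \<and> 2 * d u v \<le> Cd * l1_norm (u - v)) \<longrightarrow>
      A0 \<in> Theta_A c c' p K \<longrightarrow>
      minimax_risk d N (topic_models c c' n p K \<tau> i j) i j \<ge>
        ennreal (c3 * (cd\<^sup>2 / Cd) *
          ((kappa_bar \<tau> A0)\<^sup>2 * sqrt (real \<tau> / (real N * (ln (real \<tau>))\<^sup>2))
           + sqrt (real p * real K / (real n * real N * (ln (real p))\<^sup>2)))))"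
proof (rule exI[of _ "1/4"], rule exI[of _ "1/4"], rule exI[of _ 1], rule exI[of _ 1],
    rule exI[of _ "1 / (48 * 28672)"], intro conjI allI impI)
  fix n N p K \<tau> i j :: nat and d :: "real vec \<Rightarrow> real vec \<Rightarrow> real" and cd Cd :: real and A0 :: "real mat"
  assume N: "0 < N" and "0 < p" and Kn: "K \<le> n" and \<tau>: "\<tau> \<le> K" "1 < \<tau>" and \<tau>N: "real \<tau> \<le> 1 * real N"
    and pK: "real p * real K \<le> 1 * real n * real N" and ij: "i < n" "j < n" "i \<noteq> j" and cd: "0 < cd" "cd \<le> Cd"
    and "\<forall>u\<in>prob_simplex p. \<forall>v\<in>prob_simplex p.
         cd * l1_norm (u - v) \<le> 2 * d u v \<and> 2 * d u v \<le> Cd * l1_norm (u - v)"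
    and A0: "A0 \<in> Theta_A (1/4) (1/4) p K"
  then have d: "\<And>u v. u \<in> prob_simplex p \<Longrightarrow> v \<in> prob_simplex p \<Longrightarrow>
      cd * l1_norm (u - v) \<le> 2 * d u v \<and> 2 * d u v \<le> Cd * l1_norm (u - v)" by blast
  let ?risk = "minimax_risk d N (topic_models (1/4) (1/4) n p K \<tau> i j) i j"
  \<comment> \<open>all topics have an anchor word in \<open>A0\<close>, so the bound on their number leaves room for the pairs of words\<close>
  have "real K \<le> 1/4 * real p" by (rule topics_le_anchor_words[OF A0])
  then have Kp: "4 * K \<le> p" by linarith
  have K: "2 \<le> K" "2 \<le> \<tau>" "2 \<le> p" using \<tau> Kp by linarith+
  have n: "0 < n" using ij by simp
  define r1 where "r1 = sqrt (real \<tau> / (real N * (ln (real \<tau>))\<^sup>2))"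
  define r2 where "r2 = sqrt (real p * real K / (real n * real N * (ln (real p))\<^sup>2))"
  define s where "s = cd\<^sup>2 / Cd"
  have pos: "0 \<le> r1" "0 \<le> r2" "0 < s" using cd by (simp_all add: r1_def r2_def s_def)
  define m1 where "m1 = nat \<lceil>ln (real \<tau>)\<rceil>"
  define m2 where "m2 = nat \<lceil>ln (real p)\<rceil>"
  note m1 = nat_ceiling_ln_bounds[OF K(2), folded m1_def] and m2 = nat_ceiling_ln_bounds[OF K(3), folded m2_def]
  \<comment> \<open>the factor 1/3 gives \<open>N \<epsilon>\<^sup>2 = \<tau> / 9\<close>\<close>
  have 1: "ennreal (s * (sqrt (real \<tau> / real N) / 3 / real m1) / 28672) \<le> ?risk"
    unfolding s_def
  proof (rule minimax_risk_lower_bound[where h = \<tau>])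
    show "sqrt (real \<tau> / real N) / 3 \<le> 1"
    proof -
      have "sqrt (real \<tau> / real N) \<le> 1" using \<tau>N N by simp
      then show ?thesis by linarith
    qed
    have "real N * (sqrt (real \<tau> / real N) / 3)\<^sup>2 = real \<tau> / 9" using N by (simp add: power_divide)
    then show "real N * (sqrt (real \<tau> / real N) / 3)\<^sup>2 \<le> real (Suc \<tau>) / 8" by simp
  qed (use K Kn Kp \<tau> N m1 ij cd d in auto)
  \<comment> \<open>\<open>K \<le> n\<close> bounds \<open>N \<epsilon>\<^sup>2\<close> by \<open>p / 64\<close>\<close>
  have 2: "ennreal (s * (sqrt (real p * real K / (real n * real N)) / 8 / real m2) / 28672) \<le> ?risk"
    unfolding s_def
  proof (rule minimax_risk_lower_bound[where h = "p div 8"])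
    have "p < 8 * (p div 8) + 8" by presburger
    then have "p \<le> 8 * Suc (p div 8)" by simp
    then have h: "real p \<le> 8 * real (Suc (p div 8))" "p div 8 \<le> p" by linarith+
    show "sqrt (real p * real K / (real n * real N)) / 8 \<le> 1"
    proof -
      have "sqrt (real p * real K / (real n * real N)) \<le> 1" using pK n N by (simp add: divide_le_eq)
      then show ?thesis by linarith
    qed
    have "real N * (sqrt (real p * real K / (real n * real N)) / 8)\<^sup>2 = real p / 64 * (real K / real n)"
      using n N by (simp add: power_divide)
    also have "\<dots> \<le> real p / 64 * 1" using Kn n by (intro mult_left_mono) auto
    also have "\<dots> \<le> real (Suc (p div 8)) / 8" using h by simp
    finally show "real N * (sqrt (real p * real K / (real n * real N)) / 8)\<^sup>2 \<le> real (Suc (p div 8)) / 8" .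
    show "real (p div 8) \<le> exp (real m2)" using m2(2) h(2) by linarith
    have "8 * (p div 8) \<le> p" by (rule times_div_less_eq_dividend)
    moreover have "2 * Suc q + (K - 2) < p" if "8 * q \<le> p" for q
      unfolding mult_Suc_right using that Kp K(1) by linarith
    ultimately show "2 * Suc (p div 8) + (K - 2) < p" by blast
    show "1 \<le> p div 8" using Kp K by linarith
  qed (use K Kn Kp \<tau> N m2 ij cd d n in auto)
  have b1: "r1 / 9 \<le> sqrt (real \<tau> / real N) / 3 / real m1"
    using rate_le[of 3 "real m1" "ln (real \<tau>)" "real \<tau>" "real N"] m1 by (simp add: r1_def)
  have b2: "r2 / 24 \<le> sqrt (real p * real K / (real n * real N)) / 8 / real m2"
    using rate_le[of 8 "real m2" "ln (real p)" "real p * real K" "real n * real N"] m2 by (simp add: r2_def)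
  have "(kappa_bar \<tau> A0)\<^sup>2 \<le> 1"
    using kappa_bar_in_unit_interval[OF A0, of \<tau>] K by (intro power_le_one) auto
  then have "(kappa_bar \<tau> A0)\<^sup>2 * r1 + r2 \<le> r1 + r2" using pos mult_right_mono[of "(kappa_bar \<tau> A0)\<^sup>2" 1 r1] by simp
  also have "\<dots> \<le> 48 * max (r1 / 9) (r2 / 24)" using pos by (simp add: max_def)
  also have "\<dots> \<le> 48 * max (sqrt (real \<tau> / real N) / 3 / real m1) (sqrt (real p * real K / (real n * real N)) / 8 / real m2)"
    using b1 b2 by (intro mult_left_mono max.mono) auto
  finally have le: "1 / (48 * 28672) * s * ((kappa_bar \<tau> A0)\<^sup>2 * r1 + r2)
    \<le> s * max (sqrt (real \<tau> / real N) / 3 / real m1) (sqrt (real p * real K / (real n * real N)) / 8 / real m2) / 28672"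
    using pos by simp
  have "ennreal (s * max (sqrt (real \<tau> / real N) / 3 / real m1) (sqrt (real p * real K / (real n * real N)) / 8 / real m2) / 28672) \<le> ?risk"
    using 1 2 by (simp add: max_def)
  with ennreal_leI[OF le]
  show "ennreal (1 / (48 * 28672) * (cd\<^sup>2 / Cd) *
          ((kappa_bar \<tau> A0)\<^sup>2 * sqrt (real \<tau> / (real N * (ln (real \<tau>))\<^sup>2))
           + sqrt (real p * real K / (real n * real N * (ln (real p))\<^sup>2)))) \<le> ?risk"
    unfolding r1_def r2_def s_def by (rule order_trans)
qed auto

end
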